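(* Let $\rho>1$. Then $$\mathcal{M}_0(1,E_{1/\rho})=S(\rho)\cap\{z:|z|\ge1\}.$$
   Context: For $\rho>1$, $E_{1/\rho}(z)=\sum_{j=0}^\infty \frac{z^j}{\Gamma(1+j/\rho)}$ is the Mittag--Leffler function of order $\rho$. Its sections and tails are $s_n(z)=\sum_{k=0}^n\frac{z^k}{\Gamma(1+k/\rho)}$ and $t_n(z)=\sum_{k=n}^\infty\frac{z^k}{\Gamma(1+k/\rho)}$. For $n\ge1$, $R_n=\frac{\Gamma(1+n/\rho)}{\Gamma(1+(n-1)/\rho)}$. For $\lambda\in\mathbb{C}$, $\mathcal{M}_n(\lambda,E_{1/\rho})$ is the set of all roots $z\in\mathbb{C}$ of $(1-\lambda)s_n(R_nz)-\lambda t_{n+1}(R_nz)=0$; $\mathcal{M}(\lambda,E_{1/\rho})$ is the set of all accumulation points (in $\mathbb{C}$) of the set $\bigcup_{n=1}^\infty\mathcal{M}_n(\lambda,E_{1/\rho})$; and $\mathcal{M}_0(\lambda,E_{1/\rho})=\mathcal{M}(\lambda,E_{1/\rho})\setminus\{z:\arg z=\pm\frac{\pi}{2\rho}\}$, the two rays being understood to include their endpoint $0$. The generalized Szegő curve $S(\rho)$ is the set of all points $\sigma e^{i\phi}$, $\sigma>0$, $-\frac{\pi}{2\rho}\le\phi<2\pi-\frac{\pi}{2\rho}$, such that: (i) if $-\frac{\pi}{2\rho}\le\phi\le\frac{\pi}{2\rho}$, then $\sigma^\rho\cos(\phi\rho)-1-\rho\log\sigma=0$ (all positive solutions $\sigma$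 are included); (ii) if $\frac{\pi}{2\rho}<\phi<2\pi-\frac{\pi}{2\rho}$, then $\sigma=e^{-1/\rho}$. *)

theory Defs
  imports "HOL-Analysis.Analysis"
begin

definition ml_coeff :: "real \<Rightarrow> nat \<Rightarrow> complex" where
  "ml_coeff \<rho> k = 1 / of_real (Gamma (1 + real k / \<rho>))"

definition mittag_leffler :: "real \<Rightarrow> complex \<Rightarrow> complex" where
  "mittag_leffler \<rho> z = (\<Sum>k. ml_coeff \<rho> k * z ^ k)"

definition ml_section :: "real \<Rightarrow> nat \<Rightarrow> complex \<Rightarrow> complex" where
  "ml_section \<rho> n z = (\<Sum>k\<le>n. ml_coeff \<rho> k * z ^ k)"

definition ml_tail :: "real \<Rightarrow> nat \<Rightarrow> complex \<Rightarrow> complex" where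
  "ml_tail \<rho> n z = (\<Sum>k. ml_coeff \<rho> (n + k) * z ^ (n + k))"

lemma Gamma_shift_ge:
  fixes x s :: real
  assumes x: "x > 1" and s: "s > 0"
  shows "Gamma (x + s) \<ge> (x - 1) powr s * Gamma x"
proof -
  let ?f = "ln \<circ> Gamma :: real \<Rightarrow> real"
  have c: "convex_on {0<..} ?f" by (rule log_convex_Gamma_real)
  have eq2: "1 - s / (1 + s) = 1 / (1 + s)"
    using s by (simp add: field_simps)
  have "(1 / (1 + s)) * (x + s) + (s / (1 + s)) * (x - 1) = (x * (1 + s)) / (1 + s)"
    by (simp add: add_divide_distrib[symmetric] algebra_simps)
  hence eq1: "(1 - s / (1 + s)) *\<^sub>R (x + s) + (s / (1 + s)) *\<^sub>R (x - 1) = x"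
    using s unfolding eq2 by simp
  have "?f ((1 - s / (1 + s)) *\<^sub>R (x + s) + (s / (1 + s)) *\<^sub>R (x - 1))
        \<le> (1 - s / (1 + s)) * ?f (x + s) + (s / (1 + s)) * ?f (x - 1)"
    by (rule convex_onD[OF c]) (use x s in auto)
  hence "ln (Gamma x) \<le> (1 / (1 + s)) * ln (Gamma (x + s)) + (s / (1 + s)) * ln (Gamma (x - 1))"
    unfolding eq1 unfolding eq2 by simp
  also have "\<dots> = (ln (Gamma (x + s)) + s * ln (Gamma (x - 1))) / (1 + s)"
    by (simp add: add_divide_distrib)
  finally have "ln (Gamma x) * (1 + s) \<le> ln (Gamma (x + s)) + s * ln (Gamma (x - 1))"
    using s by (simp add: pos_le_divide_eq)
  moreover have "x - 1 \<notin> \<int>\<^sub>\<le>\<^sub>0"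
    using x nonpos_Ints_nonpos[of "x - 1"] by linarith
  hence "Gamma x = (x - 1) * Gamma (x - 1)"
    using Gamma_plus1[of "x - 1"] by simp
  hence "ln (Gamma x) = ln (x - 1) + ln (Gamma (x - 1))"
    using x by (simp add: ln_mult_pos)
  ultimately have "s * ln (x - 1) + ln (Gamma x) \<le> ln (Gamma (x + s))"
    by (simp add: algebra_simps)
  hence "exp (s * ln (x - 1) + ln (Gamma x)) \<le> exp (ln (Gamma (x + s)))" by simp
  thus ?thesis using x s by (simp add: exp_add powr_def)
qed

lemma summable_mittag_leffler:
  assumes "\<rho> > 0"
  shows "summable (\<lambda>k. ml_coeff \<rho> k * z ^ k)"
proof -
  define s where "s = 1 / \<rho>"
  have s: "s > 0" using assms by (simp add: s_def)
  define N where "N = nat \<lceil>\<rho> * (2 * norm z + 1) powr \<rho>\<rceil> + 1"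
  show ?thesis
  proof (rule summable_ratio_test[where c = "1/2" and N = N])
    fix k assume k: "k \<ge> N"
    define x where "x = 1 + real k / \<rho>"
    have kpos: "k > 0" using k by (simp add: N_def)
    hence x: "x > 1" using assms by (simp add: x_def)
    have "\<rho> * (2 * norm z + 1) powr \<rho> \<le> real k" using k unfolding N_def by linarith
    hence "(2 * norm z + 1) powr \<rho> \<le> x - 1"
      using assms by (simp add: x_def field_simps)
    hence "((2 * norm z + 1) powr \<rho>) powr s \<le> (x - 1) powr s"
      using s by (intro powr_mono2) auto
    moreover have "2 * norm z + 1 > 0"
      using norm_ge_zero[of z] by linarith
    ultimately have "2 * norm z \<le> (x - 1) powr s"
      using assms by (simp add: powr_powr s_def)
    hence "2 * norm z * Gamma x \<le> (x - 1) powr s * Gamma x"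
      using x by (intro mult_right_mono) (auto simp: less_imp_le)
    also have "\<dots> \<le> Gamma (x + s)" by (rule Gamma_shift_ge) (use x s in auto)
    finally have le: "2 * norm z * Gamma x \<le> Gamma (x + s)" .
    have pos: "Gamma x > 0" "Gamma (x + s) > 0" using x s by auto
    have "norm z / Gamma (x + s) \<le> 1 / 2 * (1 / Gamma x)"
      using le pos by (simp add: field_simps)
    hence "norm z / Gamma (x + s) * norm z ^ k \<le> 1 / 2 * (1 / Gamma x) * norm z ^ k"
      by (rule mult_right_mono) auto
    moreover have "1 + real (Suc k) / \<rho> = x + s"
      by (simp add: x_def s_def add_divide_distrib)
    ultimately show "norm (ml_coeff \<rho> (Suc k) * z ^ Suc k) \<le> 1 / 2 * norm (ml_coeff \<rho> k * z ^ k)"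
      using pos by (simp add: ml_coeff_def norm_mult norm_divide norm_power x_def[symmetric])
  qed auto
qed

lemma mittag_leffler_eq_section_plus_tail:
  assumes "\<rho> > 0"
  shows "mittag_leffler \<rho> z = ml_section \<rho> n z + ml_tail \<rho> (Suc n) z"
  using suminf_split_initial_segment[OF summable_mittag_leffler[OF assms], of z "Suc n"]
  by (simp add: mittag_leffler_def ml_section_def ml_tail_def lessThan_Suc_atMost add.commute)

definition ml_R :: "real \<Rightarrow> nat \<Rightarrow> real" where
  "ml_R \<rho> n = Gamma (1 + real n / \<rho>) / Gamma (1 + (real n - 1) / \<rho>)"

definition ml_roots :: "real \<Rightarrow> nat \<Rightarrow> complex \<Rightarrow> complex set" where
  "ml_roots \<rho> n l = {z. (1 - l) * ml_section \<rho> n (of_real (ml_R \<rho> n) * z)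
                        - l * ml_tail \<rho> (n + 1) (of_real (ml_R \<rho> n) * z) = 0}"

definition ml_acc :: "real \<Rightarrow> complex \<Rightarrow> complex set" where
  "ml_acc \<rho> l = {z. z islimpt (\<Union>n\<in>{1..}. ml_roots \<rho> n l)}"

text \<open>The origin is listed explicitly because \<^term>\<open>Arg 0 = 0\<close> in the library, whereas
  both rays are to contain their endpoint.\<close>

definition critical_rays :: "real \<Rightarrow> complex set" where
  "critical_rays \<rho> = {z. z = 0 \<or> Arg z = pi / (2 * \<rho>) \<or> Arg z = - (pi / (2 * \<rho>))}"

definition ml_acc0 :: "real \<Rightarrow> complex \<Rightarrow> complex set" where
  "ml_acc0 \<rho> l = ml_acc \<rho> l - critical_rays \<rho>"

definition szego_curve :: "real \<Rightarrow> complex set" where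
  "szego_curve \<rho> = {of_real \<sigma> * cis \<phi> | \<sigma> \<phi>.
      \<sigma> > 0 \<and> - (pi / (2 * \<rho>)) \<le> \<phi> \<and> \<phi> < 2 * pi - pi / (2 * \<rho>) \<and>
      (\<phi> \<le> pi / (2 * \<rho>) \<longrightarrow> \<sigma> powr \<rho> * cos (\<phi> * \<rho>) - 1 - \<rho> * ln \<sigma> = 0) \<and>
      (pi / (2 * \<rho>) < \<phi> \<longrightarrow> \<sigma> = exp (- (1 / \<rho>)))}"

end

theory Submission
  imports Defs "HOL-Complex_Analysis.Complex_Analysis" "HOL-Real_Asymp.Real_Asymp"
begin

text \<open>For \<open>\<lambda> = 1\<close> the roots are the zeros of \<open>E(R\<^sub>n z) - s\<^sub>n(R\<^sub>n z)\<close>. Put \<open>M = R\<^sub>n\<^sup>\<rho>\<close>, so that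
  \<open>M \<sim> n / \<rho>\<close>. Near a point with \<open>|z| \<ge> 1\<close>, \<open>z \<noteq> 1\<close>, the section has size \<open>exp (M (1 + \<rho> log |z| + o(1)))\<close>
  because its last term is its largest one and the coefficients decrease from there
  (Abel summation, as in the Enestroem-Kakeya theorem, excludes cancellation). The function \<open>E\<close> is
  \<open>\<rho> exp (M z\<^sup>\<rho>)\<close>, present only for \<open>|arg z| < \<pi> / (2 \<rho>)\<close>, up to an error \<open>exp (\<epsilon> M)\<close>: write
  \<open>1 / \<Gamma>\<close> as an inverse Laplace integral over a vertical line, sum under the integral, and move the
  line to \<open>Re v = \<epsilon>\<close>, which crosses a pole precisely at \<open>v = z\<^sup>\<rho>\<close>. Off the curve \<open>Re z\<^sup>\<rho> = 1 + \<rho> log |z|\<close> one of the two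
  terms dominates, so roots do not accumulate there, and Abel summation again rules out roots with
  \<open>0 < |z| \<le> 1\<close>. At a point of the curve with \<open>|z| > 1\<close>, if the normalised tails had no zeros nearby, their
  \<open>n\<close>-th roots would form a normal family; a limit would have modulus \<open>1\<close> on the side where
  the section dominates and modulus greater than \<open>1\<close> on the other side, which is impossible
  for a holomorphic function.\<close>

subsection \<open>The maximal term and the sections\<close>

text \<open>\<open>ml_R \<rho> n\<close> is the quotient of the coefficients of index n - 1 and n,
  so on the circle of that radius these two terms have equal modulus; log-convexity of Gamma makes
  the radii increase, hence the moduli fall off in both directions from there. The same Abel
  summation therefore serves the reversed section for |z| >= 1 and the tail for |z| <= 1. All
  comparisons are on the scale exp(n): both \<open>ml_R \<rho> n powr \<rho>\<close> and
  \<open>ln (ml_max \<rho> n)\<close> are n / \<rho> + o(n), so factors polynomial in n are harmless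
  and crude bounds for Gamma replace Stirling's formula. An error exp(c M) in E does no damage as
  long as c < 1 + \<rho> log |z|; this is why the line of integration may stay at Re v = c > 0, away
  from the branch cut of v^(1/\<rho>), and no Hankel contour appears. The integrals must converge
  absolutely, so the constant term of E, whose integrand decays only like 1/|v|, is split off. At z
  = 1 the lower bound for the section degenerates; that point lies on the curve and is reached as a
  limit of other points of it.\<close>

lemma Gamma_shift_le:
  fixes x s :: real
  assumes x: "x > 0" and s: "s > 0"
  shows "Gamma (x + s) \<le> (x + s) powr s * Gamma x"
proof -
  let ?f = "ln \<circ> Gamma :: real \<Rightarrow> real"
  \<comment> \<open>The point x + s lies between x and x + s + 1, and the functional equation
    expresses Gamma at the right end through Gamma (x + s) again; the unknown value then stands on
    both sides and can be solved for.\<close>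
  have eq1: "(1 - s / (1 + s)) *\<^sub>R x + (s / (1 + s)) *\<^sub>R (x + s + 1) = x + s"
  proof -
    have "1 - s / (1 + s) = 1 / (1 + s)" using s by (simp add: field_simps)
    moreover have "x + s = (x + s * (x + s + 1)) / (1 + s)" using s add_pos_pos[of 1 s] by (subst eq_divide_eq) (auto simp: algebra_simps)
    ultimately show ?thesis by (simp add: add_divide_distrib)
  qed
  have "?f ((1 - s / (1 + s)) *\<^sub>R x + (s / (1 + s)) *\<^sub>R (x + s + 1))
        \<le> (1 - s / (1 + s)) * ?f x + (s / (1 + s)) * ?f (x + s + 1)"
    by (rule convex_onD[OF log_convex_Gamma_real]) (use x s in auto)
  hence "ln (Gamma (x + s)) \<le> (ln (Gamma x) + s * ln (Gamma (x + s + 1))) / (1 + s)"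
    unfolding eq1 using s by (simp add: divide_simps)
  hence "ln (Gamma (x + s)) * (1 + s) \<le> ln (Gamma x) + s * ln (Gamma (x + s + 1))"
    using s by (simp add: pos_le_divide_eq)
  moreover have "Gamma (x + s + 1) = (x + s) * Gamma (x + s)"
    using x s nonpos_Ints_nonpos[of "x + s"] by (intro Gamma_plus1) force
  hence "ln (Gamma (x + s + 1)) = ln (x + s) + ln (Gamma (x + s))"
    using x s by (simp add: ln_mult_pos)
  ultimately have "ln (Gamma (x + s)) \<le> s * ln (x + s) + ln (Gamma x)"
    by (simp add: algebra_simps)
  hence "exp (ln (Gamma (x + s))) \<le> exp (s * ln (x + s) + ln (Gamma x))" by simp
  thus ?thesis using x s by (simp add: exp_add powr_def)
qed

lemma Gamma_midpoint_le:
  fixes x s :: real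
  assumes "s > 0" "x > s"
  shows "Gamma x ^ 2 \<le> Gamma (x - s) * Gamma (x + s)"
proof -
  let ?f = "ln \<circ> Gamma :: real \<Rightarrow> real"
  have eq: "(1 - 1/2) *\<^sub>R (x - s) + (1/2) *\<^sub>R (x + s) = x"
    by simp (simp add: field_simps)
  have "?f ((1 - 1/2) *\<^sub>R (x - s) + (1/2) *\<^sub>R (x + s))
        \<le> (1 - 1/2) * ?f (x - s) + (1/2) * ?f (x + s)"
    by (rule convex_onD[OF log_convex_Gamma_real]) (use assms in auto)
  hence "2 * ln (Gamma x) \<le> ln (Gamma (x - s)) + ln (Gamma (x + s))"
    unfolding eq by simp
  hence "ln (Gamma x ^ 2) \<le> ln (Gamma (x - s) * Gamma (x + s))"
    using assms by (simp add: ln_mult_pos ln_realpow)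
  moreover have "Gamma x ^ 2 > 0" "Gamma (x - s) * Gamma (x + s) > 0"
    using Gamma_real_pos[of x] Gamma_real_pos[of "x - s"] Gamma_real_pos[of "x + s"] assms
    by (simp_all only: zero_less_power mult_pos_pos diff_gt_0_iff_gt add_pos_pos less_trans[of 0 s x])
  ultimately show ?thesis by simp
qed

text \<open>Applying log-convexity one step further up turns the factor lost by
  \<^term>\<open>Gamma (x + 1) = x * Gamma x\<close> into a quantitative gain.\<close>

lemma Gamma_midpoint_strict:
  fixes x s :: real
  assumes "s > 0" "x > s"
  shows "Gamma x ^ 2 \<le> (1 - s^2 / x^2) * (Gamma (x - s) * Gamma (x + s))"
proof -
  have G: "Gamma (y + 1) = y * Gamma y" if "y > 0" for y :: real
    using that nonpos_Ints_nonpos[of y] by (intro Gamma_plus1) force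
  have "Gamma (x + 1) ^ 2 \<le> Gamma (x - s + 1) * Gamma (x + s + 1)"
    using Gamma_midpoint_le[of s "x + 1"] assms by (simp add: algebra_simps)
  hence "x^2 * Gamma x ^ 2 \<le> (x^2 - s^2) * (Gamma (x - s) * Gamma (x + s))"
    using assms G[of x] G[of "x - s"] G[of "x + s"]
    by (simp add: power_mult_distrib) (simp add: algebra_simps power2_eq_square)
  thus ?thesis using assms by (simp add: divide_simps) (simp add: algebra_simps)
qed

text \<open>By convexity the tangent to ln Gamma at 1 + y lies below its values at y and y + 2. The
  functional equation turns this into ln y <= Digamma (1 + y) <= ln (y + 1), and integrating from 0
  gives both bounds. Their distance is only logarithmic in x, which is lost in the limit
  \<open>ln_ml_max_asymp\<close>.\<close>

lemma ln_Gamma_bounds: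
  fixes x :: real
  assumes x: "x > 0"
  shows "x * ln x - x \<le> ln (Gamma (1 + x))" "ln (Gamma (1 + x)) \<le> (x + 1) * ln (x + 1) - x"
proof -
  have plus1: "ln (Gamma (y + 1)) = ln y + ln (Gamma y)" if "y > 0" for y :: real
    using that nonpos_Ints_nonpos[of y] by (subst Gamma_plus1) (force simp: ln_mult_pos)+
  have der: "((ln \<circ> Gamma) has_real_derivative Digamma y) (at y)" if "y > 0" for y :: real
  proof (subst DERIV_cong_ev[OF refl _ refl])
    show "(ln_Gamma has_real_derivative Digamma y) (at y)" 
      using has_field_derivative_ln_Gamma_real[OF that] .
    show "\<forall>\<^sub>F x in nhds y. (ln \<circ> Gamma) x = ln_Gamma x"
      using eventually_nhds_in_open[of "{0<..}" y] that
      by (auto elim!: eventually_mono simp: ln_Gamma_real_pos)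
  qed
  have tang: "(ln \<circ> Gamma) v - (ln \<circ> Gamma) y \<ge> Digamma y * (v - y)" if "y > 0" "v > 0" for y v :: real
    by (rule convex_on_imp_above_tangent[OF log_convex_Gamma_real])
       (use that der[of y] in \<open>auto simp: interior_open intro: has_field_derivative_at_within\<close>)
  have D1: "Digamma (1 + y) \<ge> ln y" if "y > 0" for y :: real
    using tang[of "1 + y" y] plus1[of y] that by (simp add: algebra_simps)
  have D2: "Digamma (1 + y) \<le> ln (y + 1)" if "y \<ge> 0" for y :: real
    using tang[of "1 + y" "y + 2"] plus1[of "1 + y"] that by (simp add: algebra_simps)
  have nz: "Gamma (1 + y) \<noteq> 0" if "y \<ge> 0" for y :: real
    using Gamma_real_pos[of "1 + y"] that by linarith
  define g where "g = (\<lambda>y. (ln \<circ> Gamma) (1 + y) - (y * ln y - y) :: real)"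
  define h where "h = (\<lambda>y. (y + 1) * ln (y + 1) - y - (ln \<circ> Gamma) (1 + y) :: real)"
  have "g e \<le> g x" if "e > 0" "e \<le> x" for e
  proof (rule DERIV_nonneg_imp_nondecreasing[OF that(2)])
    fix y assume "e \<le> y" "y \<le> x"
    hence y: "y > 0" using that by simp
    have "(g has_real_derivative Digamma (1 + y) - ln y) (at y)"
      unfolding g_def using y nz[of y] by (auto intro!: derivative_eq_intros DERIV_chain2[OF der])
    thus "\<exists>d. (g has_real_derivative d) (at y) \<and> 0 \<le> d" using D1[OF y] by auto
  qed
  \<comment> \<open>The derivative of g contains ln y, so the comparison starts at a positive e; the
    left end 0 is reached as a limit.\<close>
  moreover have "(g \<longlongrightarrow> 0) (at_right 0)"
  proof -
    have "((\<lambda>y::real. y * ln y - y) \<longlongrightarrow> 0) (at_right 0)" by real_asymp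
    moreover have "((\<lambda>y. (ln \<circ> Gamma) (1 + y)) \<longlongrightarrow> (ln \<circ> Gamma) (1 + 0)) (at_right (0::real))"
      by (rule isCont_tendsto_compose[where g = "ln \<circ> Gamma"])
         (auto intro!: DERIV_isCont[OF der] tendsto_eq_intros)
    ultimately have "(g \<longlongrightarrow> (ln \<circ> Gamma) (1 + 0) - 0) (at_right 0)"
      unfolding g_def by (intro tendsto_diff)
    thus ?thesis by simp
  qed
  ultimately have "0 \<le> g x"
    using x eventually_at_right_field[of "\<lambda>e. g e \<le> g x" 0]
    by (intro tendsto_upperbound[of g 0 "at_right 0"]) auto
  thus "x * ln x - x \<le> ln (Gamma (1 + x))" by (simp add: g_def)
  have "h 0 \<le> h x"
  proof (rule DERIV_nonneg_imp_nondecreasing[where f = h])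
    fix y assume y: "0 \<le> y" "y \<le> x"
    have "(h has_real_derivative ln (y + 1) - Digamma (1 + y)) (at y)"
      unfolding h_def using y nz[OF y(1)] by (auto intro!: derivative_eq_intros DERIV_chain2[OF der])
    thus "\<exists>d. (h has_real_derivative d) (at y) \<and> 0 \<le> d" using D2[OF y(1)] by auto
  qed (use x in auto)
  thus "ln (Gamma (1 + x)) \<le> (x + 1) * ln (x + 1) - x" by (simp add: h_def)
qed


section \<open>Abel summation for monotone coefficients\<close>

lemma abel_summation_power:
  fixes e :: "nat \<Rightarrow> real" and q :: complex
  shows "(1 - q) * (\<Sum>k\<le>n. of_real (e k) * q ^ k) =
    (\<Sum>k<n. of_real (e k - e (Suc k)) * (1 - q ^ Suc k)) + of_real (e n) * (1 - q ^ Suc n)"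
  by (induction n) (simp_all add: algebra_simps)

text \<open>The Enestroem-Kakeya argument in quantitative form. Summation by parts is arranged so
  that each difference of coefficients is multiplied by 1 - q^(k+1), whose real part is nonnegative
  in the closed disc; every term can then be dropped, and any chosen set K of them bounds the whole
  from below.\<close>

lemma Re_abel_summation_ge:
  fixes e :: "nat \<Rightarrow> real" and q :: complex
  assumes dec: "\<And>k. k < n \<Longrightarrow> e (Suc k) \<le> e k" and nonneg: "e n \<ge> 0"
    and q: "norm q \<le> 1" and K: "K \<subseteq> {..<n}"
  shows "(\<Sum>k\<in>K. (e k - e (Suc k)) * (1 - Re (q ^ Suc k))) \<le>
    Re ((1 - q) * (\<Sum>k\<le>n. of_real (e k) * q ^ k))"
proof -
  have R: "1 - Re (q ^ j) \<ge> 0" for j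
    using complex_Re_le_cmod[of "q ^ j"] power_le_one[of "norm q" j] q by (simp add: norm_power)
  have "(\<Sum>k\<in>K. (e k - e (Suc k)) * (1 - Re (q ^ Suc k)))
      \<le> (\<Sum>k<n. (e k - e (Suc k)) * (1 - Re (q ^ Suc k)))"
    using K dec R by (intro sum_mono2) (auto simp del: power_Suc intro!: mult_nonneg_nonneg)
  also have "\<dots> \<le> (\<Sum>k<n. (e k - e (Suc k)) * (1 - Re (q ^ Suc k))) + e n * (1 - Re (q ^ Suc n))"
    using nonneg R[of "Suc n"] by simp
  also have "\<dots> = Re ((1 - q) * (\<Sum>k\<le>n. of_real (e k) * q ^ k))"
    by (simp only: abel_summation_power) (simp del: power_Suc)
  finally show ?thesis .
qed

lemma eq_1_if_Re_eq_1:
  assumes "norm z \<le> 1" "Re z = 1"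
  shows "z = 1"
proof -
  have "(Re z)^2 + (Im z)^2 \<le> 1"
    unfolding cmod_power2[symmetric] using assms by (intro power_le_one) auto
  hence "Im z = 0" using assms by simp
  thus ?thesis using assms by (simp add: complex_eq_iff)
qed

text \<open>\<open>ml_max \<rho> n\<close> is the modulus of the \<open>n\<close>-th term of the series on the circle of
  radius \<^term>\<open>ml_R \<rho> n\<close>, where it is the largest one.\<close>

definition ml_max :: "real \<Rightarrow> nat \<Rightarrow> real" where
  "ml_max \<rho> n = ml_R \<rho> n ^ n / Gamma (1 + real n / \<rho>)"

section \<open>Growth of the radii and of the maximal terms\<close>

context
  fixes \<rho> :: real
  assumes rho: "\<rho> > 1"
begin

lemma Gamma_index_pos [simp]: "Gamma (1 + real n / \<rho>) > 0"
  using rho by (intro Gamma_real_pos add_pos_nonneg) auto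

lemma Gamma_index_neq_0 [simp]: "Gamma (1 + real n / \<rho>) \<noteq> 0"
  using Gamma_index_pos[of n] by linarith

lemma ml_R_Suc: "ml_R \<rho> (Suc n) = Gamma (1 + real (Suc n) / \<rho>) / Gamma (1 + real n / \<rho>)"
  by (simp add: ml_R_def)

lemma ml_R_pos [simp]: "n \<ge> 1 \<Longrightarrow> ml_R \<rho> n > 0"
  by (cases n) (simp_all add: ml_R_Suc del: of_nat_Suc)

lemma ml_R_nonneg [simp]: "n \<ge> 1 \<Longrightarrow> ml_R \<rho> n \<ge> 0"
  using ml_R_pos[of n] by linarith

lemma ml_max_pos [simp]: "n \<ge> 1 \<Longrightarrow> ml_max \<rho> n > 0"
  by (simp add: ml_max_def)

lemma ml_R_neq_0 [simp]: "n \<ge> 1 \<Longrightarrow> ml_R \<rho> n \<noteq> 0"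
  using ml_R_pos[of n] by linarith

lemma ml_max_neq_0 [simp]: "n \<ge> 1 \<Longrightarrow> ml_max \<rho> n \<noteq> 0"
  using ml_max_pos[of n] by linarith

text \<open>This is \<open>Gamma_midpoint_strict\<close> with s = 1 / \<rho> and x = 1 + n / \<rho>,
  where s / x = 1 / (\<rho> + n). The gain over plain monotonicity decays only quadratically in n,
  which later keeps the lower bound for the section polynomial.\<close>

lemma ml_R_step:
  assumes "n \<ge> 1"
  shows "ml_R \<rho> n \<le> (1 - 1 / (\<rho> + n)^2) * ml_R \<rho> (Suc n)"
proof -
  obtain m where n: "n = Suc m" using assms by (cases n) auto
  define s x where "s = 1 / \<rho>" and "x = 1 + n / \<rho>"
  have s: "s > 0" "x > s" and sx: "s^2/x^2 = 1 / (\<rho> + n)^2"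
    using rho assms by (auto simp: s_def x_def field_simps)
  have xs: "x - s = 1 + m / \<rho>" "x + s = 1 + Suc n / \<rho>"
    by (simp_all add: x_def s_def n add_divide_distrib)
  have "Gamma x ^ 2 \<le> (1 - 1 / (\<rho> + n)^2) * (Gamma (x - s) * Gamma (x + s))"
    using Gamma_midpoint_strict[OF s] unfolding sx .
  hence "Gamma x / Gamma (x - s) \<le> (1 - 1 / (\<rho> + n)^2) * (Gamma (x + s) / Gamma x)"
    using Gamma_real_pos[of x] Gamma_real_pos[of "x - s"] s
    by (simp only: pos_divide_le_eq diff_gt_0_iff_gt) (simp add: divide_simps power2_eq_square mult_ac)
  thus ?thesis unfolding xs unfolding n ml_R_Suc unfolding x_def n by simp
qed

lemma ml_R_step_less: "n \<ge> 1 \<Longrightarrow> ml_R \<rho> n < ml_R \<rho> (Suc n)"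
proof -
  assume n: "n \<ge> 1"
  have "(1 - 1 / (\<rho> + n)^2) * ml_R \<rho> (Suc n) < 1 * ml_R \<rho> (Suc n)"
    using rho n by (intro mult_strict_right_mono) auto
  thus ?thesis using ml_R_step[OF n] by linarith
qed

lemma ml_R_less: "1 \<le> m \<Longrightarrow> m < n \<Longrightarrow> ml_R \<rho> m < ml_R \<rho> n"
proof (induction n)
  case (Suc n)
  thus ?case using ml_R_step_less[of n] by (cases "m = n") auto
qed simp

lemma ml_R_mono: "1 \<le> m \<Longrightarrow> m \<le> n \<Longrightarrow> ml_R \<rho> m \<le> ml_R \<rho> n"
  using ml_R_less[of m n] by (cases "m = n") auto

text \<open>Both shift inequalities for Gamma are applied with x = 1 + (n - 1) / \<rho> and step 1 /
  \<rho>; raising to the power \<rho> cancels that exponent. For n = 1 the point x would be 1, the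
  excluded boundary value in \<open>Gamma_shift_ge\<close>.\<close>

lemma ml_R_powr_bounds:
  assumes "n \<ge> 2"
  shows "(real n - 1) / \<rho> \<le> ml_R \<rho> n powr \<rho>" "ml_R \<rho> n powr \<rho> \<le> 1 + n / \<rho>"
proof -
  obtain m where n: "n = Suc m" "m \<ge> 1" using assms by (cases n) auto
  define s x where "s = 1 / \<rho>" and "x = 1 + m / \<rho>"
  have sx: "s > 0" "x > 1" and sr: "s * \<rho> = 1" using rho n by (auto simp: s_def x_def)
  have xs: "x + s = 1 + Suc m / \<rho>"
    by (simp add: x_def s_def n add_divide_distrib)
  have R: "ml_R \<rho> n = Gamma (x + s) / Gamma x" unfolding xs unfolding n ml_R_Suc x_def ..
  have "(x - 1) powr s \<le> ml_R \<rho> n"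
    unfolding R using Gamma_shift_ge[OF sx(2,1)] sx by (simp add: pos_le_divide_eq)
  hence "((x - 1) powr s) powr \<rho> \<le> ml_R \<rho> n powr \<rho>" using rho by (intro powr_mono2) auto
  thus "(real n - 1) / \<rho> \<le> ml_R \<rho> n powr \<rho>" using sx sr rho by (simp add: powr_powr x_def n)
  have "ml_R \<rho> n \<le> (x + s) powr s"
    unfolding R using Gamma_shift_le[of x s] sx by (simp add: pos_divide_le_eq)
  hence "ml_R \<rho> n powr \<rho> \<le> ((x + s) powr s) powr \<rho>" using rho assms by (intro powr_mono2) (auto simp: less_imp_le)
  thus "ml_R \<rho> n powr \<rho> \<le> 1 + n / \<rho>" using sx sr rho by (simp add: powr_powr xs n)
qed

lemma ml_R_powr_asymp: "(\<lambda>n. ml_R \<rho> n powr \<rho> / n) \<longlonglongrightarrow> 1 / \<rho>"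
proof (rule tendsto_sandwich)
  show "(\<lambda>n. (real n - 1) / \<rho> / n) \<longlonglongrightarrow> 1 / \<rho>" using rho by (real_asymp; simp add: inverse_eq_divide)
  show "(\<lambda>n. (1 + n / \<rho>) / n) \<longlonglongrightarrow> 1 / \<rho>" using rho by (real_asymp; simp add: inverse_eq_divide)
  show "\<forall>\<^sub>F n in sequentially. (real n - 1) / \<rho> / n \<le> ml_R \<rho> n powr \<rho> / n"
    using eventually_ge_at_top[of 2]
    by eventually_elim (intro divide_right_mono ml_R_powr_bounds, auto)
  show "\<forall>\<^sub>F n in sequentially. ml_R \<rho> n powr \<rho> / n \<le> (1 + n / \<rho>) / n"
    using eventually_ge_at_top[of 2]
    by eventually_elim (intro divide_right_mono ml_R_powr_bounds, auto)
qed

text \<open>With m = n / \<rho>, the logarithm is m ln (\<open>ml_R \<rho> n powr \<rho>\<close>) -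
  ln Gamma (1 + m). The leading parts m ln m cancel, and what survives is the m subtracted in ln
  Gamma. This is the origin of the constant 1 in the equation of the curve.\<close>

lemma ln_ml_max_asymp: "(\<lambda>n. ln (ml_max \<rho> n) / n) \<longlonglongrightarrow> 1 / \<rho>"
proof (rule tendsto_sandwich)
  have eq: "ln (ml_max \<rho> n) = n * (ln (ml_R \<rho> n powr \<rho>) / \<rho>) - ln (Gamma (1 + n / \<rho>))" if "n \<ge> 2" for n
  proof -
    have "ml_R \<rho> n > 0" using that by simp
    thus ?thesis using rho by (simp add: ml_max_def ln_div ln_realpow ln_powr)
  qed
  have bd: "(n * (ln ((real n - 1) / \<rho>) / \<rho>) - ((n / \<rho> + 1) * ln (n / \<rho> + 1) - n / \<rho>)) / n \<le> ln (ml_max \<rho> n) / n \<and>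
       ln (ml_max \<rho> n) / n \<le> (n * (ln (1 + n / \<rho>) / \<rho>) - (n / \<rho> * ln (n / \<rho>) - n / \<rho>)) / n" 
    if n: "n \<ge> 2" for n
    unfolding eq[OF n]
  proof (intro conjI divide_right_mono diff_mono mult_left_mono)
    have Rn: "ml_R \<rho> n > 0" using n by simp
    show "ln ((real n - 1) / \<rho>) \<le> ln (ml_R \<rho> n powr \<rho>)" 
      using ml_R_powr_bounds[OF n] n rho Rn by (subst ln_le_cancel_iff) simp_all
    have Rn: "ml_R \<rho> n > 0" using n by simp
    show "ln (ml_R \<rho> n powr \<rho>) \<le> ln (1 + n / \<rho>)" 
      using ml_R_powr_bounds[OF n] n rho Rn by (subst ln_le_cancel_iff) (simp_all add: add_pos_pos)
  qed (use ln_Gamma_bounds[of "n / \<rho>"] n rho in auto)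
  show "\<forall>\<^sub>F n in sequentially. (n * (ln ((real n - 1) / \<rho>) / \<rho>) - ((n / \<rho> + 1) * ln (n / \<rho> + 1) - n / \<rho>)) / n \<le> ln (ml_max \<rho> n) / n"
    using eventually_ge_at_top[of 2] by eventually_elim (use bd in blast)
  show "\<forall>\<^sub>F n in sequentially. ln (ml_max \<rho> n) / n \<le> (n * (ln (1 + n / \<rho>) / \<rho>) - (n / \<rho> * ln (n / \<rho>) - n / \<rho>)) / n"
    using eventually_ge_at_top[of 2] by eventually_elim (use bd in blast)
  show "(\<lambda>n. (n * (ln ((real n - 1) / \<rho>) / \<rho>) - ((n / \<rho> + 1) * ln (n / \<rho> + 1) - n / \<rho>)) / n) \<longlonglongrightarrow> 1 / \<rho>"
    using rho by (real_asymp; simp add: inverse_eq_divide)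
  show "(\<lambda>n::nat. (n * (ln (1 + n / \<rho>) / \<rho>) - (n / \<rho> * ln (n / \<rho>) - n / \<rho>)) / n) \<longlonglongrightarrow> 1 / \<rho>"
    using rho by (real_asymp; simp add: inverse_eq_divide)
qed


text \<open>The section is read from its top term downwards, as a polynomial in 1 / z: in this order
  its coefficients are nonincreasing, and 1 / z lies in the closed unit disc when |z| >= 1.\<close>

definition sec_coeff :: "nat \<Rightarrow> nat \<Rightarrow> real" where
  "sec_coeff n j = ml_R \<rho> n ^ (n - j) / Gamma (1 + real (n - j) / \<rho>) / ml_max \<rho> n"

lemma sec_coeff_0: "n \<ge> 1 \<Longrightarrow> sec_coeff n 0 = 1"
  using ml_max_pos[of n] by (simp add: sec_coeff_def ml_max_def)

lemma sec_coeff_Suc: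
  assumes "j < n"
  shows "sec_coeff n (Suc j) = sec_coeff n j * (ml_R \<rho> (n - j) / ml_R \<rho> n)"
proof -
  obtain m where m: "n - j = Suc m" "n - Suc j = m" using assms by (cases "n - j") auto
  show ?thesis using assms ml_R_pos[of n] ml_R_pos[of "Suc m"] unfolding sec_coeff_def m
    by (simp add: ml_R_Suc del: of_nat_Suc)
qed

lemma sec_coeff_nonneg: "n \<ge> 1 \<Longrightarrow> sec_coeff n j \<ge> 0"
  unfolding sec_coeff_def 
  using ml_R_pos[of n] ml_max_pos[of n] Gamma_index_pos[of "n - j"]
  by (intro divide_nonneg_nonneg zero_le_power) (auto intro: less_imp_le)

lemma sec_coeff_dec:
  assumes "j < n"
  shows "sec_coeff n (Suc j) \<le> sec_coeff n j"
proof -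
  have "ml_R \<rho> (n - j) / ml_R \<rho> n \<le> 1" using assms ml_R_mono[of "n - j" n] ml_R_pos[of n] by simp
  thus ?thesis unfolding sec_coeff_Suc[OF assms]
    using sec_coeff_nonneg[of n j] assms by (intro mult_left_le) auto
qed

lemma sec_coeff_le_1: "n \<ge> 1 \<Longrightarrow> j \<le> n \<Longrightarrow> sec_coeff n j \<le> 1"
proof (induction j)
  case (Suc j)
  thus ?case using sec_coeff_dec[of j n] by simp
qed (simp add: sec_coeff_0)

lemma ml_section_eq:
  assumes "n \<ge> 1" "z \<noteq> 0"
  shows "ml_section \<rho> n (of_real (ml_R \<rho> n) * z) =
    of_real (ml_max \<rho> n) * z ^ n * (\<Sum>j\<le>n. of_real (sec_coeff n j) * (1 / z) ^ j)"
proof -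
  have "(\<Sum>k\<le>n. ml_coeff \<rho> k * (of_real (ml_R \<rho> n) * z) ^ k) =
      (\<Sum>j\<le>n. ml_coeff \<rho> (n - j) * (of_real (ml_R \<rho> n) * z) ^ (n - j))"
    by (rule sum.reindex_bij_witness[of _ "\<lambda>j. n - j" "\<lambda>j. n - j"]) auto
  also have "\<dots> = (\<Sum>j\<le>n. of_real (ml_max \<rho> n) * z ^ n * (of_real (sec_coeff n j) * (1 / z) ^ j))"
  proof (intro sum.cong refl)
    fix j assume "j \<in> {..n}"
    hence 1: "z ^ n * (1 / z) ^ j = z ^ (n - j)"
      using assms by (simp add: power_diff power_divide)
    have 2: "ml_max \<rho> n * sec_coeff n j = ml_R \<rho> n ^ (n - j) / Gamma (1 + real (n - j) / \<rho>)"
      using ml_max_neq_0[of n] assms by (simp add: sec_coeff_def)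
    have "of_real (ml_max \<rho> n) * z ^ n * (of_real (sec_coeff n j) * (1 / z) ^ j) =
       of_real (ml_max \<rho> n * sec_coeff n j) * (z ^ n * (1 / z) ^ j)" by (simp only: of_real_mult mult_ac)
    thus "ml_coeff \<rho> (n - j) * (of_real (ml_R \<rho> n) * z) ^ (n - j) = 
       of_real (ml_max \<rho> n) * z ^ n * (of_real (sec_coeff n j) * (1 / z) ^ j)"
      unfolding 1 2 by (simp add: ml_coeff_def power_mult_distrib)
  qed
  finally show ?thesis by (simp add: ml_section_def sum_distrib_left)
qed

lemma norm_ml_section_le:
  assumes "n \<ge> 1" "norm z \<ge> 1"
  shows "norm (ml_section \<rho> n (of_real (ml_R \<rho> n) * z)) \<le> (real n + 1) * ml_max \<rho> n * norm z ^ n"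
proof -
  have z: "z \<noteq> 0" using assms by auto
  have "norm (\<Sum>j\<le>n. of_real (sec_coeff n j) * (1 / z) ^ j) \<le> (\<Sum>j\<le>n. 1)"
    using assms sec_coeff_le_1[of n] sec_coeff_nonneg[of n]
    by (intro sum_norm_le) (auto simp: norm_mult norm_power norm_divide divide_le_eq_1 intro!: mult_le_one power_le_one)
  hence "norm (\<Sum>j\<le>n. of_real (sec_coeff n j) * (1 / z) ^ j) \<le> real n + 1" by simp
  hence "ml_max \<rho> n * norm z ^ n * norm (\<Sum>j\<le>n. of_real (sec_coeff n j) * (1 / z) ^ j) \<le>
      ml_max \<rho> n * norm z ^ n * (real n + 1)"
    using assms by (intro mult_left_mono mult_nonneg_nonneg) (auto intro: less_imp_le)
  moreover have "\<bar>ml_max \<rho> n\<bar> = ml_max \<rho> n" using ml_max_pos[OF assms(1)] by simp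
  ultimately show ?thesis using assms unfolding ml_section_eq[OF assms(1) z]
    by (simp only: norm_mult norm_power norm_of_real) (simp add: mult_ac)
qed

text \<open>The coefficients of index 0 and 1 are both 1, because the two top terms tie on the
  circle; the decrease starts between 1 and 2. Two consecutive gaps are recorded because a single
  one would not control the section at every point of the unit circle.\<close>

lemma sec_coeff_gap:
  assumes "n \<ge> 3"
  shows "sec_coeff n 1 - sec_coeff n 2 \<ge> 1 / (\<rho> + n)^2"
    "sec_coeff n 2 - sec_coeff n 3 \<ge> (ml_R \<rho> (n - 1) / ml_R \<rho> n) / (\<rho> + n)^2"
proof -
  obtain m where n: "n = Suc m" "m \<ge> 1" using assms by (cases n) auto
  have 1: "sec_coeff n 1 = 1"
    using sec_coeff_Suc[of 0 n] ml_R_pos[of n] assms by (simp add: sec_coeff_0)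
  have 2: "sec_coeff n 2 = ml_R \<rho> (n - 1) / ml_R \<rho> n"
    using sec_coeff_Suc[of 1 n] assms 1 by (simp add: numeral_2_eq_2)
  have 3: "sec_coeff n 3 = ml_R \<rho> (n - 1) / ml_R \<rho> n * (ml_R \<rho> (n - 2) / ml_R \<rho> n)"
    using sec_coeff_Suc[of 2 n] assms 2 by (simp add: numeral_3_eq_3)
  have R: "ml_R \<rho> n > 0" "ml_R \<rho> (n - 1) > 0" using assms by auto
  have "ml_R \<rho> (n - 1) \<le> (1 - 1 / (\<rho> + m)^2) * ml_R \<rho> n" using ml_R_step[of m] n by simp
  also have "\<dots> \<le> (1 - 1 / (\<rho> + n)^2) * ml_R \<rho> n"
    using rho n less_imp_le[OF R(1)] by (intro mult_right_mono diff_left_mono divide_left_mono power_mono) auto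
  finally have r1: "ml_R \<rho> (n - 1) / ml_R \<rho> n \<le> 1 - 1 / (\<rho> + n)^2" using R by (simp add: pos_divide_le_eq)
  have "ml_R \<rho> (n - 2) / ml_R \<rho> n \<le> ml_R \<rho> (n - 1) / ml_R \<rho> n"
    using assms ml_R_mono[of "n - 2" "n - 1"] R by (intro divide_right_mono) auto
  hence r2: "ml_R \<rho> (n - 2) / ml_R \<rho> n \<le> 1 - 1 / (\<rho> + n)^2" using r1 by simp
  show "sec_coeff n 1 - sec_coeff n 2 \<ge> 1 / (\<rho> + n)^2" using r1 1 2 by simp
  have "sec_coeff n 2 - sec_coeff n 3 = (ml_R \<rho> (n - 1) / ml_R \<rho> n) * (1 - ml_R \<rho> (n - 2) / ml_R \<rho> n)"
    unfolding 2 3 by (simp add: algebra_simps)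
  also have "\<dots> \<ge> (ml_R \<rho> (n - 1) / ml_R \<rho> n) * (1 / (\<rho> + n)^2)"
    using r2 R by (intro mult_left_mono) auto
  finally show "sec_coeff n 2 - sec_coeff n 3 \<ge> (ml_R \<rho> (n - 1) / ml_R \<rho> n) / (\<rho> + n)^2" by simp
qed

text \<open>The ratio tends to 1, since \<open>ml_R \<rho> n powr \<rho>\<close> is asymptotic to n
  / \<rho>. The value 1/2 is merely a constant below 1 that makes the second gap comparable with the
  first.\<close>

lemma ml_R_ratio: "\<forall>\<^sub>F n in sequentially. ml_R \<rho> (n - 1) / ml_R \<rho> n \<ge> 1/2"
proof -
  have "(\<lambda>n. ml_R \<rho> n powr \<rho> / n / (ml_R \<rho> (Suc n) powr \<rho> / Suc n)) \<longlonglongrightarrow> (1 / \<rho>) / (1 / \<rho>)"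
    using rho by (intro tendsto_divide ml_R_powr_asymp LIMSEQ_Suc[OF ml_R_powr_asymp]) auto
  moreover have "(\<lambda>n. real n / Suc n) \<longlonglongrightarrow> 1" by real_asymp
  ultimately have "(\<lambda>n. ml_R \<rho> n powr \<rho> / n / (ml_R \<rho> (Suc n) powr \<rho> / Suc n) * (real n / Suc n)) \<longlonglongrightarrow> (1 / \<rho>) / (1 / \<rho>) * 1"
    by (rule tendsto_mult)
  hence "(\<lambda>n. ml_R \<rho> n powr \<rho> / n / (ml_R \<rho> (Suc n) powr \<rho> / Suc n) * (real n / Suc n)) \<longlonglongrightarrow> 1"
    using rho by simp
  moreover have "1 > (1/2) powr \<rho>" using rho by (simp add: powr_def ln_div)
  ultimately have "\<forall>\<^sub>F n in sequentially. ml_R \<rho> n powr \<rho> / n / (ml_R \<rho> (Suc n) powr \<rho> / Suc n) * (real n / Suc n) > (1/2) powr \<rho>"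
    by (rule order_tendstoD)
  hence "\<forall>\<^sub>F n in sequentially. ml_R \<rho> (Suc n - 1) / ml_R \<rho> (Suc n) \<ge> 1/2"
    using eventually_ge_at_top[of 1]
  proof eventually_elim
    case (elim n)
    hence "(1/2) powr \<rho> < ml_R \<rho> n powr \<rho> / ml_R \<rho> (Suc n) powr \<rho>" by simp
    also have "\<dots> = (ml_R \<rho> n / ml_R \<rho> (Suc n)) powr \<rho>" using elim ml_R_pos[of n] ml_R_pos[of "Suc n"]
      by (simp add: powr_divide)
    finally have "(1/2) powr \<rho> < (ml_R \<rho> n / ml_R \<rho> (Suc n)) powr \<rho>" .
    moreover have "ml_R \<rho> n / ml_R \<rho> (Suc n) \<ge> 0" using elim ml_R_pos[of n] ml_R_pos[of "Suc n"] by simp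
    ultimately have "1/2 < ml_R \<rho> n / ml_R \<rho> (Suc n)"
      using powr_mono2[of \<rho> "ml_R \<rho> n / ml_R \<rho> (Suc n)" "1/2"] rho by (cases "1/2 < ml_R \<rho> n / ml_R \<rho> (Suc n)") auto
    thus ?case by simp
  qed
  thus ?thesis by (subst (asm) eventually_sequentially_Suc)
qed

text \<open>With q = 1 / z the gaps at indices 1 and 2 contribute multiples of 1 - Re q^2 and 1 - Re
  q^3. In the closed disc these vanish together only if q^2 = q^3 = 1, that is for q = 1, which is
  where z0 = 1 must be excluded.\<close>

lemma norm_ml_section_ge:
  assumes z0: "norm z0 \<ge> 1" "z0 \<noteq> 1"
  obtains r \<delta> where "r > 0" "\<delta> > 0"
    "\<forall>\<^sub>F n in sequentially. \<forall>z\<in>ball z0 r. norm z \<ge> 1 \<longrightarrow>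
       \<delta> / (\<rho> + n)^2 * ml_max \<rho> n * norm z ^ n \<le> norm (ml_section \<rho> n (of_real (ml_R \<rho> n) * z))"
proof -
  define w where "w = (\<lambda>z::complex. (1 - Re ((1/z)^2)) + (1 - Re ((1/z)^3)))"
  have R: "1 - Re (q ^ j) \<ge> 0" if "norm q \<le> 1" for j and q :: complex
    using complex_Re_le_cmod[of "q ^ j"] power_le_one[of "norm q" j] that by (simp add: norm_power)
  have one: "q ^ j = 1" if "norm q \<le> 1" "1 - Re (q ^ j) = 0" for j and q :: complex
  proof -
    have "norm (q ^ j) \<le> 1" using that power_le_one[of "norm q" j] by (simp add: norm_power)
    thus ?thesis using that eq_1_if_Re_eq_1[of "q ^ j"] by simp
  qed
  have w0: "w z0 > 0"
  proof (rule ccontr)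
    assume "\<not> w z0 > 0"
    moreover have q: "norm (1 / z0) \<le> 1" using z0 by (simp add: norm_divide divide_le_eq_1)
    ultimately have "1 - Re ((1/z0)^2) = 0" "1 - Re ((1/z0)^3) = 0"
      using R[OF q, of 2] R[OF q, of 3] unfolding w_def by linarith+
    hence "(1/z0)^2 = 1" "(1/z0)^3 = 1" using one[OF q] by blast+
    hence "1 / z0 = 1" by (simp add: power3_eq_cube power2_eq_square)
    thus False using z0 by auto
  qed
  have "isCont w z0" unfolding w_def using z0
    by (intro continuous_intros bounded_linear.isCont[OF bounded_linear_Re]) auto
  hence "\<forall>\<^sub>F z in nhds z0. w z > w z0 / 2"
    using order_tendstoD(1)[of w "w z0" "nhds z0" "w z0 / 2"] w0 by (simp add: isCont_def tendsto_nhds_iff)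
  then obtain r where r: "r > 0" "\<And>z. dist z z0 < r \<Longrightarrow> w z > w z0 / 2"
    by (auto simp: eventually_nhds_metric)
  \<comment> \<open>Three factors 1/2 enter: from \<open>ml_R_ratio\<close> in the gaps, from w z >
    w z0 / 2 on the ball, and from |1 - q| <= 2.\<close>
  define \<delta> where "\<delta> = w z0 / 8"
  have "\<forall>\<^sub>F n in sequentially. \<forall>z\<in>ball z0 r. norm z \<ge> 1 \<longrightarrow>
       \<delta> / (\<rho> + n)^2 * ml_max \<rho> n * norm z ^ n \<le> norm (ml_section \<rho> n (of_real (ml_R \<rho> n) * z))"
    using ml_R_ratio eventually_ge_at_top[of 4]
  proof eventually_elim
    case (elim n)
    show ?case
    proof (intro ballI impI)
      fix z assume z: "z \<in> ball z0 r" "norm z \<ge> 1"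
      define q where "q = 1 / z"
      have q: "norm q \<le> 1" and znz: "z \<noteq> 0" using z by (auto simp: q_def norm_divide divide_le_eq_1)
      define S where "S = (\<Sum>j\<le>n. of_real (sec_coeff n j) * q ^ j)"
      have g1: "1 / (2 * (\<rho> + n)^2) \<le> sec_coeff n 1 - sec_coeff n 2"
      proof -
        have "1 / (2 * (\<rho> + n)^2) \<le> 1 / (\<rho> + n)^2"
          using rho by (intro divide_left_mono mult_pos_pos zero_less_power) auto
        thus ?thesis using sec_coeff_gap(1)[of n] elim by linarith
      qed
      have "(1/2) / (\<rho> + n)^2 \<le> (ml_R \<rho> (n - 1) / ml_R \<rho> n) / (\<rho> + n)^2"
        using elim by (intro divide_right_mono) auto
      hence g2: "1 / (2 * (\<rho> + n)^2) \<le> sec_coeff n 2 - sec_coeff n 3"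
        using sec_coeff_gap(2)[of n] elim by simp
      have "1 / (2 * (\<rho> + n)^2) * (w z0 / 2) \<le> 1 / (2 * (\<rho> + n)^2) * w z"
        using r(2)[of z] z rho by (intro mult_left_mono) (auto simp: dist_commute)
      also have "\<dots> = 1 / (2 * (\<rho> + n)^2) * (1 - Re (q ^ 2)) + 1 / (2 * (\<rho> + n)^2) * (1 - Re (q ^ 3))"
        by (simp only: w_def q_def distrib_left)
      also have "\<dots> \<le> (sec_coeff n 1 - sec_coeff n 2) * (1 - Re (q ^ 2)) + (sec_coeff n 2 - sec_coeff n 3) * (1 - Re (q ^ 3))"
        by (intro add_mono mult_right_mono g1 g2 R q)
      also have "\<dots> = (\<Sum>k\<in>{1,2}. (sec_coeff n k - sec_coeff n (Suc k)) * (1 - Re (q ^ Suc k)))"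
        by (simp add: eval_nat_numeral)
      also have "\<dots> \<le> Re ((1 - q) * S)"
        unfolding S_def using elim by (intro Re_abel_summation_ge sec_coeff_dec sec_coeff_nonneg q) auto
      also have "\<dots> \<le> norm ((1 - q) * S)" by (rule complex_Re_le_cmod)
      also have "\<dots> \<le> 2 * norm S"
        using q norm_triangle_ineq4[of 1 q] by (simp add: norm_mult mult_right_mono)
      finally have "\<delta> / (\<rho> + n)^2 \<le> norm S" by (simp add: \<delta>_def)
      hence "ml_max \<rho> n * norm z ^ n * (\<delta> / (\<rho> + n)^2) \<le> ml_max \<rho> n * norm z ^ n * norm S"
        using elim by (intro mult_left_mono mult_nonneg_nonneg) (auto intro: less_imp_le)
      thus "\<delta> / (\<rho> + n)^2 * ml_max \<rho> n * norm z ^ n \<le> norm (ml_section \<rho> n (of_real (ml_R \<rho> n) * z))"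
        using ml_section_eq[of n z] elim znz abs_of_pos[OF ml_max_pos[of n]]
        by (simp add: norm_mult norm_power S_def q_def) (simp add: mult_ac)
    qed
  qed
  thus ?thesis using that[of r \<delta>] r w0 by (simp add: \<delta>_def)
qed

text \<open>After removal of z^(n+1), consecutive coefficients of the tail have ratio R_n /
  R_(n+k+2) < 1, so Abel summation in powers of z itself applies. It follows that every nonzero root
  for \<lambda> = 1 has |z| > 1.\<close>

lemma ml_tail_neq_0:
  assumes n: "n \<ge> 1" and z: "z \<noteq> 0" "norm z \<le> 1"
  shows "ml_tail \<rho> (n + 1) (of_real (ml_R \<rho> n) * z) \<noteq> 0"
proof -
  define c where "c = (\<lambda>k. ml_R \<rho> n ^ (n + 1 + k) / Gamma (1 + real (n + 1 + k) / \<rho>))"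
  have Rp: "ml_R \<rho> n > 0" using n by simp
  have c_pos: "c k > 0" for k unfolding c_def using Rp by (intro divide_pos_pos zero_less_power Gamma_index_pos)
  have c_Suc: "c (Suc k) = c k * (ml_R \<rho> n / ml_R \<rho> (Suc (n + 1 + k)))" for k
  proof -
    define j where "j = n + 1 + k"
    have "n + 1 + Suc k = Suc j" by (simp add: j_def)
    thus ?thesis unfolding c_def ml_R_Suc j_def[symmetric] by (simp del: of_nat_Suc)
  qed
  have c_less: "c (Suc k) < c k" for k
  proof -
    have "ml_R \<rho> n / ml_R \<rho> (Suc (n + 1 + k)) < 1" using ml_R_less[of n "Suc (n + 1 + k)"] n by simp
    hence "c k * (ml_R \<rho> n / ml_R \<rho> (Suc (n + 1 + k))) < c k * 1" by (intro mult_strict_left_mono c_pos)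
    thus ?thesis unfolding c_Suc by (simp only: mult_1_right)
  qed
  have summ: "summable (\<lambda>k. of_real (c k) * z ^ k)"
  proof -
    have "summable (\<lambda>k. ml_coeff \<rho> (k + (n + 1)) * (of_real (ml_R \<rho> n) * z) ^ (k + (n + 1)))"
      using summable_mittag_leffler[of \<rho>] rho by (subst summable_iff_shift) auto
    hence "summable (\<lambda>k. 1 / z ^ (n + 1) * (ml_coeff \<rho> (k + (n + 1)) * (of_real (ml_R \<rho> n) * z) ^ (k + (n + 1))))"
      by (rule summable_mult)
    also have "(\<lambda>k. 1 / z ^ (n + 1) * (ml_coeff \<rho> (k + (n + 1)) * (of_real (ml_R \<rho> n) * z) ^ (k + (n + 1)))) = 
       (\<lambda>k. of_real (c k) * z ^ k)"
      using z by (auto simp: fun_eq_iff c_def ml_coeff_def power_mult_distrib power_add add_ac)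
    finally show ?thesis .
  qed
  have tail: "ml_tail \<rho> (n + 1) (of_real (ml_R \<rho> n) * z) = z ^ (n + 1) * (\<Sum>k. of_real (c k) * z ^ k)"
    unfolding ml_tail_def suminf_mult[OF summ, symmetric]
    by (intro suminf_cong) (simp add: c_def ml_coeff_def power_mult_distrib power_add)
  have "(\<Sum>k. of_real (c k) * z ^ k) \<noteq> 0"
  proof (cases "z = 1")
    case True
    have "summable c" using summ True summable_of_real_iff[of c, where ?'a = complex] by simp
    hence "(\<Sum>k. c k) > 0" using c_pos by (rule suminf_pos)
    moreover have "(\<Sum>k. complex_of_real (c k)) = of_real (\<Sum>k. c k)"
      by (rule suminf_of_real[OF \<open>summable c\<close>, symmetric])
    ultimately show ?thesis using True by simp
  next
    case False
    have "(\<lambda>N. (\<Sum>k<N. of_real (c k) * z ^ k)) \<longlonglongrightarrow> (\<Sum>k. of_real (c k) * z ^ k)"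
      by (rule summable_LIMSEQ[OF summ])
    hence "(\<lambda>N. Re ((1 - z) * (\<Sum>k<N. of_real (c k) * z ^ k))) \<longlonglongrightarrow> Re ((1 - z) * (\<Sum>k. of_real (c k) * z ^ k))"
      by (intro tendsto_intros)
    hence lim: "(\<lambda>N. Re ((1 - z) * (\<Sum>k\<le>N. of_real (c k) * z ^ k))) \<longlonglongrightarrow> Re ((1 - z) * (\<Sum>k. of_real (c k) * z ^ k))"
      using LIMSEQ_Suc unfolding lessThan_Suc_atMost[symmetric] by blast
    \<comment> \<open>There is no tie here: already the first difference is positive, and its factor
      1 - Re z vanishes in the closed disc only at 1, the case settled above by positivity.\<close>
    have "(c 0 - c 1) * (1 - Re z) \<le> Re ((1 - z) * (\<Sum>k. of_real (c k) * z ^ k))"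
    proof (rule tendsto_lowerbound[OF lim])
      show "\<forall>\<^sub>F N in sequentially. (c 0 - c 1) * (1 - Re z) \<le> Re ((1 - z) * (\<Sum>k\<le>N. of_real (c k) * z ^ k))"
        using eventually_ge_at_top[of 1]
      proof eventually_elim
        case (elim N)
        show ?case using Re_abel_summation_ge[of N c z "{0}"] elim c_less c_pos z
          by (auto intro: less_imp_le)
      qed
    qed auto
    moreover have "(c 0 - c 1) * (1 - Re z) > 0"
    proof (intro mult_pos_pos)
      have "Re z \<noteq> 1"
        using eq_1_if_Re_eq_1[of z] z False by auto
      thus "1 - Re z > 0" using complex_Re_le_cmod[of z] z by simp
    qed (use c_less[of 0] in simp)
    ultimately show ?thesis by auto
  qed
  thus ?thesis unfolding tail using z by simp
qed

end

subsection \<open>Shifting vertical lines of integration\<close>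

lemma integrable_norm_Complex_powr:
  fixes c e :: real
  assumes c: "c > 0" and e: "e < -1"
  shows "integrable lborel (\<lambda>y. norm (Complex c y) powr e)"
proof -
  define F where "F = (\<lambda>y. norm (Complex c y) powr e)"
  have pos: "norm (Complex c y) > 0" for y using c by (simp add: complex_eq_iff)
  have cont: "continuous_on A F" for A unfolding F_def
    by (intro continuous_intros) (use c in \<open>auto simp: complex_eq_iff\<close>)
  have nn: "F y \<ge> 0" for y by (simp add: F_def)
  have 1: "set_integrable lborel {1..} (\<lambda>y. y powr e)"
  proof -
    have "(\<lambda>y. y powr e) absolutely_integrable_on {1..}"
      using has_integral_powr_to_inf[OF e, of 1]
      by (intro nonnegative_absolutely_integrable_1) (auto simp: integrable_on_def)
    thus ?thesis unfolding set_integrable_def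
      by (subst (asm) integrable_completion) auto
  qed
  have 2: "set_integrable lborel {1..} F"
  proof (rule set_integrable_bound[OF 1])
    show "set_borel_measurable lborel {1..} F" unfolding set_borel_measurable_def
      using cont[of UNIV] borel_measurable_continuous_onI by (intro borel_measurable_scaleR) (auto simp: F_def)
    show "AE x in lborel. x \<in> {1..} \<longrightarrow> norm (F x) \<le> norm (x powr e)"
    proof (intro AE_I2 impI)
      fix y :: real assume "y \<in> {1..}"
      thus "norm (F y) \<le> norm (y powr e)"
        using e abs_Im_le_cmod[of "Complex c y"] by (auto simp: F_def intro!: powr_mono2')
    qed
  qed
  have 3: "set_integrable lborel {-1..1} F" by (intro borel_integrable_atLeastAtMost' cont)
  have 4: "set_integrable lborel {..-1} F"
  proof -
    have "integrable lborel (\<lambda>y. indicat_real {1..} (0 + (-1) * y) *\<^sub>R F (0 + (-1) * y))"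
      using 2 unfolding set_integrable_def by (rule lborel_integrable_real_affine) auto
    also have "(\<lambda>y. indicat_real {1..} (0 + (-1) * y) *\<^sub>R F (0 + (-1) * y)) = (\<lambda>y. indicat_real {..-1} y *\<^sub>R F y)"
      by (auto simp: fun_eq_iff F_def indicator_def cmod_def)
    finally show ?thesis unfolding set_integrable_def .
  qed
  have "set_integrable lborel ({1..} \<union> {-1..1} \<union> {..-1}) F"
    by (intro set_integrable_Un 2 3 4) auto
  also have "{1..} \<union> {-1..1} \<union> {..-1} = (UNIV :: real set)" by auto
  finally show ?thesis by (simp add: set_integrable_def F_def)
qed

text \<open>Links the Lebesgue integral over a whole line, where dominated convergence is available,
  with the integrals over segments that contour integration delivers.\<close>

lemma tendsto_integral_truncated:
  fixes g :: "real \<Rightarrow> complex"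
  assumes "integrable lborel g"
  shows "(\<lambda>n. integral {-real n..real n} g) \<longlonglongrightarrow> (LBINT y. g y)"
proof -
  have "set_integrable lborel {-real n..real n} g" for n
    unfolding set_integrable_def using assms by (intro integrable_mult_indicator) auto
  hence eq: "integral {-real n..real n} g = (LBINT y. indicator {-real n..real n} y *\<^sub>R g y)" for n
    by (subst set_borel_integral_eq_integral(2)[symmetric]) (auto simp: set_lebesgue_integral_def)
  show ?thesis unfolding eq
  proof (rule integral_dominated_convergence[where w = "\<lambda>y. norm (g y)"])
    show "AE y in lborel. (\<lambda>n. indicat_real {-real n..real n} y *\<^sub>R g y) \<longlonglongrightarrow> g y"
    proof (intro AE_I2 tendsto_eventually)
      fix y :: real
      show "\<forall>\<^sub>F n in sequentially. indicat_real {-real n..real n} y *\<^sub>R g y = g y"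
        using eventually_ge_at_top[of "nat \<lceil>\<bar>y\<bar>\<rceil>"]
        by eventually_elim (auto simp: indicator_def; linarith)
    qed
  qed (use assms in \<open>auto simp: indicator_def\<close>)
qed

text \<open>Residue theorem on the rectangle with corners c - iT and C + iT, as T grows: the
  horizontal sides vanish by \<open>decay\<close>. On the vertical sides dv = i dy, which removes
  the i from 2 \<pi> i.\<close>

lemma vertical_line_shift:
  fixes f :: "complex \<Rightarrow> complex" and b :: "real \<Rightarrow> real"
  assumes c: "0 < c" "c < C" and fin: "finite pts"
    and holo: "f holomorphic_on ({v. Re v > 0} - pts)"
    and off: "\<And>p. p \<in> pts \<Longrightarrow> Re p \<noteq> c \<and> Re p \<noteq> C"
    and int: "integrable lborel (\<lambda>y. f (Complex c y))" "integrable lborel (\<lambda>y. f (Complex C y))"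
    and decay: "\<And>v. c \<le> Re v \<Longrightarrow> Re v \<le> C \<Longrightarrow> \<bar>Im v\<bar> \<ge> Y \<Longrightarrow> norm (f v) \<le> b \<bar>Im v\<bar>"
    and b: "(b \<longlongrightarrow> 0) at_top"
  shows "(LBINT y. f (Complex C y)) - (LBINT y. f (Complex c y)) =
    2 * pi * (\<Sum>p\<in>{p\<in>pts. c < Re p \<and> Re p < C}. residue f p)"
proof -
  define H where "H = {v::complex. Re v > 0}"
  define S where "S = (\<Sum>p\<in>{p\<in>pts. c < Re p \<and> Re p < C}. residue f p)"
  have H: "open H" "connected H" unfolding H_def
    by (auto simp: open_halfspace_Re_gt intro!: convex_connected convex_halfspace_Re_gt)
  \<comment> \<open>Above this height there are no poles, so a tall rectangle has none on its
    horizontal sides and encloses all those between the two lines.\<close>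
  obtain Y' where Y': "\<And>p. p \<in> pts \<Longrightarrow> \<bar>Im p\<bar> < Y'" 
  proof -
    have "bounded pts" using fin by (rule finite_imp_bounded)
    then obtain B where B: "\<And>p. p \<in> pts \<Longrightarrow> norm p \<le> B" by (auto simp: bounded_iff)
    show ?thesis
      by (rule that[of "B + 1"]) (use B abs_Im_le_cmod in \<open>fastforce intro: le_less_trans order_trans\<close>)
  qed
  have main: "norm (integral {-real n..real n} (\<lambda>y. f (Complex C y)) - integral {-real n..real n} (\<lambda>y. f (Complex c y))
       - 2 * pi * S) \<le> 2 * (b n * (C - c))" if n: "real n > max Y (max Y' 0)" for n
  proof -
    define T where "T = real n"
    have T: "T > Y" "T > Y'" "T > 0" using n by (auto simp: T_def)
    define a1 a2 a3 a4 where "a1 = Complex c (-T)" and "a2 = Complex C (-T)" and "a3 = Complex C T" and "a4 = Complex c T"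
    have rect: "rectpath a1 a3 = linepath a1 a2 +++ linepath a2 a3 +++ linepath a3 a4 +++ linepath a4 a1"
      by (simp add: rectpath_def Let_def a1_def a2_def a3_def a4_def)
    have le: "Re a1 \<le> Re a3" "Im a1 \<le> Im a3" using c T by (auto simp: a1_def a3_def)
    have im: "path_image (rectpath a1 a3) \<subseteq> H - pts"
    proof
      fix v assume v: "v \<in> path_image (rectpath a1 a3)"
      hence "v \<in> cbox a1 a3 - box a1 a3" using le by (subst (asm) path_image_rectpath_cbox_minus_box) auto
      hence v: "c \<le> Re v" "Re v \<le> C" "Re v = c \<or> Re v = C \<or> Im v = T \<or> Im v = -T"
        by (auto simp: in_cbox_complex_iff in_box_complex_iff a1_def a3_def)
      have "v \<notin> pts" using v(3) off[of v] Y'[of v] T by fastforce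
      thus "v \<in> H - pts" using v c by (simp add: H_def)
    qed
    have seg: "path_image (rectpath a1 a3) = 
        closed_segment a1 a2 \<union> closed_segment a2 a3 \<union> closed_segment a3 a4 \<union> closed_segment a4 a1"
      unfolding rect by (simp add: path_image_join Un_assoc)
    have cont: "continuous_on (H - pts) f" using holo by (intro holomorphic_on_imp_continuous_on) (simp add: H_def)
    have conts: "continuous_on (closed_segment a1 a2) f" "continuous_on (closed_segment a2 a3) f"
       "continuous_on (closed_segment a3 a4) f" "continuous_on (closed_segment a4 a1) f"
       "continuous_on (closed_segment a1 a4) f"
      using im unfolding seg closed_segment_commute[of a1 a4]
      by (auto intro: continuous_on_subset[OF cont])
    note ci = conts[THEN contour_integrable_continuous_linepath]
    have wind: "winding_number (rectpath a1 a3) p = (if c < Re p \<and> Re p < C then 1 else 0)" if "p \<in> pts" for p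
    proof (cases "c < Re p \<and> Re p < C")
      case True
      hence "p \<in> box a1 a3" using Y'[OF that] T by (auto simp: in_box_complex_iff a1_def a3_def)
      thus ?thesis using True by (simp add: winding_number_rectpath)
    next
      case False
      hence "p \<notin> cbox a1 a3" using off[OF that] by (auto simp: in_cbox_complex_iff a1_def a3_def)
      thus ?thesis using False le by (auto simp: winding_number_rectpath_outside)
    qed
    have "contour_integral (rectpath a1 a3) f = 2 * pi * \<i> * (\<Sum>p\<in>pts. winding_number (rectpath a1 a3) p * residue f p)"
    proof (rule Residue_theorem[OF H fin])
      show "\<forall>v. v \<notin> H \<longrightarrow> winding_number (rectpath a1 a3) v = 0"
        using le c by (auto simp: H_def in_cbox_complex_iff a1_def a3_def intro!: winding_number_rectpath_outside)
    qed (use holo im in \<open>auto simp: H_def\<close>)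
    also have "(\<Sum>p\<in>pts. winding_number (rectpath a1 a3) p * residue f p) = S"
      unfolding S_def using fin by (intro sum.mono_neutral_cong_right) (auto simp: wind)
    finally have res: "contour_integral (rectpath a1 a3) f = 2 * pi * \<i> * S" .
    have "contour_integral (rectpath a1 a3) f = contour_integral (linepath a1 a2) f + 
        (contour_integral (linepath a2 a3) f + (contour_integral (linepath a3 a4) f + contour_integral (linepath a4 a1) f))"
      unfolding rect using ci by (simp add: contour_integrable_join)
    also have "contour_integral (linepath a4 a1) f = - contour_integral (linepath a1 a4) f"
      by (rule contour_integral_reverse_linepath[OF conts(4)])
    also have "contour_integral (linepath a1 a4) f = \<i> * integral {-T..T} (\<lambda>y. f (Complex c y))"
      using T by (intro contour_integral_linepath_same_Re) (auto simp: a1_def a4_def)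
    also have "contour_integral (linepath a2 a3) f = \<i> * integral {-T..T} (\<lambda>y. f (Complex C y))"
      using T by (intro contour_integral_linepath_same_Re) (auto simp: a2_def a3_def)
    finally have eq: "\<i> * (integral {-T..T} (\<lambda>y. f (Complex C y)) - integral {-T..T} (\<lambda>y. f (Complex c y)) - 2 * pi * S) =
       - (contour_integral (linepath a1 a2) f + contour_integral (linepath a3 a4) f)"
      unfolding res by (simp add: algebra_simps)
    have bnn: "b T \<ge> 0" using order_trans[OF norm_ge_zero decay[of "Complex c T"]] T c by simp
    have h1: "norm (contour_integral (linepath a1 a2) f) \<le> b T * norm (a2 - a1)"
    proof (rule contour_integral_bound_linepath[OF ci(1) bnn])
      fix v assume "v \<in> closed_segment a1 a2"
      hence "c \<le> Re v \<and> Re v \<le> C \<and> Im v = -T" using c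
        by (auto simp: a1_def a2_def closed_segment_same_Im closed_segment_eq_real_ivl)
      thus "norm (f v) \<le> b T" using decay[of v] T by simp
    qed
    have h2: "norm (contour_integral (linepath a3 a4) f) \<le> b T * norm (a4 - a3)"
    proof (rule contour_integral_bound_linepath[OF ci(3) bnn])
      fix v assume "v \<in> closed_segment a3 a4"
      hence "c \<le> Re v \<and> Re v \<le> C \<and> Im v = T" using c
        by (auto simp: a3_def a4_def closed_segment_same_Im closed_segment_eq_real_ivl)
      thus "norm (f v) \<le> b T" using decay[of v] T by simp
    qed
    have "norm (a2 - a1) = C - c" "norm (a4 - a3) = C - c"
      using c by (auto simp: a1_def a2_def a3_def a4_def cmod_def)
    moreover have "norm (\<i> * (integral {-T..T} (\<lambda>y. f (Complex C y)) - integral {-T..T} (\<lambda>y. f (Complex c y)) - 2 * pi * S))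
       \<le> norm (contour_integral (linepath a1 a2) f) + norm (contour_integral (linepath a3 a4) f)"
      unfolding eq norm_minus_cancel by (rule norm_triangle_ineq)
    ultimately show ?thesis using h1 h2 by (simp add: norm_mult T_def)
  qed
  have "(\<lambda>n. integral {-real n..real n} (\<lambda>y. f (Complex C y)) - integral {-real n..real n} (\<lambda>y. f (Complex c y)) - 2 * pi * S)
     \<longlonglongrightarrow> (LBINT y. f (Complex C y)) - (LBINT y. f (Complex c y)) - 2 * pi * S"
    by (intro tendsto_intros tendsto_integral_truncated int)
  moreover have "(\<lambda>n. integral {-real n..real n} (\<lambda>y. f (Complex C y)) - integral {-real n..real n} (\<lambda>y. f (Complex c y)) - 2 * pi * S) \<longlonglongrightarrow> 0"
  proof (rule Lim_null_comparison)
    have "\<forall>\<^sub>F n in sequentially. real n > max Y (max Y' 0)"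
      using filterlim_real_sequentially by (rule filterlim_at_top_dense[THEN iffD1, rule_format])
    thus "\<forall>\<^sub>F n in sequentially. norm (integral {-real n..real n} (\<lambda>y. f (Complex C y)) - integral {-real n..real n} (\<lambda>y. f (Complex c y)) - 2 * pi * S) \<le> 2 * (b (real n) * (C - c))"
      by eventually_elim (rule main)
    have "(\<lambda>n. b (real n)) \<longlonglongrightarrow> 0" using b filterlim_real_sequentially by (rule filterlim_compose)
    thus "(\<lambda>n. 2 * (b (real n) * (C - c))) \<longlonglongrightarrow> 0" by (auto intro!: tendsto_eq_intros)
  qed
  ultimately have "(LBINT y. f (Complex C y)) - (LBINT y. f (Complex c y)) - 2 * pi * S = 0"
    by (rule LIMSEQ_unique)
  thus ?thesis by (simp add: S_def)
qed

text \<open>The derivative of Ln at 1 is taken along the increments u / (n + 1); these must be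
  nonzero, hence the separate case u = 0.\<close>

lemma tendsto_exp_limit_complex: "(\<lambda>n. (1 + u / of_nat (Suc n)) ^ Suc n) \<longlonglongrightarrow> exp (u :: complex)"
proof (cases "u = 0")
  case False
  have "((\<lambda>h. (Ln (1 + h) - Ln 1) / h) \<longlongrightarrow> inverse 1) (at 0)"
    using has_field_derivative_Ln[of 1] unfolding has_field_derivative_def[symmetric] DERIV_def by simp
  moreover have "filterlim (\<lambda>n. u / of_nat (Suc n)) (at 0) sequentially"
    unfolding filterlim_at using False
    by (auto intro!: LIMSEQ_Suc[OF lim_const_over_n] simp del: of_nat_Suc)
  ultimately have "(\<lambda>n. (Ln (1 + u / of_nat (Suc n)) - Ln 1) / (u / of_nat (Suc n))) \<longlonglongrightarrow> inverse 1"
    by (rule filterlim_compose)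
  hence "(\<lambda>n. exp (u * ((Ln (1 + u / of_nat (Suc n)) - Ln 1) / (u / of_nat (Suc n))))) \<longlonglongrightarrow> exp (u * inverse 1)"
    by (intro tendsto_intros)
  moreover have "\<forall>\<^sub>F n in sequentially. exp (u * ((Ln (1 + u / of_nat (Suc n)) - Ln 1) / (u / of_nat (Suc n))))
      = (1 + u / of_nat (Suc n)) ^ Suc n"
    using eventually_gt_at_top[of "nat \<lceil>norm u\<rceil>"]
  proof eventually_elim
    case (elim n)
    hence "norm u < norm (of_nat (Suc n) :: complex)" by (simp only: norm_of_nat) linarith
    hence nz: "1 + u / of_nat (Suc n) \<noteq> 0"
    proof -
      have "norm (u / of_nat (Suc n)) < 1"
        using \<open>norm u < _\<close> unfolding norm_divide by (subst pos_divide_less_eq) auto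
      hence "u / of_nat (Suc n) \<noteq> - 1" by auto
      thus ?thesis by (simp add: add_eq_0_iff)
    qed
    have "u * ((Ln (1 + u / of_nat (Suc n)) - Ln 1) / (u / of_nat (Suc n))) = of_nat (Suc n) * Ln (1 + u / of_nat (Suc n))"
      using False by (simp del: of_nat_Suc)
    thus ?case by (simp only: exp_of_nat_mult exp_Ln[OF nz])
  qed
  ultimately show ?thesis by (simp add: Lim_transform_eventually)
qed auto

lemma higher_deriv_powr_neg:
  fixes x :: real
  assumes "Re v > 0"
  shows "(deriv ^^ n) (\<lambda>v. v powr of_real (-1 - x)) v =
    (-1) ^ n * of_real (pochhammer (1 + x) n) * v powr of_real (-1 - x - n)"
  using assms
proof (induction n arbitrary: v)
  case (Suc n)
  have "(deriv ^^ Suc n) (\<lambda>v. v powr of_real (-1 - x)) v = 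
      deriv (\<lambda>v. (-1) ^ n * of_real (pochhammer (1 + x) n) * v powr of_real (-1 - x - n)) v"
    unfolding funpow.simps o_def
    using Suc eventually_nhds_in_open[of "{v. Re v > 0}" v] open_halfspace_Re_gt
    by (intro deriv_cong_ev refl) (auto elim!: eventually_mono)
  also have "\<dots> = (-1) ^ n * of_real (pochhammer (1 + x) n) * (of_real (-1 - x - n) * v powr (of_real (-1 - x - n) - 1))"
    using Suc.prems complex_nonpos_Reals_iff[of v]
    by (intro DERIV_imp_deriv DERIV_cmult has_field_derivative_powr) auto
  also have "of_real (-1 - x - n) - 1 = (of_real (-1 - x - Suc n) :: complex)" by simp
  finally show ?case by (simp add: pochhammer_Suc algebra_simps)
qed simp

text \<open>Replacing \<^term>\<open>exp (M * v)\<close> by \<open>(1 - M v / N) powr (-N)\<close> gives an integrand which decays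
  to the right, with a single pole at \<open>p = N / M\<close>; as \<open>N\<close> grows, its residue becomes
  the Gauss product for the reciprocal Gamma function.\<close>

lemma vertical_integral_approximant:
  fixes x c p :: real
  assumes x: "x > 0" and c: "0 < c" "c < p"
  shows "(LBINT y. (of_real (-p) / (Complex c y - of_real p)) ^ Suc n * Complex c y powr of_real (-1 - x)) =
     of_real (2 * pi * p powr (-x) * pochhammer (1 + x) n / fact n)"
    and "integrable lborel (\<lambda>y. (of_real (-p) / (Complex c y - of_real p)) ^ Suc n * Complex c y powr of_real (-1 - x))"
proof -
  define g where "g = (\<lambda>v::complex. of_real ((-p) ^ Suc n) * v powr of_real (-1 - x))"
  define f where "f = (\<lambda>v::complex. g v / (v - of_real p) ^ Suc n)"
  have f_eq: "f v = (of_real (-p) / (v - of_real p)) ^ Suc n * v powr of_real (-1 - x)" for v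
    by (simp only: f_def g_def power_divide of_real_power times_divide_eq_left)
  have p: "p > 0" using c by simp
  have g_holo: "g holomorphic_on {v. Re v > 0}" unfolding g_def
    by (intro holomorphic_intros) (auto simp: complex_nonpos_Reals_iff)
  have f_holo: "f holomorphic_on ({v. Re v > 0} - {of_real p})" unfolding f_def
    by (intro holomorphic_intros holomorphic_on_subset[OF g_holo]) auto
  have norm_f: "norm (f v) = (p / norm (v - of_real p)) ^ Suc n * norm v powr (-1 - x)" for v
    unfolding f_eq norm_mult norm_power norm_divide using p norm_powr_real_powr'[of "of_real (-1 - x)" v]
    by (simp del: power_Suc of_real_diff of_real_minus)
  have bound: "norm (f (Complex C y)) \<le> (p / \<bar>C - p\<bar>) ^ Suc n * norm (Complex C y) powr (-1 - x)" if "C \<noteq> p" for C y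
    unfolding norm_f using p that abs_Re_le_cmod[of "Complex C y - of_real p"]
    by (intro mult_right_mono power_mono divide_left_mono mult_pos_pos) (auto simp: complex_eq_iff)
  have meas: "(\<lambda>y. f (Complex C y)) \<in> borel_measurable lborel" if "C > 0" "C \<noteq> p" for C
  proof -
    have "continuous_on UNIV (\<lambda>y. f (Complex C y))"
      by (rule continuous_on_compose2[OF holomorphic_on_imp_continuous_on[OF f_holo], where f = "\<lambda>y. Complex C y"])
         (use that in \<open>auto intro!: continuous_intros simp: complex_eq_iff\<close>)
    thus ?thesis by (simp add: borel_measurable_continuous_onI)
  qed
  have int: "integrable lborel (\<lambda>y. f (Complex C y))" if "C > 0" "C \<noteq> p" for C
  proof (rule Bochner_Integration.integrable_bound)
    show "integrable lborel (\<lambda>y. (p / \<bar>C - p\<bar>) ^ Suc n * norm (Complex C y) powr (-1 - x))"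
      using x that by (intro integrable_mult_right integrable_norm_Complex_powr) auto
    show "AE y in lborel. norm (f (Complex C y)) \<le> norm ((p / \<bar>C - p\<bar>) ^ Suc n * norm (Complex C y) powr (-1 - x))"
      using bound[OF that(2)] p by (auto intro!: AE_I2 order_trans[OF bound[OF that(2)]])
  qed (rule meas[OF that])
  show "integrable lborel (\<lambda>y. (of_real (-p) / (Complex c y - of_real p)) ^ Suc n * Complex c y powr of_real (-1 - x))"
    using int[of c] c unfolding f_eq by simp
  have res: "residue f (of_real p) = - of_real (p powr (-x) * pochhammer (1 + x) n / fact n)"
  proof -
    have "residue f (of_real p) = (deriv ^^ n) g (of_real p) / fact n"
      unfolding f_def using p g_holo
      by (intro residue_holomorphic_over_power[of "{v. Re v > 0}"]) (auto simp: open_halfspace_Re_gt)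
    also have "(deriv ^^ n) g (of_real p) = of_real ((-p) ^ Suc n) * (deriv ^^ n) (\<lambda>v. v powr of_real (-1 - x)) (of_real p)"
      unfolding g_def using p
      by (intro higher_deriv_cmult[of _ "{v. Re v > 0}"] holomorphic_intros) 
         (auto simp: open_halfspace_Re_gt complex_nonpos_Reals_iff)
    also have "\<dots> = of_real ((-p) ^ Suc n * ((-1) ^ n * pochhammer (1 + x) n * p powr (-1 - x - n)))"
      using p by (subst higher_deriv_powr_neg) (simp_all add: powr_of_real[symmetric])
    also have "(-p) ^ Suc n * ((-1) ^ n * pochhammer (1 + x) n * p powr (-1 - x - n)) = 
        - (p ^ Suc n * p powr (-1 - x - n)) * pochhammer (1 + x) n"
    proof -
      have sq: "(-1) ^ n * (-1) ^ n = (1::real)" by (simp flip: power_mult_distrib)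
      have "(-p) ^ Suc n = - ((-1) ^ n * p ^ Suc n)"
        unfolding power_minus[of p "Suc n"] by simp
      moreover have "- (s * a) * (s * P * w) = - (a * w) * P" if "s * s = 1" for s a P w :: real
        using that by algebra
      ultimately show ?thesis using sq by metis
    qed
    also have "p ^ Suc n * p powr (-1 - x - n) = p powr (-x)"
      using p by (simp add: powr_realpow[symmetric] powr_add[symmetric] del: power_Suc)
    finally show ?thesis by simp
  qed
  \<comment> \<open>For C > p the integral over Re v = C does not depend on C, and the estimate
    below shows that it tends to 0. The integral over Re v = c is therefore -2 \<pi> times the
    residue, and the minus sign in \<open>res\<close> makes it positive.\<close>
  have V: "(LBINT y. f (Complex C y)) - (LBINT y. f (Complex c y)) = 2 * pi * residue f (of_real p)" if C: "C > p" for C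
  proof -
    have "(LBINT y. f (Complex C y)) - (LBINT y. f (Complex c y)) =
       2 * pi * (\<Sum>q\<in>{q\<in>{of_real p}. c < Re q \<and> Re q < C}. residue f q)"
    proof (rule vertical_line_shift[OF _ _ _ f_holo, where Y = "p" and b = "\<lambda>t. t powr (-1 - x)"])
      fix v assume v: "\<bar>Im v\<bar> \<ge> p"
      have "norm (f v) \<le> 1 ^ Suc n * \<bar>Im v\<bar> powr (-1 - x)"
        unfolding norm_f using v p x abs_Im_le_cmod[of "v - of_real p"] abs_Im_le_cmod[of v]
        by (intro mult_mono power_mono powr_mono2') (auto simp: divide_le_eq_1)
      thus "norm (f v) \<le> \<bar>Im v\<bar> powr (-1 - x)" by simp
    next
      show "((\<lambda>t. t powr (-1 - x)) \<longlongrightarrow> 0) at_top" using x by real_asymp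
    qed (use c C int in auto)
    also have "{q\<in>{of_real p}. c < Re q \<and> Re q < C} = {complex_of_real p}" using c C by auto
    finally show ?thesis by simp
  qed
  have "(\<lambda>k::nat. LBINT y. f (Complex (real k) y)) \<longlonglongrightarrow> 0"
  proof (rule Lim_null_comparison)
    \<comment> \<open>The majorant is taken on the line Re v = 1 to be independent of k. Once k > 2p
      + 1, the ratio p / (k - p) is below 1, so one of its n + 1 factors already supplies the decay
      in k.\<close>
    define I where "I = (LBINT y. norm (Complex 1 y) powr (-1 - x))"
    have "\<forall>\<^sub>F k::nat in sequentially. real k > 2 * p + 1"
      using filterlim_real_sequentially by (rule filterlim_at_top_dense[THEN iffD1, rule_format])
    thus "\<forall>\<^sub>F k::nat in sequentially. norm (LBINT y. f (Complex (real k) y)) \<le> p / (real k - p) * I"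
    proof eventually_elim
      case (elim k)
      have "norm (LBINT y. f (Complex (real k) y)) \<le> (LBINT y. p / (real k - p) * norm (Complex 1 y) powr (-1 - x))"
      proof (rule Bochner_Integration.integral_norm_bound_integral)
        show "integrable lborel (\<lambda>y. f (Complex (real k) y))" using elim p by (intro int) auto
        show "integrable lborel (\<lambda>y. p / (real k - p) * norm (Complex 1 y) powr (-1 - x))"
          using x by (intro integrable_mult_right integrable_norm_Complex_powr) auto
        fix y :: real
        have "(p / \<bar>real k - p\<bar>) ^ Suc n \<le> (p / (real k - p)) ^ 1"
          using elim p power_decreasing[of 1 "Suc n" "p / (real k - p)"]
          by (subst abs_of_pos) (simp_all only: diff_gt_0_iff_gt pos_divide_le_eq, simp_all del: power_Suc)
        moreover have "norm (Complex 1 y) \<le> norm (Complex k y)"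
          using elim p by (auto simp: cmod_def intro!: power_mono)
        hence "norm (Complex k y) powr (-1 - x) \<le> norm (Complex 1 y) powr (-1 - x)"
          using x by (intro powr_mono2') (auto simp: complex_eq_iff)
        ultimately have "(p / \<bar>real k - p\<bar>) ^ Suc n * norm (Complex k y) powr (-1 - x) \<le> (p / (real k - p)) ^ 1 * norm (Complex 1 y) powr (-1 - x)"
          using elim p by (intro mult_mono) auto
        thus "norm (f (Complex (real k) y)) \<le> p / (real k - p) * norm (Complex 1 y) powr (-1 - x)"
          using bound[of "real k" y] elim p by simp
      qed
      also have "\<dots> = p / (real k - p) * I" by (simp add: I_def)
      finally show ?case .
    qed
    show "(\<lambda>k. p / (real k - p) * I) \<longlonglongrightarrow> 0" by real_asymp
  qed
  moreover have "(\<lambda>k::nat. LBINT y. f (Complex (real k) y)) \<longlonglongrightarrow> 2 * pi * residue f (of_real p) + (LBINT y. f (Complex c y))"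
  proof (rule tendsto_eventually)
    have "\<forall>\<^sub>F k::nat in sequentially. real k > p"
      using filterlim_real_sequentially by (rule filterlim_at_top_dense[THEN iffD1, rule_format])
    thus "\<forall>\<^sub>F k::nat in sequentially. (LBINT y. f (Complex (real k) y)) = 2 * pi * residue f (of_real p) + (LBINT y. f (Complex c y))"
      by eventually_elim (use V in \<open>simp add: algebra_simps\<close>)
  qed
  ultimately have "0 = 2 * pi * residue f (of_real p) + (LBINT y. f (Complex c y))"
    by (rule LIMSEQ_unique)
  hence "(LBINT y. f (Complex c y)) = - (2 * pi * residue f (of_real p))" by (simp add: eq_neg_iff_add_eq_0 add.commute)
  thus "(LBINT y. (of_real (-p) / (Complex c y - of_real p)) ^ Suc n * Complex c y powr of_real (-1 - x)) =
     of_real (2 * pi * p powr (-x) * pochhammer (1 + x) n / fact n)"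
    unfolding res f_eq by simp
qed

subsection \<open>Exponential asymptotics of the Mittag-Leffler function\<close>

text \<open>Laplace's integral for 1 / Gamma, by dominated convergence from the rational
  approximants with p = (n + 1) / M: there (-p / (v - p))^(n+1) is (1 - M v / (n + 1))^(-(n+1)),
  which tends to exp (M v).\<close>

lemma reciprocal_Gamma_vertical_integral:
  fixes x c M :: real
  assumes x: "x > 0" and c: "c > 0" and M: "M > 0"
  shows "(LBINT y. exp (of_real M * Complex c y) * Complex c y powr of_real (-1 - x)) =
     of_real (2 * pi * M powr x / Gamma (1 + x))"
    and "integrable lborel (\<lambda>y. exp (of_real M * Complex c y) * Complex c y powr of_real (-1 - x))"
proof -
  define p where "p = (\<lambda>n. real (Suc n) / M)"
  define g where "g = (\<lambda>n v. (of_real (-p n) / (v - of_real (p n))) ^ Suc n * v powr of_real (-1 - x) :: complex)"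
  define f where "f = (\<lambda>v. exp (of_real M * v) * v powr of_real (-1 - x) :: complex)"
  have ev_p: "\<forall>\<^sub>F n in sequentially. p n > c"
  proof -
    have "filterlim p at_top sequentially" unfolding p_def using M by real_asymp
    thus ?thesis by (rule filterlim_at_top_dense[THEN iffD1, rule_format])
  qed
  have "(\<lambda>n. (1 + (- M * c) / real (Suc n)) ^ Suc n) \<longlonglongrightarrow> exp (- M * c)"
    by (rule LIMSEQ_Suc[OF tendsto_exp_limit_sequentially])
  hence "(\<lambda>n. inverse ((1 + (- M * c) / real (Suc n)) ^ Suc n)) \<longlonglongrightarrow> inverse (exp (- M * c))"
    by (intro tendsto_inverse) auto
  hence ev_b: "\<forall>\<^sub>F n in sequentially. inverse ((1 + (- M * c) / real (Suc n)) ^ Suc n) < exp (M * c) + 1"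
    by (rule order_tendstoD) (simp add: exp_minus)
  \<comment> \<open>On Re v = c the modulus of 1 - M v / (n + 1) is at least its real part 1 - M c /
    (n + 1), whose power converges to exp (M c) after inversion; the added 1 leaves room for one
    bound valid for all n >= n0.\<close>
  obtain n0 where n0: "\<And>n. n \<ge> n0 \<Longrightarrow> p n > c \<and> inverse ((1 + (- M * c) / real (Suc n)) ^ Suc n) < exp (M * c) + 1"
    using eventually_conj[OF ev_p ev_b] by (auto simp: eventually_sequentially)
  have cnz: "Complex c y \<noteq> 0" "Complex c y \<notin> \<real>\<^sub>\<le>\<^sub>0" for y using c by (auto simp: complex_eq_iff complex_nonpos_Reals_iff)
  have npow: "norm (v powr of_real (-1 - x)) = norm v powr (-1 - x)" for v :: complex
    using norm_powr_real_powr'[of "of_real (-1 - x)" v] by (simp del: of_real_diff of_real_minus)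
  have rew: "of_real (-p n) / (v - of_real (p n)) = inverse (1 + (- (of_real M * v)) / of_nat (Suc n))" for n and v :: complex
    using M by (simp add: p_def divide_simps del: of_nat_Suc) (simp add: algebra_simps del: of_nat_Suc)
  have bound: "norm (g n (Complex c y)) \<le> (exp (M * c) + 1) * norm (Complex c y) powr (-1 - x)" if n: "n \<ge> n0" for n y
  proof -
    have pn: "p n > c" using n0[OF n] by simp
    have pos: "1 + (- M * c) / real (Suc n) > 0" using pn M by (simp add: p_def field_simps del: of_nat_Suc)
    have "1 + (- M * c) / real (Suc n) = Re (1 + (- (of_real M * Complex c y)) / of_nat (Suc n))"
      by (simp add: Re_divide_of_nat del: of_nat_Suc)
    also have "\<dots> \<le> norm (1 + (- (of_real M * Complex c y)) / of_nat (Suc n))" by (rule complex_Re_le_cmod)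
    finally have "inverse (norm (1 + (- (of_real M * Complex c y)) / of_nat (Suc n))) ^ Suc n \<le> inverse (1 + (- M * c) / real (Suc n)) ^ Suc n"
      using pos by (intro power_mono le_imp_inverse_le) auto
    also have "\<dots> \<le> exp (M * c) + 1" using n0[OF n] unfolding power_inverse by linarith
    finally show ?thesis unfolding g_def rew norm_mult norm_power norm_inverse npow
      by (intro mult_right_mono) auto
  qed
  have meas: "(\<lambda>y. f (Complex c y)) \<in> borel_measurable lborel"
  proof -
    have "continuous_on UNIV (\<lambda>y. f (Complex c y))" unfolding f_def
      by (intro continuous_intros) (use cnz c in \<open>auto simp: complex_nonpos_Reals_iff\<close>)
    thus ?thesis by (simp add: borel_measurable_continuous_onI)
  qed
  have int_w: "integrable lborel (\<lambda>y. (exp (M * c) + 1) * norm (Complex c y) powr (-1 - x))"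
    using x c by (intro integrable_mult_right integrable_norm_Complex_powr) auto
  show "integrable lborel (\<lambda>y. exp (of_real M * Complex c y) * Complex c y powr of_real (-1 - x))"
  proof (rule Bochner_Integration.integrable_bound[OF int_w])
    show "AE y in lborel. norm (exp (of_real M * Complex c y) * Complex c y powr of_real (-1 - x)) \<le>
        norm ((exp (M * c) + 1) * norm (Complex c y) powr (-1 - x))"
      unfolding norm_mult npow by (intro AE_I2 mult_mono) auto
  qed (use meas in \<open>simp add: f_def\<close>)
  have "(\<lambda>n. LBINT y. g (n + n0) (Complex c y)) \<longlonglongrightarrow> (LBINT y. f (Complex c y))"
  proof (rule integral_dominated_convergence[OF meas _ int_w])
    show "(\<lambda>y. g (n + n0) (Complex c y)) \<in> borel_measurable lborel" for n
      using vertical_integral_approximant(2)[OF x c, of "p (n + n0)" "n + n0"] n0[of "n + n0"]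
      by (auto simp: g_def dest: borel_measurable_integrable)
    show "AE y in lborel. norm (g (n + n0) (Complex c y)) \<le> (exp (M * c) + 1) * norm (Complex c y) powr (-1 - x)" for n
      by (intro AE_I2 bound) auto
    show "AE y in lborel. (\<lambda>n. g (n + n0) (Complex c y)) \<longlonglongrightarrow> f (Complex c y)"
    proof (intro AE_I2 LIMSEQ_ignore_initial_segment)
      fix y :: real
      have "(\<lambda>n. inverse ((1 + (- (of_real M * Complex c y)) / of_nat (Suc n)) ^ Suc n) * Complex c y powr of_real (-1 - x))
         \<longlonglongrightarrow> inverse (exp (- (of_real M * Complex c y))) * Complex c y powr of_real (-1 - x)"
        by (intro tendsto_mult tendsto_inverse tendsto_exp_limit_complex tendsto_const) auto
      thus "(\<lambda>n. g n (Complex c y)) \<longlonglongrightarrow> f (Complex c y)"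
        unfolding g_def f_def rew power_inverse by (simp only: exp_minus inverse_inverse_eq)
    qed
  qed
  moreover have "(\<lambda>n. LBINT y. g (n + n0) (Complex c y)) \<longlonglongrightarrow> of_real (2 * pi * M powr x / Gamma (1 + x))"
  proof -
    have eq: "(LBINT y. g (n + n0) (Complex c y)) = of_real (2 * pi * p (n + n0) powr (-x) * pochhammer (1 + x) (n + n0) / fact (n + n0))" for n
      unfolding g_def by (rule vertical_integral_approximant(1)[OF x c]) (use n0 in auto)
    \<comment> \<open>Gauss's product has a Pochhammer symbol of length n + 1 and the power n^(1+x),
      the integral has length n and (n + 1)^x. The last factor converts one into the other and tends
      to 1.\<close>
    have "(\<lambda>n. 2 * pi * M powr x * (rGamma_series (1 + x) n * (real n powr (1 + x) / ((1 + x + n) * (real n + 1) powr x)))) \<longlonglongrightarrow> 2 * pi * M powr x * (rGamma (1 + x) * 1)"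
      by (intro tendsto_mult tendsto_const rGamma_series_LIMSEQ) (use x in real_asymp)
    moreover have "\<forall>\<^sub>F n in sequentially. 2 * pi * M powr x * (rGamma_series (1 + x) n * (real n powr (1 + x) / ((1 + x + n) * (real n + 1) powr x))) = 
        2 * pi * p n powr (-x) * pochhammer (1 + x) n / fact n"
      using eventually_gt_at_top[of 0]
    proof eventually_elim
      case (elim n)
      have "exp ((1 + x) * ln (of_nat n)) = real n powr (1 + x)" using elim by (simp add: powr_def)
      moreover have "M powr x = p n powr (-x) * (real n + 1) powr x"
        using M by (simp add: p_def powr_divide powr_minus field_simps)
      moreover have "pochhammer (1 + x) (n + 1) = pochhammer (1 + x) n * (1 + x + n)"
        by (simp add: pochhammer_Suc)
      moreover have "1 + x + real n \<noteq> 0" "real n powr (1 + x) \<noteq> 0" "(real n + 1) powr x \<noteq> 0" using x elim by auto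
      ultimately show ?case unfolding rGamma_series_def
        by (simp add: divide_simps)
    qed
    ultimately have "(\<lambda>n. 2 * pi * p n powr (-x) * pochhammer (1 + x) n / fact n) \<longlonglongrightarrow> 2 * pi * M powr x * rGamma (1 + x)"
      by (simp add: Lim_transform_eventually)
    hence "(\<lambda>n. complex_of_real (2 * pi * p n powr (-x) * pochhammer (1 + x) n / fact n)) \<longlonglongrightarrow> of_real (2 * pi * M powr x * rGamma (1 + x))"
      by (rule tendsto_of_real)
    thus ?thesis unfolding eq
      by (intro LIMSEQ_ignore_initial_segment) (simp add: rGamma_inverse_Gamma divide_inverse)
  qed
  ultimately have "(LBINT y. f (Complex c y)) = of_real (2 * pi * M powr x / Gamma (1 + x))"
    by (rule LIMSEQ_unique)
  thus "(LBINT y. exp (of_real M * Complex c y) * Complex c y powr of_real (-1 - x)) =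
     of_real (2 * pi * M powr x / Gamma (1 + x))" by (simp add: f_def)
qed

section \<open>The Mittag-Leffler function as a vertical integral\<close>

lemma norm_powr_of_real: "norm ((z::complex) powr of_real a) = norm z powr a"
  using norm_powr_real_powr'[of "of_real a" z] by simp

lemma powr_inverse_powr_cancel:
  assumes "a > 0" "v \<noteq> 0" "\<bar>Im (Ln v) * a\<bar> < pi"
  shows "(v powr of_real a) powr of_real (1 / a) = v"
proof -
  have "Ln (v powr of_real a) = of_real a * Ln v"
    using assms by (simp add: powr_def) (subst Ln_exp, auto simp: mult.commute abs_if split: if_splits)
  thus ?thesis using assms by (simp add: powr_def)
qed

text \<open>The geometric series over k >= 1 of exp (M v) / v times (z / v^(1/\<rho>))^k. Leaving
  out k = 0 improves the decay on vertical lines from 1 / |v| to |v|^(-1-1/\<rho>), which is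
  integrable. In the right half-plane a pole can occur only where v^(1/\<rho>) = z.\<close>

definition ml_kernel :: "real \<Rightarrow> real \<Rightarrow> complex \<Rightarrow> complex \<Rightarrow> complex" where
  "ml_kernel \<rho> M z v = exp (of_real M * v) * z / (v * (v powr of_real (1 / \<rho>) - z))"

lemma norm_ml_kernel:
  assumes "norm (v powr of_real (1 / \<rho>) - z) \<ge> \<kappa> * norm v powr (1 / \<rho>)" "\<kappa> > 0" "v \<noteq> 0"
  shows "norm (ml_kernel \<rho> M z v) \<le> exp (M * Re v) * norm z / \<kappa> * norm v powr (-1 - 1 / \<rho>)"
proof -
  have "norm (ml_kernel \<rho> M z v) = exp (M * Re v) * norm z / (norm v * norm (v powr of_real (1 / \<rho>) - z))"
    by (simp add: ml_kernel_def norm_mult norm_divide)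
  also have "\<dots> \<le> exp (M * Re v) * norm z / (norm v * (\<kappa> * norm v powr (1 / \<rho>)))"
    using assms by (intro divide_left_mono mult_left_mono mult_nonneg_nonneg mult_pos_pos less_le_trans[OF _ assms(1)]) auto
  also have "\<dots> = exp (M * Re v) * norm z / \<kappa> * norm v powr (-1 - 1 / \<rho>)"
    using assms by (simp add: powr_diff powr_minus field_simps)
  finally show ?thesis .
qed

text \<open>On such a line the geometric series has ratio at most |z| / c^(1/\<rho>) < 1 and may be
  integrated termwise. Each term is the integral of a reciprocal Gamma function, and M = R^\<rho>
  turns M^(k/\<rho>) into R^k. The subtracted 1 is the omitted term k = 0.\<close>

lemma mittag_leffler_vertical_integral:
  assumes rho: "\<rho> > 1" and R: "R > 0" and c: "c > 0" and z: "norm z < c powr (1 / \<rho>)"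
  shows "(LBINT y. ml_kernel \<rho> (R powr \<rho>) z (Complex c y)) = 2 * pi * (mittag_leffler \<rho> (of_real R * z) - 1)"
proof -
  define M where "M = R powr \<rho>"
  have M: "M > 0" using R by (simp add: M_def)
  define q where "q = (\<lambda>v::complex. z / v powr of_real (1 / \<rho>))"
  define \<theta> where "\<theta> = norm z / c powr (1 / \<rho>)"
  have th: "0 \<le> \<theta>" "\<theta> < 1" using z c by (auto simp: \<theta>_def)
  define F where "F = (\<lambda>k v. z ^ Suc k * (exp (of_real M * v) * v powr of_real (-1 - real (Suc k) / \<rho>)))"
  have cnz: "Complex c y \<noteq> 0" for y using c by (auto simp: complex_eq_iff)
  have nc: "norm (Complex c y) \<ge> c" for y using abs_Re_le_cmod[of "Complex c y"] c by simp
  have q: "norm (q (Complex c y)) \<le> \<theta>" for y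
    unfolding q_def \<theta>_def norm_divide norm_powr_of_real
    using nc[of y] c rho by (intro divide_left_mono powr_mono2 mult_pos_pos) (auto simp: cnz)
  have F_eq: "F k v = exp (of_real M * v) / v * q v ^ Suc k" if "v \<noteq> 0" for k v
  proof -
    have "v powr of_real (-1 - real (Suc k) / \<rho>) = v powr (- 1 - of_nat (Suc k) * of_real (1 / \<rho>))"
      by simp
    also have "\<dots> = v powr (-1) / v powr (of_nat (Suc k) * of_real (1 / \<rho>))"
      by (rule powr_diff)
    also have "v powr (of_nat (Suc k) * of_real (1 / \<rho>)) = (v powr of_real (1 / \<rho>)) ^ Suc k"
      using that by (simp only: powr_def if_False exp_of_nat_mult[symmetric] mult.assoc)
    also have "v powr (-1) = 1 / v" using that by (simp add: powr_minus divide_inverse)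
    finally show ?thesis by (simp add: F_def q_def power_divide del: power_Suc)
  qed
  have ml: "(\<lambda>k. ml_coeff \<rho> (Suc k) * (of_real R * z) ^ Suc k) sums (mittag_leffler \<rho> (of_real R * z) - 1)"
  proof -
    have "summable (\<lambda>k. ml_coeff \<rho> k * (of_real R * z) ^ k)" using rho by (intro summable_mittag_leffler) simp
    hence "(\<lambda>k. ml_coeff \<rho> k * (of_real R * z) ^ k) sums mittag_leffler \<rho> (of_real R * z)"
      unfolding mittag_leffler_def by (rule summable_sums)
    thus ?thesis by (subst sums_Suc_iff) (simp add: ml_coeff_def)
  qed
  have Fint: "integrable lborel (\<lambda>y. F k (Complex c y))" for k
    unfolding F_def using rho by (intro integrable_mult_right reciprocal_Gamma_vertical_integral c M) auto
  have LF: "(LBINT y. F k (Complex c y)) = 2 * pi * (ml_coeff \<rho> (Suc k) * (of_real R * z) ^ Suc k)" for k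
  proof -
    have "(LBINT y. F k (Complex c y)) = z ^ Suc k * of_real (2 * pi * M powr (real (Suc k) / \<rho>) / Gamma (1 + real (Suc k) / \<rho>))"
      unfolding F_def using rho by (subst integral_mult_right_zero, subst reciprocal_Gamma_vertical_integral) (auto simp: c M)
    also have "M powr (real (Suc k) / \<rho>) = R ^ Suc k"
      using R rho unfolding M_def powr_powr by (subst powr_realpow[symmetric]) auto
    finally show ?thesis by (simp add: ml_coeff_def power_mult_distrib)
  qed
  have sumF: "(\<lambda>k. F k v) sums ml_kernel \<rho> M z v" if "v \<noteq> 0" "norm (q v) < 1" for v
  proof -
    have w: "v powr of_real (1 / \<rho>) \<noteq> 0" using that by (simp add: powr_def)
    have "(\<lambda>k. exp (of_real M * v) / v * q v * q v ^ k) sums (exp (of_real M * v) / v * q v * (1 / (1 - q v)))"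
      by (intro sums_mult geometric_sums that)
    also have "(\<lambda>k. exp (of_real M * v) / v * q v * q v ^ k) = (\<lambda>k. F k v)"
      by (simp add: F_eq[OF that(1)] mult.assoc)
    also have "q v \<noteq> 1" using that by auto
    hence "exp (of_real M * v) / v * q v * (1 / (1 - q v)) = ml_kernel \<rho> M z v"
      using w that(1) by (simp add: q_def ml_kernel_def divide_simps)
    finally show ?thesis .
  qed
  define I where "I = (LBINT y. norm (Complex c y) powr (-1 - 1 / \<rho>))"
  have Iint: "integrable lborel (\<lambda>y. norm (Complex c y) powr (-1 - 1 / \<rho>))"
    using c rho by (intro integrable_norm_Complex_powr) auto
  have nF: "norm (F k (Complex c y)) \<le> exp (M * c) * norm z * \<theta> ^ k * norm (Complex c y) powr (-1 - 1 / \<rho>)" for k y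
  proof -
    have "norm (F k (Complex c y)) = exp (M * c) / norm (Complex c y) * (norm z / norm (Complex c y) powr (1 / \<rho>)) * norm (q (Complex c y)) ^ k"
      unfolding F_eq[OF cnz] by (simp add: norm_mult norm_divide norm_power) (simp add: q_def norm_divide norm_powr_of_real mult_ac flip: of_real_divide of_real_inverse)
    also have "\<dots> \<le> exp (M * c) / norm (Complex c y) * (norm z / norm (Complex c y) powr (1 / \<rho>)) * \<theta> ^ k"
      using q by (intro mult_left_mono power_mono) auto
    also have "\<dots> = exp (M * c) * norm z * \<theta> ^ k * norm (Complex c y) powr (-1 - 1 / \<rho>)"
      using cnz[of y] by (simp add: powr_diff powr_minus field_simps)
    finally show ?thesis .
  qed
  have "(\<lambda>k. LBINT y. F k (Complex c y)) sums (LBINT y. (\<Sum>k. F k (Complex c y)))"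
  proof (rule sums_integral)
    show "AE y in lborel. summable (\<lambda>k. norm (F k (Complex c y)))"
    proof (rule AE_I2)
      fix y :: real
      have "summable (\<lambda>k. exp (M * c) * norm z * \<theta> ^ k * norm (Complex c y) powr (-1 - 1 / \<rho>))"
        using th by (intro summable_mult summable_mult2 summable_geometric) auto
      thus "summable (\<lambda>k. norm (F k (Complex c y)))"
        by (rule summable_comparison_test'[of _ 0]) (use nF in auto)
    qed
    show "summable (\<lambda>k. LBINT y. norm (F k (Complex c y)))"
    proof (rule summable_comparison_test'[of _ 0])
      show "summable (\<lambda>k. exp (M * c) * norm z * \<theta> ^ k * I)"
        using th by (intro summable_mult summable_mult2 summable_geometric) auto
      fix k :: nat
      have "(LBINT y. norm (F k (Complex c y))) \<le> (LBINT y. exp (M * c) * norm z * \<theta> ^ k * norm (Complex c y) powr (-1 - 1 / \<rho>))"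
        by (intro integral_mono integrable_norm Fint integrable_mult_right Iint nF)
      thus "norm (LBINT y. norm (F k (Complex c y))) \<le> exp (M * c) * norm z * \<theta> ^ k * I"
        by (simp add: I_def)
    qed
  qed (rule Fint)
  also have "(\<lambda>y. \<Sum>k. F k (Complex c y)) = (\<lambda>y. ml_kernel \<rho> M z (Complex c y))"
    using le_less_trans[OF q th(2)] by (intro ext sums_unique[symmetric] sumF cnz)
  finally have "(\<lambda>k. LBINT y. F k (Complex c y)) sums (LBINT y. ml_kernel \<rho> M z (Complex c y))" .
  moreover have "(\<lambda>k. LBINT y. F k (Complex c y)) sums (2 * pi * (mittag_leffler \<rho> (of_real R * z) - 1))"
    unfolding LF by (intro sums_mult ml)
  ultimately show ?thesis unfolding M_def by (rule sums_unique2)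
qed


text \<open>The lower bound has to grow like |v|^(1/\<rho>), because that growth provides the
  integrable decay in \<open>norm_ml_kernel\<close>. It comes from compactness for bounded v and
  from the triangle inequality for large v, uniformly for z near z0.\<close>

lemma ml_kernel_separation:
  fixes \<rho> c :: real and z0 :: complex
  assumes rho: "\<rho> > 1" and A: "closed A" "A \<subseteq> {v. Re v > 0}"
    and z0: "\<And>v. v \<in> A \<Longrightarrow> v powr of_real (1 / \<rho>) \<noteq> z0"
  obtains \<kappa> r where "\<kappa> > 0" "r > 0"
    "\<And>z v. z \<in> ball z0 r \<Longrightarrow> v \<in> A \<Longrightarrow> \<kappa> * norm v powr (1 / \<rho>) \<le> norm (v powr of_real (1 / \<rho>) - z)"
proof -
  \<comment> \<open>As r <= 1, every z in the ball has |z| < B / 2, so |w| > B forces |w - z| >= |w|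
    / 2.\<close>
  define B where "B = 2 * (norm z0 + 1)"
  have B: "B > 0" by (simp add: B_def add_nonneg_pos)
  define D where "D = A \<inter> cball 0 (B powr \<rho>)"
  have "compact D" unfolding D_def using A(1) by (intro closed_Int_compact) auto
  moreover have "continuous_on D (\<lambda>v. v powr of_real (1 / \<rho>))"
    using A(2) by (intro continuous_intros) (auto simp: D_def complex_nonpos_Reals_iff)
  ultimately have "closed ((\<lambda>v. v powr of_real (1 / \<rho>)) ` D)"
    using compact_continuous_image compact_imp_closed by blast
  moreover have "z0 \<notin> (\<lambda>v. v powr of_real (1 / \<rho>)) ` D" using z0 by (auto simp: D_def)
  ultimately obtain d where d: "d > 0" "\<And>w. w \<in> (\<lambda>v. v powr of_real (1 / \<rho>)) ` D \<Longrightarrow> d \<le> dist z0 w"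
    using separate_point_closed by metis
  define r where "r = min 1 (d / 2)"
  define \<kappa> where "\<kappa> = min (1/2) (d / (2 * B))"
  show ?thesis
  proof (rule that[of \<kappa> r])
    show "\<kappa> > 0" "r > 0" using d B by (auto simp: \<kappa>_def r_def)
    fix z v assume z: "z \<in> ball z0 r" and v: "v \<in> A"
    define w where "w = v powr of_real (1 / \<rho>)"
    have w: "norm w = norm v powr (1 / \<rho>)" by (simp only: w_def norm_powr_of_real)
    have zr: "norm (z - z0) < 1" "norm (z - z0) < d / 2" using z by (auto simp: r_def dist_norm norm_minus_commute)
    show "\<kappa> * norm v powr (1 / \<rho>) \<le> norm (v powr of_real (1 / \<rho>) - z)"
      unfolding w_def[symmetric] w[symmetric]
    proof (cases "norm w \<le> B")
      case True
      have "norm v = norm w powr \<rho>" using rho by (simp add: w powr_powr)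
      also have "\<dots> \<le> B powr \<rho>" using True rho by (intro powr_mono2) auto
      finally have "w \<in> (\<lambda>v. v powr of_real (1 / \<rho>)) ` D" using v by (auto simp: w_def D_def)
      hence "d \<le> norm (w - z0)" using d by (simp add: dist_norm norm_minus_commute)
      also have "\<dots> \<le> norm (w - z) + norm (z - z0)" using norm_triangle_ineq[of "w - z" "z - z0"] by simp
      finally have "d / 2 \<le> norm (w - z)" using zr by simp
      moreover have "\<kappa> * norm w \<le> d / (2 * B) * B"
        using True B d by (intro mult_mono) (auto simp: \<kappa>_def)
      ultimately show "\<kappa> * norm w \<le> norm (w - z)" using B by simp
    next
      case False
      have "norm w \<le> norm (w - z) + norm (z - z0) + norm z0"
        using norm_triangle_ineq[of "w - z" z] norm_triangle_ineq[of "z - z0" z0] by simp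
      hence "norm w / 2 \<le> norm (w - z)" using False zr by (simp add: B_def)
      moreover have "\<kappa> * norm w \<le> 1/2 * norm w" by (intro mult_right_mono) (auto simp: \<kappa>_def)
      ultimately show "\<kappa> * norm w \<le> norm (w - z)" by simp
    qed
  qed
qed

text \<open>The argument of v is below \<pi> / 2 in modulus and division by \<rho> > 1 shrinks it,
  so the principal branches invert each other. Hence a solution of v^(1/\<rho>) = z in the right
  half-plane can only be z^\<rho>.\<close>

lemma ml_root_unique:
  assumes "\<rho> > 1" "Re v > 0"
  shows "(v powr of_real (1 / \<rho>)) powr of_real \<rho> = v"
proof -
  have "\<bar>Im (Ln v)\<bar> < pi / 2" using assms by (intro Re_Ln_pos_lt_imp)
  hence "\<bar>Im (Ln v) * (1 / \<rho>)\<bar> < pi / 2 / \<rho>" using assms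
    divide_strict_right_mono[of "\<bar>Im (Ln v)\<bar>" "pi / 2" \<rho>] by (simp only: abs_mult abs_divide) simp
  also have "\<dots> \<le> pi / 2 / 1" using assms by (intro divide_left_mono) auto
  also have "\<dots> < pi" by simp
  finally have "\<bar>Im (Ln v) * (1 / \<rho>)\<bar> < pi" .
  moreover have "v \<noteq> 0" using assms by auto
  ultimately show ?thesis using powr_inverse_powr_cancel[of "1 / \<rho>" v] assms by auto
qed

text \<open>The line is moved from a remote Re v = C, where the integral represents E, back to Re v
  = c. In the bound R occurs only through exp (R^\<rho> c), so the position of the line alone
  decides the rate of the error.\<close>

lemma mittag_leffler_residue_estimate:
  fixes \<rho> :: real
  assumes rho: "\<rho> > 1" and R: "R > 0" and c: "c > 0" and kap: "\<kappa> > 0"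
    and sep: "\<And>v. Re v = c \<Longrightarrow> \<kappa> * norm v powr (1 / \<rho>) \<le> norm (v powr of_real (1 / \<rho>) - z)"
  shows "norm (mittag_leffler \<rho> (of_real R * z) -
      (if \<exists>v. Re v > c \<and> v powr of_real (1 / \<rho>) = z then of_real \<rho> * exp (of_real (R powr \<rho>) * z powr of_real \<rho>) else 0))
    \<le> 1 + exp (R powr \<rho> * c) * (norm z / \<kappa> * (LBINT y. norm (Complex c y) powr (-1 - 1 / \<rho>)))"
proof -
  define M where "M = R powr \<rho>"
  define f where "f = ml_kernel \<rho> M z"
  define I where "I = (LBINT y. norm (Complex c y) powr (-1 - 1 / \<rho>))"
  define pts where "pts = {v. Re v > 0 \<and> v powr of_real (1 / \<rho>) = z}"
  \<comment> \<open>Far enough for the geometric series, since C^(1/\<rho>) >= |z| + 1, and by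
    \<open>big\<close> to the right of any pole.\<close>
  define C where "C = max (c + 1) ((norm z + 1) powr \<rho>)"
  have C: "C > c" "C > 0" using c by (auto simp: C_def)
  have M: "M > 0" using R by (simp add: M_def)
  have pts: "pts \<subseteq> {z powr of_real \<rho>}" using ml_root_unique[OF rho] by (auto simp: pts_def)
  have "((norm z + 1) powr \<rho>) powr (1 / \<rho>) \<le> C powr (1 / \<rho>)"
    using rho by (intro powr_mono2) (auto simp: C_def)
  hence zC: "norm z < C powr (1 / \<rho>)" using rho by (simp add: powr_powr)
  have big: "norm (v powr of_real (1 / \<rho>) - z) \<ge> 1" if "norm v \<ge> (norm z + 1) powr \<rho>" for v
  proof -
    have "((norm z + 1) powr \<rho>) powr (1 / \<rho>) \<le> norm v powr (1 / \<rho>)"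
      using rho that by (intro powr_mono2) auto
    hence "norm z + 1 \<le> norm (v powr of_real (1 / \<rho>))" using rho by (simp add: powr_powr norm_powr_of_real del: of_real_divide)
    thus ?thesis using norm_triangle_ineq2[of "v powr of_real (1 / \<rho>)" z] by linarith
  qed
  have pC: "Re p < C" if "p \<in> pts" for p
  proof -
    have "\<not> norm p \<ge> (norm z + 1) powr \<rho>" using big[of p] that by (auto simp: pts_def)
    thus ?thesis using complex_Re_le_cmod[of p] by (simp add: C_def)
  qed
  have pc: "Re p \<noteq> c" if "p \<in> pts" for p
  proof
    assume "Re p = c"
    hence "\<kappa> * norm p powr (1 / \<rho>) \<le> 0" using sep[of p] that by (simp add: pts_def)
    moreover have "p \<noteq> 0" using that by (auto simp: pts_def)
    ultimately show False using kap by (simp add: mult_le_0_iff)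
  qed
  have f_holo: "f holomorphic_on ({v. Re v > 0} - pts)" unfolding f_def ml_kernel_def
    by (intro holomorphic_intros) (auto simp: complex_nonpos_Reals_iff pts_def)
  have meas: "(\<lambda>y. f (Complex b y)) \<in> borel_measurable lborel" if "b > 0" "\<And>p. p \<in> pts \<Longrightarrow> Re p \<noteq> b" for b
  proof -
    have npts: "Complex b y \<notin> pts" for y using that(2)[of "Complex b y"] by auto
    have "continuous_on UNIV (\<lambda>y. f (Complex b y))"
      by (rule continuous_on_compose2[OF holomorphic_on_imp_continuous_on[OF f_holo], where f = "\<lambda>y. Complex b y"])
         (use that npts in \<open>auto intro!: continuous_intros\<close>)
    thus ?thesis by (simp add: borel_measurable_continuous_onI)
  qed
  have Iint: "integrable lborel (\<lambda>y. norm (Complex b y) powr (-1 - 1 / \<rho>))" if "b > 0" for b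
    using that rho by (intro integrable_norm_Complex_powr) auto
  have int: "integrable lborel (\<lambda>y. f (Complex b y))" 
    if "b > 0" "\<kappa>' > 0" and sep': "\<And>v. Re v = b \<Longrightarrow> \<kappa>' * norm v powr (1 / \<rho>) \<le> norm (v powr of_real (1 / \<rho>) - z)" for b \<kappa>'
  proof (rule Bochner_Integration.integrable_bound)
    show "integrable lborel (\<lambda>y. exp (M * b) * norm z / \<kappa>' * norm (Complex b y) powr (-1 - 1 / \<rho>))"
      by (intro integrable_mult_right Iint that)
    have "Re p \<noteq> b" if "p \<in> pts" for p
    proof
      assume "Re p = b"
      hence "\<kappa>' * norm p powr (1 / \<rho>) \<le> 0" using sep'[of p] that by (simp add: pts_def)
      moreover have "p \<noteq> 0" using that by (auto simp: pts_def)
      ultimately show False using \<open>\<kappa>' > 0\<close> by (simp add: mult_le_0_iff)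
    qed
    thus "(\<lambda>y. f (Complex b y)) \<in> borel_measurable lborel" using meas[OF that(1)] by blast
    show "AE y in lborel. norm (f (Complex b y)) \<le> norm (exp (M * b) * norm z / \<kappa>' * norm (Complex b y) powr (-1 - 1 / \<rho>))"
    proof (rule AE_I2)
      fix y
      have "Complex b y \<noteq> 0" using that by (auto simp: complex_eq_iff)
      from norm_ml_kernel[OF sep' that(2) this, of M]
      show "norm (f (Complex b y)) \<le> norm (exp (M * b) * norm z / \<kappa>' * norm (Complex b y) powr (-1 - 1 / \<rho>))"
        using that by (simp add: f_def)
    qed
  qed
  have intc: "integrable lborel (\<lambda>y. f (Complex c y))" by (rule int[OF c kap sep])
  have intC: "integrable lborel (\<lambda>y. f (Complex C y))"
  proof (rule int[OF C(2)])
    show "1 - norm z / C powr (1 / \<rho>) > 0" using zC C by simp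
    fix v assume "Re v = C"
    hence "C powr (1 / \<rho>) \<le> norm v powr (1 / \<rho>)"
      using C rho complex_Re_le_cmod[of v] by (intro powr_mono2) auto
    hence "norm z \<le> norm z / C powr (1 / \<rho>) * norm v powr (1 / \<rho>)"
      using C by (simp add: field_simps mult_left_mono)
    thus "(1 - norm z / C powr (1 / \<rho>)) * norm v powr (1 / \<rho>) \<le> norm (v powr of_real (1 / \<rho>) - z)"
      using norm_triangle_ineq2[of "v powr of_real (1 / \<rho>)" z] unfolding norm_powr_of_real by (simp add: algebra_simps)
  qed
  have shift: "(LBINT y. f (Complex C y)) - (LBINT y. f (Complex c y)) = 2 * pi * (\<Sum>p\<in>{p\<in>pts. c < Re p \<and> Re p < C}. residue f p)"
  proof (rule vertical_line_shift[OF c C(1) _ f_holo _ intc intC, where Y = "max 1 ((norm z + 1) powr \<rho>)" and b = "\<lambda>t. exp (M * C) * norm z / t"])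
    show "finite pts" using pts by (rule finite_subset) auto
    show "((\<lambda>t. exp (M * C) * norm z / t) \<longlongrightarrow> 0) at_top" by real_asymp
    fix v assume v: "Re v \<le> C" "max 1 ((norm z + 1) powr \<rho>) \<le> \<bar>Im v\<bar>"
    have "norm (f v) = exp (M * Re v) * norm z / (norm v * norm (v powr of_real (1 / \<rho>) - z))"
      by (simp add: f_def ml_kernel_def norm_mult norm_divide)
    also have "\<dots> \<le> exp (M * C) * norm z / (\<bar>Im v\<bar> * 1)"
      using v M abs_Im_le_cmod[of v] big[of v]
      by (intro frac_le mult_right_mono mult_mono) auto
    finally show "norm (f v) \<le> exp (M * C) * norm z / \<bar>Im v\<bar>" by simp
  qed (use pc pC in auto)
  have res: "residue f p = of_real \<rho> * exp (of_real M * z powr of_real \<rho>)" if p: "p \<in> pts" for p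
  proof -
    have p_eq: "p = z powr of_real \<rho>" and Rep: "Re p > 0" and pz: "p powr of_real (1 / \<rho>) = z" using p pts by (auto simp: pts_def)
    have p0: "p \<noteq> 0" "p \<notin> \<real>\<^sub>\<le>\<^sub>0" using Rep by (auto simp: complex_nonpos_Reals_iff)
    have z: "z \<noteq> 0" using pz p0 by (auto simp: powr_def)
    have f_alt: "f = (\<lambda>v. (exp (of_real M * v) * z / v) / (v powr of_real (1 / \<rho>) - z))"
      by (simp add: f_def ml_kernel_def fun_eq_iff)
    \<comment> \<open>Since p^(1/\<rho>) = z, the derivative of the denominator is z / (\<rho> p);
      the factor z / p cancels against the numerator and leaves \<rho>.\<close>
    have pw: "p powr (of_real (1 / \<rho>) - 1) = z / p" using p0 pz by (simp add: powr_diff)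
    have "residue f p = (exp (of_real M * p) * z / p) / (of_real (1 / \<rho>) * p powr (of_real (1 / \<rho>) - 1))"
      unfolding f_alt
    proof (rule residue_simple_pole_deriv[of _ "{v. Re v > 0}"])
      show "((\<lambda>v. v powr of_real (1 / \<rho>) - z) has_field_derivative of_real (1 / \<rho>) * p powr (of_real (1 / \<rho>) - 1)) (at p)"
        using p0 by (auto intro!: derivative_eq_intros)
      show "of_real (1 / \<rho>) * p powr (of_real (1 / \<rho>) - 1) \<noteq> 0" unfolding pw using p0 z rho by simp
      show "connected {v. Re v > 0}" by (intro convex_connected convex_halfspace_Re_gt)
    qed (use p0 z pz Rep rho in \<open>auto intro!: holomorphic_intros simp: open_halfspace_Re_gt complex_nonpos_Reals_iff\<close>)
    also note pw
    also have "(exp (of_real M * p) * z / p) / (of_real (1 / \<rho>) * (z / p)) = of_real \<rho> * exp (of_real M * p)"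
      using p0 z rho by (simp add: field_simps)
    finally show ?thesis by (simp add: p_eq)
  qed
  have S: "(\<Sum>p\<in>{p\<in>pts. c < Re p \<and> Re p < C}. residue f p) =
      (if \<exists>v. Re v > c \<and> v powr of_real (1 / \<rho>) = z then of_real \<rho> * exp (of_real M * z powr of_real \<rho>) else 0)"
  proof (cases "\<exists>v. Re v > c \<and> v powr of_real (1 / \<rho>) = z")
    case True
    then obtain v where v: "Re v > c" "v powr of_real (1 / \<rho>) = z" by blast
    hence vp: "v \<in> pts" using c by (simp add: pts_def)
    hence "pts = {v}" using pts by auto
    hence "{p\<in>pts. c < Re p \<and> Re p < C} = {v}" using v pC[OF vp] by auto
    thus ?thesis using True res[OF vp] by auto
  next
    case False
    hence "{p\<in>pts. c < Re p \<and> Re p < C} = {}" using c by (auto simp: pts_def)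
    thus ?thesis unfolding if_not_P[OF False] by (simp only: sum.empty)
  qed
  have "(LBINT y. f (Complex C y)) = 2 * pi * (mittag_leffler \<rho> (of_real R * z) - 1)"
    unfolding f_def M_def by (rule mittag_leffler_vertical_integral[OF rho R C(2) zC])
  hence E: "mittag_leffler \<rho> (of_real R * z) - 
      (if \<exists>v. Re v > c \<and> v powr of_real (1 / \<rho>) = z then of_real \<rho> * exp (of_real M * z powr of_real \<rho>) else 0) =
      1 + (LBINT y. f (Complex c y)) / (2 * pi)"
    using shift unfolding S by (simp add: field_simps)
  have "norm (LBINT y. f (Complex c y)) \<le> (LBINT y. exp (M * c) * norm z / \<kappa> * norm (Complex c y) powr (-1 - 1 / \<rho>))"
  proof (rule Bochner_Integration.integral_norm_bound_integral[OF intc])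
    show "integrable lborel (\<lambda>y. exp (M * c) * norm z / \<kappa> * norm (Complex c y) powr (-1 - 1 / \<rho>))"
      by (intro integrable_mult_right Iint c)
    fix y
    have "Complex c y \<noteq> 0" using c by (auto simp: complex_eq_iff)
    from norm_ml_kernel[OF sep kap this, of M]
    show "norm (f (Complex c y)) \<le> exp (M * c) * norm z / \<kappa> * norm (Complex c y) powr (-1 - 1 / \<rho>)"
      by (simp add: f_def)
  qed
  also have "\<dots> = exp (M * c) * (norm z / \<kappa> * I)" by (simp add: I_def)
  finally have L: "norm (LBINT y. f (Complex c y)) \<le> exp (M * c) * (norm z / \<kappa> * I)" .
  have "norm ((LBINT y. f (Complex c y)) / (2 * pi)) \<le> norm (LBINT y. f (Complex c y)) / 1"
    unfolding norm_divide using pi_gt3 by (intro divide_left_mono) auto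
  hence "norm (1 + (LBINT y. f (Complex c y)) / (2 * pi)) \<le> 1 + exp (M * c) * (norm z / \<kappa> * I)"
    using L norm_triangle_ineq[of 1 "(LBINT y. f (Complex c y)) / (2 * pi)"] by simp
  thus ?thesis using E unfolding M_def I_def by simp
qed

subsection \<open>Which term dominates\<close>

lemma eventually_nhds_less:
  fixes f :: "'a::t2_space \<Rightarrow> real"
  assumes "isCont f a" "f a < b"
  shows "\<forall>\<^sub>F z in nhds a. f z < b"
  using assms order_tendstoD(2)[of f "f a" "at a" b] by (simp add: isCont_def eventually_nhds_conv_at)

lemma eventually_nhds_greater:
  fixes f :: "'a::t2_space \<Rightarrow> real"
  assumes "isCont f a" "f a > b"
  shows "\<forall>\<^sub>F z in nhds a. f z > b"
  using assms order_tendstoD(1)[of f "f a" "at a" b] by (simp add: isCont_def eventually_nhds_conv_at)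

lemma isCont_Re_powr: "z0 \<notin> \<real>\<^sub>\<le>\<^sub>0 \<Longrightarrow> isCont (\<lambda>z. Re (z powr s)) z0"
  by (intro bounded_linear.isCont[OF bounded_linear_Re] DERIV_isCont[OF has_field_derivative_powr])

text \<open>The open sector |arg z| < \<pi> / (2 \<rho>) without 0, written as the image of the
  right half-plane: in this form it says that a contour shift can meet a pole.\<close>

definition in_sector :: "real \<Rightarrow> complex \<Rightarrow> bool" where
  "in_sector \<rho> z \<longleftrightarrow> (\<exists>v. Re v > 0 \<and> v powr of_real (1 / \<rho>) = z)"

text \<open>The rate, in units of M = R_n^\<rho>, at which the exponential part of E outgrows the
  section; it has this meaning inside the sector.\<close>

definition szego_fun :: "real \<Rightarrow> complex \<Rightarrow> real" where
  "szego_fun \<rho> z = Re (z powr of_real \<rho>) - 1 - \<rho> * ln (norm z)"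

context
  fixes \<rho> :: real
  assumes rho: "\<rho> > 1"
begin

section \<open>Local bounds for E, and the comparison of growth rates\<close>

lemma Ln_ml_root:
  assumes "Re v > 0"
  shows "Ln (v powr of_real (1 / \<rho>)) = Ln v / of_real \<rho>"
    and "\<bar>Im (Ln (v powr of_real (1 / \<rho>)))\<bar> < pi / (2 * \<rho>)"
    and "Re (v powr of_real (1 / \<rho>)) > 0"
proof -
  have v: "v \<noteq> 0" using assms by auto
  have "\<bar>Im (Ln v)\<bar> < pi / 2" using assms by (rule Re_Ln_pos_lt_imp)
  hence "\<bar>Im (Ln v)\<bar> / \<rho> < pi / 2 / \<rho>" using rho by (intro divide_strict_right_mono) auto
  hence 1: "\<bar>Im (Ln v / of_real \<rho>)\<bar> < pi / (2 * \<rho>)" using rho by (simp add: abs_divide)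
  have "pi / 2 / \<rho> \<le> pi / 2 / 1" using rho by (intro divide_left_mono) auto
  hence "pi / (2 * \<rho>) \<le> pi / 2" by (simp only: divide_divide_eq_left div_by_1)
  hence 2: "\<bar>Im (Ln v / of_real \<rho>)\<bar> < pi / 2" using 1 by linarith
  have "Ln (exp (Ln v / of_real \<rho>)) = Ln v / of_real \<rho>"
    using 2 pi_gt_zero by (intro Ln_exp) linarith+
  thus 3: "Ln (v powr of_real (1 / \<rho>)) = Ln v / of_real \<rho>" using v by (simp add: powr_def)
  show "\<bar>Im (Ln (v powr of_real (1 / \<rho>)))\<bar> < pi / (2 * \<rho>)" unfolding 3 by (rule 1)
  have "v powr of_real (1 / \<rho>) \<noteq> 0" using v by (simp add: powr_def)
  thus "Re (v powr of_real (1 / \<rho>)) > 0" using 2 Re_Ln_pos_lt[of "v powr of_real (1 / \<rho>)"] unfolding 3 by simp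
qed

text \<open>By separation, the absence of a pole in Re v >= c passes from z0 to all z in a ball, so
  only the integral over Re v = c remains, with constants uniform in z and R.\<close>

lemma mittag_leffler_bound_without_pole:
  assumes c: "c > 0" and np: "\<And>v. Re v \<ge> c \<Longrightarrow> v powr of_real (1 / \<rho>) \<noteq> z0"
  obtains r K where "r > 0" "K > 0"
    "\<And>z R. z \<in> ball z0 r \<Longrightarrow> R > 0 \<Longrightarrow> norm (mittag_leffler \<rho> (of_real R * z)) \<le> K * exp (c * R powr \<rho>)"
proof -
  obtain \<kappa> r where k: "\<kappa> > 0" "r > 0" and
    sep: "\<And>z v. z \<in> ball z0 r \<Longrightarrow> v \<in> {v. Re v \<ge> c} \<Longrightarrow> \<kappa> * norm v powr (1 / \<rho>) \<le> norm (v powr of_real (1 / \<rho>) - z)"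
  proof (rule ml_kernel_separation[OF rho, of "{v. Re v \<ge> c}" z0])
    show "closed {v. Re v \<ge> c}" by (rule closed_halfspace_Re_ge)
  qed (use np c that in auto)
  define I where "I = (LBINT y. norm (Complex c y) powr (-1 - 1 / \<rho>))"
  have I: "I \<ge> 0" unfolding I_def by (intro Bochner_Integration.integral_nonneg) auto
  define K where "K = 1 + (norm z0 + r) / \<kappa> * I"
  have "norm (mittag_leffler \<rho> (of_real R * z)) \<le> K * exp (c * R powr \<rho>)" if z: "z \<in> ball z0 r" and R: "R > 0" for z R
  proof -
    have no: "\<not> (\<exists>v. Re v > c \<and> v powr of_real (1 / \<rho>) = z)"
    proof
      assume "\<exists>v. Re v > c \<and> v powr of_real (1 / \<rho>) = z"
      then obtain v where v: "Re v > c" "v powr of_real (1 / \<rho>) = z" by blast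
      hence "v \<noteq> 0" using c by auto
      moreover have "\<kappa> * norm v powr (1 / \<rho>) \<le> 0" using sep[OF z, of v] v by simp
      ultimately show False using k by (simp add: mult_le_0_iff)
    qed
    have "norm (mittag_leffler \<rho> (of_real R * z)) \<le> 1 + exp (R powr \<rho> * c) * (norm z / \<kappa> * I)"
      using mittag_leffler_residue_estimate[OF rho R c k(1), of z] sep[OF z] unfolding if_not_P[OF no] I_def by simp
    also have "\<dots> \<le> 1 * exp (R powr \<rho> * c) + exp (R powr \<rho> * c) * ((norm z0 + r) / \<kappa> * I)"
      using z k c I norm_triangle_ineq2[of z z0]
      by (intro add_mono mult_left_mono mult_right_mono divide_right_mono) (auto simp: dist_norm norm_minus_commute)
    also have "\<dots> = K * exp (c * R powr \<rho>)" by (simp add: K_def algebra_simps)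
    finally show ?thesis .
  qed
  moreover have "K > 0" using k I unfolding K_def by (intro add_pos_nonneg mult_nonneg_nonneg divide_nonneg_pos) auto
  ultimately show ?thesis using that k by blast
qed

text \<open>Here only the line Re v = c is kept apart from the solutions. For z near z0 the power
  z^\<rho> keeps real part above c and stays in the range where the branches invert each other, so
  every such z has its pole crossed.\<close>

lemma mittag_leffler_bound_near_pole:
  assumes c: "c > 0" and v0: "Re v0 > c" "v0 powr of_real (1 / \<rho>) = z0"
  obtains r K where "r > 0" "K > 0"
    "\<And>z R. z \<in> ball z0 r \<Longrightarrow> R > 0 \<Longrightarrow>
       norm (mittag_leffler \<rho> (of_real R * z) - of_real \<rho> * exp (of_real (R powr \<rho>) * z powr of_real \<rho>)) \<le> K * exp (c * R powr \<rho>)"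
proof -
  have v0': "v0 \<noteq> 0" "z0 powr of_real \<rho> = v0" and Lnv0: "\<bar>Im (Ln v0)\<bar> < pi / 2"
    using ml_root_unique[OF rho, of v0] v0 c Re_Ln_pos_lt_imp[of v0] by auto
  have Rev0: "Re v0 > 0" using v0 c by simp
  note Lnz = Ln_ml_root[OF Rev0, unfolded v0(2)]
  have Lnz0: "\<bar>Im (Ln z0) * \<rho>\<bar> < pi" using Lnz(1) Lnv0 rho pi_gt_zero by simp
  have z0: "z0 \<noteq> 0" "z0 \<notin> \<real>\<^sub>\<le>\<^sub>0" using Lnz(3) by (auto simp: complex_nonpos_Reals_iff)
  have np: "v powr of_real (1 / \<rho>) \<noteq> z0" if "Re v = c" for v
    using ml_root_unique[OF rho, of v] that v0' v0 c by auto
  obtain \<kappa> r where k: "\<kappa> > 0" "r > 0" and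
    sep: "\<And>z v. z \<in> ball z0 r \<Longrightarrow> v \<in> {v. Re v = c} \<Longrightarrow> \<kappa> * norm v powr (1 / \<rho>) \<le> norm (v powr of_real (1 / \<rho>) - z)"
  proof (rule ml_kernel_separation[OF rho, of "{v. Re v = c}" z0])
    show "closed {v. Re v = c}" using closed_halfspace_Re_le[of c] closed_halfspace_Re_ge[of c]
        closed_Int[of "{v. Re v \<le> c}" "{v. Re v \<ge> c}"] by (simp add: Int_def eq_iff)
  qed (use np c that in auto)
  have "\<forall>\<^sub>F z in nhds z0. z \<noteq> 0 \<and> \<bar>Im (Ln z) * \<rho>\<bar> < pi \<and> Re (z powr of_real \<rho>) > c"
  proof (intro eventually_conj)
    have "isCont (\<lambda>z. \<bar>Im (Ln z) * \<rho>\<bar>) z0" using z0 by (intro continuous_intros) auto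
    thus "\<forall>\<^sub>F z in nhds z0. \<bar>Im (Ln z) * \<rho>\<bar> < pi"
      by (rule eventually_nhds_less) (rule Lnz0)
    show "\<forall>\<^sub>F z in nhds z0. Re (z powr of_real \<rho>) > c"
      by (rule eventually_nhds_greater[OF isCont_Re_powr]) (use z0 v0 v0' in simp_all)
    show "\<forall>\<^sub>F z in nhds z0. z \<noteq> 0" by (rule t1_space_nhds[OF z0(1)])
  qed
  then obtain r' where r': "r' > 0" "\<And>z. dist z z0 < r' \<Longrightarrow> z \<noteq> 0 \<and> \<bar>Im (Ln z) * \<rho>\<bar> < pi \<and> Re (z powr of_real \<rho>) > c"
    by (auto simp: eventually_nhds_metric)
  define I where "I = (LBINT y. norm (Complex c y) powr (-1 - 1 / \<rho>))"
  have I: "I \<ge> 0" unfolding I_def by (intro Bochner_Integration.integral_nonneg) auto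
  define K where "K = 1 + (norm z0 + r) / \<kappa> * I"
  have "norm (mittag_leffler \<rho> (of_real R * z) - of_real \<rho> * exp (of_real (R powr \<rho>) * z powr of_real \<rho>)) \<le> K * exp (c * R powr \<rho>)"
    if z': "z \<in> ball z0 (min r r')" and R: "R > 0" for z R
  proof -
    have z: "z \<in> ball z0 r" "dist z z0 < r'" using z' by (auto simp: dist_commute)
    have yes: "\<exists>v. Re v > c \<and> v powr of_real (1 / \<rho>) = z"
      using r'(2)[OF z(2)] powr_inverse_powr_cancel[of \<rho> z] rho by (intro exI[of _ "z powr of_real \<rho>"]) auto
    have "norm (mittag_leffler \<rho> (of_real R * z) - of_real \<rho> * exp (of_real (R powr \<rho>) * z powr of_real \<rho>)) \<le> 1 + exp (R powr \<rho> * c) * (norm z / \<kappa> * I)"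
      using mittag_leffler_residue_estimate[OF rho R c k(1), of z] sep[OF z(1)] unfolding if_P[OF yes] I_def by simp
    also have "\<dots> \<le> 1 * exp (R powr \<rho> * c) + exp (R powr \<rho> * c) * ((norm z0 + r) / \<kappa> * I)"
      using z k c I norm_triangle_ineq2[of z z0]
      by (intro add_mono mult_left_mono mult_right_mono divide_right_mono) (auto simp: dist_norm norm_minus_commute)
    also have "\<dots> = K * exp (c * R powr \<rho>)" by (simp add: K_def algebra_simps)
    finally show ?thesis .
  qed
  moreover have "K > 0" using k I unfolding K_def by (intro add_pos_nonneg mult_nonneg_nonneg divide_nonneg_pos) auto
  ultimately show ?thesis using that[of "min r r'" K] k r' by auto
qed

text \<open>Divided by n the expression tends to (s + b + c) / \<rho>. The signs s = 1 and s = -1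
  serve the two directions of comparison; the subtracted logarithm is room for a factor (\<rho> +
  n)^2.\<close>

lemma ml_growth_at_top:
  fixes s b c :: real
  assumes "s + b + c > 0"
  shows "filterlim (\<lambda>n. s * ln (ml_max \<rho> n) + n * b / \<rho> + c * (ml_R \<rho> n powr \<rho>) - 2 * ln (\<rho> + n)) at_top sequentially"
proof -
  have "(\<lambda>n. s * (ln (ml_max \<rho> n) / n) + b / \<rho> + c * (ml_R \<rho> n powr \<rho> / n) - 2 * ln (\<rho> + n) / n) \<longlonglongrightarrow>
      s * (1 / \<rho>) + b / \<rho> + c * (1 / \<rho>) - 0"
    by (intro tendsto_intros ln_ml_max_asymp[OF rho] ml_R_powr_asymp[OF rho]) real_asymp
  moreover have "s * (1 / \<rho>) + b / \<rho> + c * (1 / \<rho>) - 0 > 0" using assms rho by (simp flip: add_divide_distrib)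
  ultimately have "filterlim (\<lambda>n. (s * (ln (ml_max \<rho> n) / n) + b / \<rho> + c * (ml_R \<rho> n powr \<rho> / n) - 2 * ln (\<rho> + n) / n) * real n) at_top sequentially"
    using filterlim_real_sequentially by (rule filterlim_tendsto_pos_mult_at_top)
  moreover have "\<forall>\<^sub>F n in sequentially. (s * (ln (ml_max \<rho> n) / n) + b / \<rho> + c * (ml_R \<rho> n powr \<rho> / n) - 2 * ln (\<rho> + n) / n) * real n
      = s * ln (ml_max \<rho> n) + n * b / \<rho> + c * (ml_R \<rho> n powr \<rho>) - 2 * ln (\<rho> + n)"
    using eventually_gt_at_top[of 0] by eventually_elim (simp add: algebra_simps)
  ultimately show ?thesis by (simp cong: filterlim_cong)
qed

text \<open>Here exp (b / \<rho>) stands for a modulus |z|, so 1 + b is 1 + \<rho> log |z|, the rate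
  of the section, and c is the rate of the competing term.\<close>

lemma exp_less_ml_max:
  assumes "c < 1 + b" "\<delta> > 0"
  shows "\<forall>\<^sub>F n in sequentially. K * exp (c * ml_R \<rho> n powr \<rho>) < \<delta> / (\<rho> + n)^2 * ml_max \<rho> n * exp (b / \<rho>) ^ n"
proof -
  have "\<forall>\<^sub>F n in sequentially. 1 * ln (ml_max \<rho> n) + n * b / \<rho> + (-c) * (ml_R \<rho> n powr \<rho>) - 2 * ln (\<rho> + n) > ln ((\<bar>K\<bar> + 1) / \<delta>)"
    by (rule filterlim_at_top_dense[THEN iffD1, rule_format, OF ml_growth_at_top]) (use assms in simp)
  thus ?thesis using eventually_ge_at_top[of 1]
  proof eventually_elim
    case (elim n)
    define a where "a = ml_R \<rho> n powr \<rho>"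
    have pos: "ml_max \<rho> n > 0" "\<rho> + n > 0" using ml_max_pos[OF rho, of n] rho elim by auto
    have exp2: "exp (2 * ln (\<rho> + n)) = (\<rho> + n)^2"
      using exp_of_nat_mult[of 2 "ln (\<rho> + n)"] pos by simp
    have "(\<bar>K\<bar> + 1) / \<delta> < exp (1 * ln (ml_max \<rho> n) + n * b / \<rho> + (-c) * a - 2 * ln (\<rho> + n))"
      using elim(1) assms(2) unfolding a_def[symmetric] by (subst (asm) exp_less_cancel_iff[symmetric]) (simp add: add_nonneg_pos)
    also have "\<dots> = ml_max \<rho> n * exp (b / \<rho>) ^ n / exp (c * a) / (\<rho> + n)^2"
      using pos exp2 by (simp add: exp_add exp_diff exp_minus exp_of_nat_mult[symmetric] ln_realpow[symmetric] field_simps)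
    finally have "\<bar>K\<bar> + 1 < \<delta> / (\<rho> + n)^2 * ml_max \<rho> n * exp (b / \<rho>) ^ n / exp (c * a)"
      using assms(2) by (simp add: field_simps)
    hence "(\<bar>K\<bar> + 1) * exp (c * a) < \<delta> / (\<rho> + n)^2 * ml_max \<rho> n * exp (b / \<rho>) ^ n"
      by (subst (asm) pos_less_divide_eq) (rule exp_gt_zero)
    moreover have "K * exp (c * a) \<le> (\<bar>K\<bar> + 1) * exp (c * a)" by (intro mult_right_mono) auto
    ultimately show ?case unfolding a_def by linarith
  qed
qed

lemma ml_max_less_exp:
  assumes "1 + b < c"
  shows "\<forall>\<^sub>F n in sequentially. (real n + 1) * ml_max \<rho> n * exp (b / \<rho>) ^ n < exp (c * ml_R \<rho> n powr \<rho>)"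
proof -
  have "\<forall>\<^sub>F n in sequentially. (-1) * ln (ml_max \<rho> n) + n * (-b) / \<rho> + c * (ml_R \<rho> n powr \<rho>) - 2 * ln (\<rho> + n) > 0"
    by (rule filterlim_at_top_dense[THEN iffD1, rule_format, OF ml_growth_at_top]) (use assms in simp)
  thus ?thesis using eventually_ge_at_top[of 1]
  proof eventually_elim
    case (elim n)
    define a where "a = ml_R \<rho> n powr \<rho>"
    have pos: "ml_max \<rho> n > 0" "\<rho> + n > 0" using ml_max_pos[OF rho, of n] rho elim by auto
    have exp2: "exp (2 * ln (\<rho> + n)) = (\<rho> + n)^2"
      using exp_of_nat_mult[of 2 "ln (\<rho> + n)"] pos by simp
    have "1 < exp ((-1) * ln (ml_max \<rho> n) + n * (-b) / \<rho> + c * a - 2 * ln (\<rho> + n))"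
      using elim(1) unfolding a_def[symmetric] by simp
    also have "\<dots> = exp (c * a) / (ml_max \<rho> n * exp (b / \<rho>) ^ n * (\<rho> + n)^2)"
      using pos exp2 by (simp add: exp_add exp_diff exp_minus exp_of_nat_mult[symmetric] ln_realpow[symmetric] field_simps)
    finally have "ml_max \<rho> n * exp (b / \<rho>) ^ n * (\<rho> + n)^2 < exp (c * a)"
      using pos by (simp add: pos_less_divide_eq)
    moreover have "real n + 1 \<le> (\<rho> + n)^2" using rho power_increasing[of 1 2 "\<rho> + n"] by simp
    hence "ml_max \<rho> n * exp (b / \<rho>) ^ n * (real n + 1) \<le> ml_max \<rho> n * exp (b / \<rho>) ^ n * (\<rho> + n)^2"
      using pos by (intro mult_left_mono) auto
    ultimately show ?case by (simp add: a_def mult_ac)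
  qed
qed

lemma ml_R_powr_at_top: "filterlim (\<lambda>n. ml_R \<rho> n powr \<rho>) at_top sequentially"
proof (rule filterlim_at_top_mono)
  show "filterlim (\<lambda>n. (real n - 1) / \<rho>) at_top sequentially" using rho by real_asymp
  show "\<forall>\<^sub>F n in sequentially. (real n - 1) / \<rho> \<le> ml_R \<rho> n powr \<rho>"
    using eventually_ge_at_top[of 2] by eventually_elim (rule ml_R_powr_bounds[OF rho])
qed

text \<open>The pole term has rate Re v0 at z0. Settling for a rate c below it leaves room for the
  variation of Re z^\<rho> over the ball, through the midpoint c', and for absorbing the error K exp
  (c M).\<close>

lemma mittag_leffler_lower:
  assumes c: "c > 0" and v0: "Re v0 > c" "v0 powr of_real (1 / \<rho>) = z0"
  obtains r where "r > 0" "\<forall>\<^sub>F n in sequentially. \<forall>z\<in>ball z0 r.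
     exp (c * ml_R \<rho> n powr \<rho>) \<le> norm (mittag_leffler \<rho> (of_real (ml_R \<rho> n) * z))"
proof -
  have v0': "v0 \<noteq> 0" "z0 powr of_real \<rho> = v0" using ml_root_unique[OF rho, of v0] v0 c by auto
  define c' where "c' = (c + Re v0) / 2"
  have c': "c < c'" "c' < Re v0" using v0 by (auto simp: c'_def)
  obtain r K where r: "r > 0" "K > 0" and est:
    "\<And>z R. z \<in> ball z0 r \<Longrightarrow> R > 0 \<Longrightarrow>
       norm (mittag_leffler \<rho> (of_real R * z) - of_real \<rho> * exp (of_real (R powr \<rho>) * z powr of_real \<rho>)) \<le> K * exp (c * R powr \<rho>)"
    by (rule mittag_leffler_bound_near_pole[OF c v0]) (rule that; assumption)
  have "Re v0 > 0" using v0 c by simp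
  hence "z0 \<notin> \<real>\<^sub>\<le>\<^sub>0" using Ln_ml_root(3)[of v0] unfolding v0(2) by (auto simp: complex_nonpos_Reals_iff)
  hence "isCont (\<lambda>z. Re (z powr of_real \<rho>)) z0" by (rule isCont_Re_powr)
  hence "\<forall>\<^sub>F z in nhds z0. Re (z powr of_real \<rho>) > c'"
    by (rule eventually_nhds_greater) (use c' v0' in simp)
  then obtain r' where r': "r' > 0" "\<And>z. dist z z0 < r' \<Longrightarrow> Re (z powr of_real \<rho>) > c'"
    by (auto simp: eventually_nhds_metric)
  have "\<forall>\<^sub>F n in sequentially. ml_R \<rho> n powr \<rho> > ln (K + 1) / (c' - c)"
    by (rule filterlim_at_top_dense[THEN iffD1, rule_format, OF ml_R_powr_at_top])
  hence "\<forall>\<^sub>F n in sequentially. \<forall>z\<in>ball z0 (min r r').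
     exp (c * ml_R \<rho> n powr \<rho>) \<le> norm (mittag_leffler \<rho> (of_real (ml_R \<rho> n) * z))"
    using eventually_ge_at_top[of 1]
  proof eventually_elim
    case (elim n)
    show ?case
    proof
      fix z assume z': "z \<in> ball z0 (min r r')"
      hence z: "z \<in> ball z0 r" "dist z z0 < r'" by (auto simp: dist_commute)
      define M where "M = ml_R \<rho> n powr \<rho>"
      define E where "E = mittag_leffler \<rho> (of_real (ml_R \<rho> n) * z)"
      have R: "ml_R \<rho> n > 0" using elim ml_R_pos[OF rho] by simp
      have "ln (K + 1) < (c' - c) * M" using elim(1) c' by (simp add: M_def pos_divide_less_eq mult.commute)
      hence "K + 1 < exp ((c' - c) * M)" using r by (metis add_pos_pos exp_less_cancel_iff exp_ln zero_less_one)
      hence "(K + 1) * exp (c * M) \<le> exp ((c' - c) * M) * exp (c * M)" by (intro mult_right_mono) auto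
      also have "\<dots> = exp (c' * M)" by (simp flip: exp_add add: algebra_simps)
      also have "\<dots> \<le> exp (Re (z powr of_real \<rho>) * M)"
        using r'(2)[OF z(2)] by (simp add: M_def mult_right_mono)
      also have "\<dots> \<le> norm (of_real \<rho> * exp (of_real M * z powr of_real \<rho>))"
        using rho by (simp add: norm_mult mult.commute)
      also have "\<dots> \<le> norm E + K * exp (c * M)"
        using est[OF z(1) R] norm_triangle_ineq2[of "of_real \<rho> * exp (of_real M * z powr of_real \<rho>)" E]
        by (simp add: E_def M_def norm_minus_commute)
      finally show "exp (c * ml_R \<rho> n powr \<rho>) \<le> norm (mittag_leffler \<rho> (of_real (ml_R \<rho> n) * z))"
        by (simp add: E_def M_def algebra_simps)
    qed
  qed
  thus ?thesis using that[of "min r r'"] r r' by simp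
qed

section \<open>Size of the tails on either side of the curve\<close>

lemma ml_tail_eq: "ml_tail \<rho> (n + 1) z = mittag_leffler \<rho> z - ml_section \<rho> n z"
  using mittag_leffler_eq_section_plus_tail[of \<rho> z n] rho by simp

lemma ml_roots_1: "ml_roots \<rho> n 1 = {z. ml_tail \<rho> (n + 1) (of_real (ml_R \<rho> n) * z) = 0}"
  by (simp add: ml_roots_def)

text \<open>Supplies the line of integration: to the right of the pole if there is one, yet with a
  rate below that of the section. Outside the sector any positive c under that rate will do.\<close>

lemma below_szego:
  assumes z: "norm z \<ge> 1" "\<not> in_sector \<rho> z \<or> szego_fun \<rho> z < 0"
  obtains c where "c > 0" "c < 1 + \<rho> * ln (norm z)" "\<And>v. Re v \<ge> c \<Longrightarrow> v powr of_real (1 / \<rho>) \<noteq> z"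
proof -
  have l: "1 + \<rho> * ln (norm z) > 0" using z rho by (intro add_pos_nonneg mult_nonneg_nonneg) auto
  show ?thesis
  proof (cases "in_sector \<rho> z")
    case True
    hence "max 0 (Re (z powr of_real \<rho>)) < 1 + \<rho> * ln (norm z)" using z l by (simp add: szego_fun_def)
    then obtain c where c: "max 0 (Re (z powr of_real \<rho>)) < c" "c < 1 + \<rho> * ln (norm z)" using dense by blast
    have "v powr of_real (1 / \<rho>) \<noteq> z" if "Re v \<ge> c" for v
      using ml_root_unique[OF rho, of v] that c by auto
    thus ?thesis using that[of c] c by auto
  next
    case False
    obtain c where c: "0 < c" "c < 1 + \<rho> * ln (norm z)" using dense[OF l] by blast
    have "v powr of_real (1 / \<rho>) \<noteq> z" if "Re v \<ge> c" for v
      using False that c by (auto simp: in_sector_def)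
    thus ?thesis using that[of c] c by auto
  qed
qed

text \<open>With b between c - 1 and \<rho> log |z0|, the bound for E of rate c stays below the
  section wherever |z| >= exp (b / \<rho>), hence on a whole ball. The two-sided estimate, tight up
  to polynomial factors, makes the nth roots of the normalised tails tend to modulus 1.\<close>

lemma section_dominates:
  assumes z0: "norm z0 \<ge> 1" "z0 \<noteq> 1" "\<not> in_sector \<rho> z0 \<or> szego_fun \<rho> z0 < 0"
  obtains r \<delta> where "r > 0" "\<delta> > 0" "\<forall>\<^sub>F n in sequentially. \<forall>z\<in>ball z0 r. norm z \<ge> 1 \<longrightarrow>
    \<delta> / (\<rho> + n)^2 * ml_max \<rho> n * norm z ^ n \<le> norm (ml_tail \<rho> (n + 1) (of_real (ml_R \<rho> n) * z)) \<and>
    norm (ml_tail \<rho> (n + 1) (of_real (ml_R \<rho> n) * z)) \<le> (real n + 2) * ml_max \<rho> n * norm z ^ n"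
proof -
  obtain c where c: "c > 0" "c < 1 + \<rho> * ln (norm z0)" "\<And>v. Re v \<ge> c \<Longrightarrow> v powr of_real (1 / \<rho>) \<noteq> z0"
    by (rule below_szego[OF z0(1,3)]) (rule that; assumption)
  obtain r1 K where r1: "r1 > 0" "K > 0" and E:
    "\<And>z R. z \<in> ball z0 r1 \<Longrightarrow> R > 0 \<Longrightarrow> norm (mittag_leffler \<rho> (of_real R * z)) \<le> K * exp (c * R powr \<rho>)"
    by (rule mittag_leffler_bound_without_pole[OF c(1,3)]) (assumption | (rule that; assumption))+
  obtain r2 \<delta> where r2: "r2 > 0" "\<delta> > 0" and S: "\<forall>\<^sub>F n in sequentially. \<forall>z\<in>ball z0 r2. norm z \<ge> 1 \<longrightarrow>
       \<delta> / (\<rho> + n)^2 * ml_max \<rho> n * norm z ^ n \<le> norm (ml_section \<rho> n (of_real (ml_R \<rho> n) * z))"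
    by (rule norm_ml_section_ge[OF rho z0(1,2)])
  \<comment> \<open>Half of \<delta> is spent on absorbing E; the cap 1 lets E add at most one
    maximal term, which gives n + 2 in the upper bound.\<close>
  define \<delta>' where "\<delta>' = min (\<delta> / 2) 1"
  have d': "\<delta>' > 0" "\<delta>' \<le> \<delta> / 2" "\<delta>' \<le> 1" using r2 by (auto simp: \<delta>'_def)
  obtain b where b: "c - 1 < b" "b < \<rho> * ln (norm z0)" using dense[of "c - 1" "\<rho> * ln (norm z0)"] c by auto
  have cb: "c < 1 + b" using b by simp
  have "b / \<rho> < ln (norm z0)" using b rho by (simp add: pos_divide_less_eq mult.commute)
  hence "exp (b / \<rho>) < exp (ln (norm z0))" by simp
  hence eb: "exp (b / \<rho>) < norm z0" using z0(1) by (subst (asm) exp_ln) auto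
  define r where "r = min (min r1 r2) (norm z0 - exp (b / \<rho>))"
  have "\<forall>\<^sub>F n in sequentially. \<forall>z\<in>ball z0 r. norm z \<ge> 1 \<longrightarrow>
    \<delta>' / (\<rho> + n)^2 * ml_max \<rho> n * norm z ^ n \<le> norm (ml_tail \<rho> (n + 1) (of_real (ml_R \<rho> n) * z)) \<and>
    norm (ml_tail \<rho> (n + 1) (of_real (ml_R \<rho> n) * z)) \<le> (real n + 2) * ml_max \<rho> n * norm z ^ n"
    using S exp_less_ml_max[OF cb d'(1), of K] eventually_ge_at_top[of 1]
  proof eventually_elim
    case (elim n)
    note cmp = elim(2)
    show ?case
    proof (intro ballI impI)
      fix z assume z: "z \<in> ball z0 r" "norm z \<ge> 1"
      define A where "A = ml_max \<rho> n * norm z ^ n"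
      have A: "A > 0" unfolding A_def using ml_max_pos[OF rho, of n] elim z by (intro mult_pos_pos zero_less_power) auto
      have zz: "z \<in> ball z0 r1" "z \<in> ball z0 r2" "dist z0 z < norm z0 - exp (b / \<rho>)" using z by (auto simp: r_def)
      hence nz: "exp (b / \<rho>) \<le> norm z" using norm_triangle_ineq2[of z0 z] by (simp add: dist_norm)
      define E' S' where "E' = mittag_leffler \<rho> (of_real (ml_R \<rho> n) * z)" and "S' = ml_section \<rho> n (of_real (ml_R \<rho> n) * z)"
      have "norm E' \<le> K * exp (c * ml_R \<rho> n powr \<rho>)" unfolding E'_def
        using E[OF zz(1)] ml_R_pos[OF rho, of n] elim by simp
      also have "\<dots> \<le> \<delta>' / (\<rho> + n)^2 * ml_max \<rho> n * exp (b / \<rho>) ^ n" using cmp by simp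
      also have "\<dots> \<le> \<delta>' / (\<rho> + n)^2 * ml_max \<rho> n * norm z ^ n"
        using nz d' ml_max_pos[OF rho, of n] elim by (intro mult_left_mono power_mono mult_nonneg_nonneg) (auto intro: less_imp_le)
      finally have E': "norm E' \<le> \<delta>' / (\<rho> + n)^2 * A" by (simp add: A_def)
      have "\<delta> / (\<rho> + n)^2 * A \<le> norm S'" using elim(1) zz(2) z by (simp add: S'_def A_def mult.assoc)
      moreover have "(2 * \<delta>') / (\<rho> + n)^2 * A \<le> \<delta> / (\<rho> + n)^2 * A"
        using d' A by (intro mult_right_mono divide_right_mono) auto
      hence "2 * (\<delta>' / (\<rho> + n)^2 * A) \<le> \<delta> / (\<rho> + n)^2 * A" by (simp only: times_divide_eq_right mult.assoc times_divide_eq_left)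
      moreover have "t \<le> norm (S' - E')" if "u \<le> norm S'" "2 * t \<le> u" "norm E' \<le> t" for t u
        using that norm_triangle_ineq2[of S' E'] by linarith
      ultimately have lo: "\<delta>' / (\<rho> + n)^2 * A \<le> norm (E' - S')"
        using E' unfolding norm_minus_commute[of E' S'] by blast
      have "1 \<le> (\<rho> + n)^2" using rho by (intro one_le_power) auto
      hence "\<delta>' / (\<rho> + n)^2 \<le> 1" using d' by (simp add: divide_le_eq)
      hence "\<delta>' / (\<rho> + n)^2 * A \<le> 1 * A" using A by (intro mult_right_mono) auto
      moreover have "norm S' \<le> (real n + 1) * A"
        using norm_ml_section_le[OF rho, of n z] elim z by (simp add: S'_def A_def mult.assoc)
      ultimately have "norm (E' - S') \<le> (real n + 2) * A"
        using E' norm_triangle_ineq4[of E' S'] by (simp add: algebra_simps)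
      thus "\<delta>' / (\<rho> + n)^2 * ml_max \<rho> n * norm z ^ n \<le> norm (ml_tail \<rho> (n + 1) (of_real (ml_R \<rho> n) * z)) \<and>
        norm (ml_tail \<rho> (n + 1) (of_real (ml_R \<rho> n) * z)) \<le> (real n + 2) * ml_max \<rho> n * norm z ^ n"
        unfolding ml_tail_eq E'_def[symmetric] S'_def[symmetric] using lo by (simp add: A_def mult.assoc)
    qed
  qed
  thus ?thesis using that[of r \<delta>'] d' r1 r2 eb by (simp add: r_def)
qed

text \<open>The geometric surplus q^n is the point of the estimate: after taking nth roots it still
  separates the modulus from 1.\<close>

lemma exponential_dominates:
  assumes z0: "norm z0 \<ge> 1" "in_sector \<rho> z0" "szego_fun \<rho> z0 > 0"
  obtains r q where "r > 0" "q > 1" "\<forall>\<^sub>F n in sequentially. \<forall>z\<in>ball z0 r. norm z \<ge> 1 \<longrightarrow>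
    q ^ n * ml_max \<rho> n * norm z ^ n \<le> norm (ml_tail \<rho> (n + 1) (of_real (ml_R \<rho> n) * z))"
proof -
  obtain v0 where v0: "Re v0 > 0" "v0 powr of_real (1 / \<rho>) = z0" using z0 by (auto simp: in_sector_def)
  have v0': "z0 powr of_real \<rho> = v0" using ml_root_unique[OF rho, of v0] v0 by auto
  have "1 + \<rho> * ln (norm z0) < Re v0" using z0(3) by (simp add: szego_fun_def v0')
  then obtain c where c: "1 + \<rho> * ln (norm z0) < c" "c < Re v0" using dense by blast
  have cpos: "c > 0" using c(1) z0(1) rho mult_nonneg_nonneg[of \<rho> "ln (norm z0)"] ln_ge_zero[OF z0(1)] by linarith
  obtain r1 where r1: "r1 > 0" and E: "\<forall>\<^sub>F n in sequentially. \<forall>z\<in>ball z0 r1.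
     exp (c * ml_R \<rho> n powr \<rho>) \<le> norm (mittag_leffler \<rho> (of_real (ml_R \<rho> n) * z))"
    by (rule mittag_leffler_lower[OF cpos c(2) v0(2)])
  obtain b where b: "\<rho> * ln (norm z0) < b" "b < c - 1" using dense[of "\<rho> * ln (norm z0)" "c - 1"] c by auto
  have bc: "1 + b < c" using b by simp
  have "ln (norm z0) < b / \<rho>" using b rho by (simp add: pos_less_divide_eq mult.commute)
  hence "exp (ln (norm z0)) < exp (b / \<rho>)" by simp
  moreover have "norm z0 > 0" using z0 by linarith
  ultimately have "norm z0 < exp (b / \<rho>)" by (simp only: exp_ln)
  \<comment> \<open>m bounds |z| on the ball and stays below exp (b / \<rho>), so the quotient q of
    the two is a surplus valid on the whole ball.\<close>
  then obtain m where m: "norm z0 < m" "m < exp (b / \<rho>)" using dense by blast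
  have m0: "m > 0" using m(1) norm_ge_zero[of z0] by linarith
  define q where "q = exp (b / \<rho>) / m"
  have q: "q > 1" using m m0 by (simp add: q_def)
  define r where "r = min r1 (m - norm z0)"
  have "\<forall>\<^sub>F n in sequentially. q ^ n > 2"
  proof -
    have "filterlim (\<lambda>n. q ^ n) at_top sequentially" using q by real_asymp
    thus ?thesis by (rule filterlim_at_top_dense[THEN iffD1, rule_format])
  qed
  with E ml_max_less_exp[OF bc] eventually_ge_at_top[of 1]
  have "\<forall>\<^sub>F n in sequentially. \<forall>z\<in>ball z0 r. norm z \<ge> 1 \<longrightarrow>
    q ^ n * ml_max \<rho> n * norm z ^ n \<le> norm (ml_tail \<rho> (n + 1) (of_real (ml_R \<rho> n) * z))"
  proof eventually_elim
    case (elim n)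
    note E = elim(1) and cmp = elim(2) and qn = elim(4)
    show ?case
    proof (intro ballI impI)
      fix z assume z: "z \<in> ball z0 r" "norm z \<ge> 1"
      define A where "A = ml_max \<rho> n * norm z ^ n"
      have A: "A > 0" unfolding A_def using ml_max_pos[OF rho, of n] elim z by (intro mult_pos_pos zero_less_power) auto
      have zz: "z \<in> ball z0 r1" "dist z0 z < m - norm z0" using z by (auto simp: r_def)
      hence nz: "norm z \<le> m" using norm_triangle_ineq2[of z z0] by (simp add: dist_norm norm_minus_commute)
      define E' S' where "E' = mittag_leffler \<rho> (of_real (ml_R \<rho> n) * z)" and "S' = ml_section \<rho> n (of_real (ml_R \<rho> n) * z)"
      have "(real n + 1) * (q ^ n * A) \<le> (real n + 1) * (q ^ n * (ml_max \<rho> n * m ^ n))"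
        unfolding A_def using nz q ml_max_pos[OF rho, of n] elim
        by (intro mult_left_mono power_mono) (auto intro: less_imp_le)
      also have "q ^ n * (ml_max \<rho> n * m ^ n) = ml_max \<rho> n * exp (b / \<rho>) ^ n"
        using m0 by (simp add: q_def power_divide)
      also have "(real n + 1) * (ml_max \<rho> n * exp (b / \<rho>) ^ n) \<le> norm E'"
        using cmp E zz(1) by (force simp: E'_def mult.assoc)
      finally have "(real n + 1) * (q ^ n * A) \<le> norm E'" .
      moreover have "norm S' \<le> (real n + 1) * A"
        using norm_ml_section_le[OF rho, of n z] elim z by (simp add: S'_def A_def mult.assoc)
      moreover have "(real n + 1) * A + q ^ n * A \<le> (real n + 1) * (q ^ n * A)"
      proof -
        have "(real n + 1) + q ^ n \<le> (real n + 1) * q ^ n"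
        proof -
          have "real n * 2 \<le> real n * q ^ n" using qn by (intro mult_left_mono) auto
          moreover have "real n \<ge> 1" using elim by simp
          ultimately show ?thesis by (simp only: distrib_right mult_1_left)
        qed
        from mult_right_mono[OF this, of A] show ?thesis using A by (simp add: algebra_simps)
      qed
      ultimately have "q ^ n * A \<le> norm (E' - S')" using norm_triangle_ineq2[of E' S'] by linarith
      thus "q ^ n * ml_max \<rho> n * norm z ^ n \<le> norm (ml_tail \<rho> (n + 1) (of_real (ml_R \<rho> n) * z))"
        unfolding ml_tail_eq E'_def[symmetric] S'_def[symmetric] by (simp add: A_def mult.assoc)
    qed
  qed
  thus ?thesis using that[of r q] q r1 m by (simp add: r_def)
qed

section \<open>Accumulation points lie on the curve\<close>

lemma mittag_leffler_holomorphic: "mittag_leffler \<rho> holomorphic_on A"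
proof -
  have "mittag_leffler \<rho> holomorphic_on ball 0 (norm z + 1)" for z
  proof (rule power_series_holomorphic[where a = "ml_coeff \<rho>"])
    fix w
    show "(\<lambda>n. ml_coeff \<rho> n * (w - 0) ^ n) sums mittag_leffler \<rho> w"
      unfolding mittag_leffler_def using rho summable_mittag_leffler[of \<rho> w] by (simp add: summable_sums)
  qed
  hence "mittag_leffler \<rho> field_differentiable at z" for z
    by (intro holomorphic_on_imp_differentiable_at[of _ "ball 0 (norm z + 1)"]) auto
  thus ?thesis by (simp add: holomorphic_on_def field_differentiable_at_within)
qed

lemma ml_tail_holomorphic [holomorphic_intros]: 
  "(\<lambda>z. ml_tail \<rho> (n + 1) (of_real (ml_R \<rho> n) * z)) holomorphic_on A"
  unfolding ml_tail_eq ml_section_def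
  by (intro holomorphic_intros holomorphic_on_compose_gen[OF _ mittag_leffler_holomorphic, unfolded o_def, of _ _ UNIV]) auto

text \<open>A limit point would force the entire function to vanish identically, but it is nonzero
  at z = 1. Accumulation must therefore involve infinitely many n.\<close>

lemma ml_roots_not_islimpt:
  assumes "n \<ge> 1"
  shows "\<not> z islimpt ml_roots \<rho> n 1"
proof
  assume "z islimpt ml_roots \<rho> n 1"
  hence "ml_tail \<rho> (n + 1) (of_real (ml_R \<rho> n) * 1) = 0"
    by (intro analytic_continuation[OF ml_tail_holomorphic, of UNIV "ml_roots \<rho> n 1" z n 1]) (auto simp: ml_roots_1)
  thus False using ml_tail_neq_0[OF rho assms, of 1] by simp
qed

text \<open>If either term dominates at z0, no root of large index lies near z0, and the finitely
  many remaining root sets do not accumulate. The dominance estimates concern |z| >= 1 only; the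
  rest of the ball is free of nonzero roots by \<open>ml_tail_neq_0\<close>.\<close>

lemma ml_acc_imp_szego:
  assumes acc: "z0 \<in> ml_acc \<rho> 1" and z0: "z0 \<noteq> 0"
  shows "norm z0 \<ge> 1" and "z0 \<noteq> 1 \<Longrightarrow> in_sector \<rho> z0 \<and> szego_fun \<rho> z0 = 0"
proof -
  define U where "U = (\<Union>n\<in>{1..}. ml_roots \<rho> n 1)"
  have lim: "z0 islimpt U" using acc by (simp add: ml_acc_def U_def)
  have small: "norm z > 1 \<or> z = 0" if "z \<in> ml_roots \<rho> n 1" "n \<ge> 1" for z n
    using ml_tail_neq_0[OF rho that(2), of z] that(1) by (force simp: ml_roots_1)
  show n1: "norm z0 \<ge> 1"
  proof (rule ccontr)
    assume "\<not> norm z0 \<ge> 1"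
    hence "min (norm z0) (1 - norm z0) > 0" using z0 by auto
    then obtain z where z: "z \<in> U" "dist z z0 < min (norm z0) (1 - norm z0)"
      using lim unfolding islimpt_approachable by blast
    then obtain n where "z \<in> ml_roots \<rho> n 1" "n \<ge> 1" by (auto simp: U_def)
    hence "norm z > 1 \<or> z = 0" by (rule small)
    thus False using z(2) norm_triangle_ineq2[of z z0] by (auto simp: dist_norm)
  qed
  show "in_sector \<rho> z0 \<and> szego_fun \<rho> z0 = 0" if ne1: "z0 \<noteq> 1"
  proof (rule ccontr)
    assume "\<not> ?thesis"
    hence cases: "(\<not> in_sector \<rho> z0 \<or> szego_fun \<rho> z0 < 0) \<or> (in_sector \<rho> z0 \<and> szego_fun \<rho> z0 > 0)" by auto
    obtain r where r: "r > 0" and ev: "\<forall>\<^sub>F n in sequentially. \<forall>z\<in>ball z0 r. norm z \<ge> 1 \<longrightarrow> z \<notin> ml_roots \<rho> n 1"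
      using cases
    proof
      assume "\<not> in_sector \<rho> z0 \<or> szego_fun \<rho> z0 < 0"
      then obtain r \<delta> where r: "r > 0" "\<delta> > 0" and ev: "\<forall>\<^sub>F n in sequentially. \<forall>z\<in>ball z0 r. norm z \<ge> 1 \<longrightarrow>
        \<delta> / (\<rho> + n)^2 * ml_max \<rho> n * norm z ^ n \<le> norm (ml_tail \<rho> (n + 1) (of_real (ml_R \<rho> n) * z)) \<and>
        norm (ml_tail \<rho> (n + 1) (of_real (ml_R \<rho> n) * z)) \<le> (real n + 2) * ml_max \<rho> n * norm z ^ n"
        by (rule section_dominates[OF n1 ne1])
      have "\<forall>\<^sub>F n in sequentially. \<forall>z\<in>ball z0 r. norm z \<ge> 1 \<longrightarrow> z \<notin> ml_roots \<rho> n 1"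
        using ev eventually_ge_at_top[of 1]
      proof eventually_elim
        case (elim n)
        show ?case
        proof (intro ballI impI)
          fix z assume z: "z \<in> ball z0 r" "norm z \<ge> 1"
          have "\<delta> / (\<rho> + n)^2 * ml_max \<rho> n * norm z ^ n > 0"
            using r rho ml_max_pos[OF rho, of n] elim z by (intro mult_pos_pos divide_pos_pos zero_less_power) auto
          thus "z \<notin> ml_roots \<rho> n 1" using elim z by (force simp: ml_roots_1)
        qed
      qed
      thus ?thesis using that r by blast
    next
      assume above: "in_sector \<rho> z0 \<and> szego_fun \<rho> z0 > 0"
      obtain r q where r: "r > 0" "q > 1" and ev: "\<forall>\<^sub>F n in sequentially. \<forall>z\<in>ball z0 r. norm z \<ge> 1 \<longrightarrow>
        q ^ n * ml_max \<rho> n * norm z ^ n \<le> norm (ml_tail \<rho> (n + 1) (of_real (ml_R \<rho> n) * z))"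
        by (rule exponential_dominates[OF n1 conjunct1[OF above] conjunct2[OF above]])
      have "\<forall>\<^sub>F n in sequentially. \<forall>z\<in>ball z0 r. norm z \<ge> 1 \<longrightarrow> z \<notin> ml_roots \<rho> n 1"
        using ev eventually_ge_at_top[of 1]
      proof eventually_elim
        case (elim n)
        show ?case
        proof (intro ballI impI)
          fix z assume z: "z \<in> ball z0 r" "norm z \<ge> 1"
          have "q ^ n * ml_max \<rho> n * norm z ^ n > 0"
            using r ml_max_pos[OF rho, of n] elim z by (intro mult_pos_pos zero_less_power) auto
          thus "z \<notin> ml_roots \<rho> n 1" using elim z by (force simp: ml_roots_1)
        qed
      qed
      thus ?thesis using that r by blast
    qed
    obtain N where N: "\<And>n z. n \<ge> N \<Longrightarrow> z \<in> ball z0 r \<Longrightarrow> norm z \<ge> 1 \<Longrightarrow> z \<notin> ml_roots \<rho> n 1"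
      using ev unfolding eventually_sequentially by blast
    \<comment> \<open>Every tail vanishes at 0; capping the radius at |z0| keeps this root out of
      the ball.\<close>
    have "z0 islimpt (U \<inter> ball z0 (min r (norm z0)))"
      using lim r z0 by (intro islimpt_Int_eventually eventually_at_in_open') auto
    moreover have "U \<inter> ball z0 (min r (norm z0)) \<subseteq> (\<Union>n\<in>{1..<N}. ml_roots \<rho> n 1)"
    proof
      fix z assume z: "z \<in> U \<inter> ball z0 (min r (norm z0))"
      then obtain n where n: "z \<in> ml_roots \<rho> n 1" "n \<ge> 1" by (auto simp: U_def)
      have "z \<noteq> 0" using z by auto
      hence "norm z > 1" using small[OF n] by auto
      hence "n < N" using N[of n z] z n by (cases "n < N") auto
      thus "z \<in> (\<Union>n\<in>{1..<N}. ml_roots \<rho> n 1)" using n by auto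
    qed
    ultimately have lim': "z0 islimpt (\<Union>n\<in>{1..<N}. ml_roots \<rho> n 1)" by (rule islimpt_subset)
    have "\<not> z0 islimpt (\<Union>n\<in>F. ml_roots \<rho> n 1)" if "finite F" "F \<subseteq> {1..}" for F
      using that by (induction F) (auto simp: islimpt_Un ml_roots_not_islimpt)
    moreover have "{1..<N} \<subseteq> {1..}" by (intro subsetI) simp
    ultimately show False using lim' by blast
  qed
qed

end

subsection \<open>Accumulation at the curve\<close>

text \<open>This is \<open>szego_fun\<close> in the coordinates t = log |z| and \<phi> = arg z,
  valid inside the sector.\<close>

definition szego_log :: "real \<Rightarrow> real \<Rightarrow> real \<Rightarrow> real" where
  "szego_log \<rho> t \<phi> = exp (\<rho> * t) * cos (\<rho> * \<phi>) - 1 - \<rho> * t"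

context
  fixes \<rho> :: real
  assumes rho: "\<rho> > 1"
begin

text \<open>Taking nth roots turns q^n into a fixed q > 1 and sends polynomial factors to 1; the
  roots exist because a zero-free holomorphic function on a ball has a logarithm. A single point w
  above the curve shows that the limit is not constant, while V has to be open: the contradiction is
  an open map sending V into the unit circle.\<close>

lemma ml_root_near_sign_change:
  assumes S: "\<And>z. z \<in> ball z1 e \<Longrightarrow> norm z > 1" and C: "C \<ge> 0"
    and E: "\<And>z R. z \<in> ball z1 e \<Longrightarrow> R > 0 \<Longrightarrow> norm (mittag_leffler \<rho> (of_real R * z)) \<le> K * exp (C * R powr \<rho>)"
    and w: "w \<in> ball z1 e" "in_sector \<rho> w" "szego_fun \<rho> w > 0"
    and V: "open V" "V \<subseteq> ball z1 e" "V \<noteq> {}" "\<And>z. z \<in> V \<Longrightarrow> szego_fun \<rho> z < 0"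
  shows "\<exists>n\<ge>1. \<exists>z\<in>ball z1 e. z \<in> ml_roots \<rho> n 1"
proof (rule ccontr)
  assume contra: "\<not> ?thesis"
  define B1 where "B1 = ball z1 e"
  define h where "h = (\<lambda>n z. ml_tail \<rho> (n + 1) (of_real (ml_R \<rho> n) * z) / (of_real (ml_max \<rho> n) * z ^ n))"
  have "0 \<le> K * exp (C * 1 powr \<rho>)" by (rule order_trans[OF norm_ge_zero E[OF w(1) zero_less_one]])
  hence K: "K \<ge> 0" by (simp add: zero_le_mult_iff)
  have z_nz: "z \<noteq> 0" if "z \<in> B1" for z using S[of z] that by (auto simp: B1_def)
  have ex: "\<exists>g. g holomorphic_on B1 \<and> (\<forall>z\<in>B1. g z ^ n = h n z)" if n: "n \<ge> 1" for n
  proof -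
    have "h n holomorphic_on B1" unfolding h_def
      using z_nz n ml_max_neq_0[OF rho, of n] by (intro holomorphic_intros ml_tail_holomorphic[OF rho]) auto
    moreover have "h n z \<noteq> 0" if "z \<in> B1" for z
      using contra n that z_nz ml_max_neq_0[OF rho, of n] by (auto simp: h_def ml_roots_1[OF rho] B1_def)
    moreover have "contractible B1" unfolding B1_def by (intro convex_imp_contractible convex_ball)
    ultimately obtain l where l: "l holomorphic_on B1" "\<And>z. z \<in> B1 \<Longrightarrow> h n z = exp (l z)"
      using contractible_imp_holomorphic_log by metis
    show ?thesis
    proof (intro exI[of _ "\<lambda>z. exp (l z / of_nat n)"] conjI ballI)
      show "(\<lambda>z. exp (l z / of_nat n)) holomorphic_on B1" using n by (intro holomorphic_intros l) auto
      fix z assume "z \<in> B1"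
      thus "exp (l z / of_nat n) ^ n = h n z" using n l(2)[of z] by (simp flip: exp_of_nat_mult)
    qed
  qed
  then obtain g where g: "\<And>n. n \<ge> 1 \<Longrightarrow> g n holomorphic_on B1" "\<And>n z. n \<ge> 1 \<Longrightarrow> z \<in> B1 \<Longrightarrow> g n z ^ n = h n z"
    by metis
  have norm_g: "norm (g n z) ^ n = norm (h n z)" if "n \<ge> 1" "z \<in> B1" for n z
    using g(2)[OF that] by (metis norm_power)
  have norm_h: "norm (h n z) = norm (ml_tail \<rho> (n + 1) (of_real (ml_R \<rho> n) * z)) / (ml_max \<rho> n * norm z ^ n)" if "n \<ge> 1" for n z
    using ml_max_pos[OF rho that] by (simp add: h_def norm_divide norm_mult norm_power)
  \<comment> \<open>The normalised tail will be bounded by (K exp C + 1) exp ((C + 1) n); since K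
    exp C + 1 >= 1, it is at most its own nth power, so D bounds the nth root.\<close>
  define D where "D = (K * exp C + 1) * exp (C + 1)"
  have "(\<lambda>n. ln (ml_max \<rho> n) / n) \<longlonglongrightarrow> 1 / \<rho>" by (rule ln_ml_max_asymp[OF rho])
  hence "\<forall>\<^sub>F n in sequentially. ln (ml_max \<rho> n) / n > 0" by (rule order_tendstoD) (use rho in simp)
  hence "\<forall>\<^sub>F n in sequentially. n \<ge> 2 \<and> (\<forall>z\<in>B1. norm (g n z) \<le> D)"
    using eventually_ge_at_top[of 2]
  proof eventually_elim
    case (elim n)
    have n: "n \<ge> 1" using elim by simp
    have "ln (ml_max \<rho> n) > 0" using elim by (simp add: zero_less_divide_iff)
    hence A: "ml_max \<rho> n \<ge> 1" using ml_max_pos[OF rho n] by simp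
    have "norm (g n z) \<le> D" if z: "z \<in> B1" for z
    proof -
      have nz: "norm z > 1" using S z by (simp add: B1_def)
      define A' where "A' = ml_max \<rho> n * norm z ^ n"
      have "1 * 1 \<le> A'" unfolding A'_def using A nz by (intro mult_mono one_le_power) auto
      hence A': "A' \<ge> 1" by simp
      have "norm (ml_tail \<rho> (n + 1) (of_real (ml_R \<rho> n) * z)) \<le> K * exp (C * ml_R \<rho> n powr \<rho>) + (real n + 1) * A'"
        unfolding ml_tail_eq[OF rho] A'_def
        using norm_triangle_ineq4[of "mittag_leffler \<rho> (of_real (ml_R \<rho> n) * z)" "ml_section \<rho> n (of_real (ml_R \<rho> n) * z)"]
          E[of z "ml_R \<rho> n"] z ml_R_pos[OF rho n] norm_ml_section_le[OF rho n, of z] nz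
        by (simp add: B1_def mult.assoc)
      also have "K * exp (C * ml_R \<rho> n powr \<rho>) \<le> K * exp (C * (1 + real n)) * A'"
      proof -
        have "real n / \<rho> \<le> real n / 1" using rho by (intro divide_left_mono) auto
        hence "ml_R \<rho> n powr \<rho> \<le> 1 + real n" using ml_R_powr_bounds(2)[OF rho elim(2)] by simp
        hence "K * exp (C * ml_R \<rho> n powr \<rho>) \<le> K * exp (C * (1 + real n))"
          using C K by (intro mult_left_mono) (auto intro: mult_left_mono)
        also have "\<dots> \<le> K * exp (C * (1 + real n)) * A'"
          using mult_left_mono[OF A', of "K * exp (C * (1 + real n))"] K by simp
        finally show ?thesis .
      qed
      also have "K * exp (C * (1 + real n)) * A' + (real n + 1) * A' = (K * exp (C * (1 + real n)) + (1 + real n)) * A'"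
        by (simp add: algebra_simps)
      finally have "norm (h n z) \<le> K * exp (C * (1 + real n)) + (1 + real n)"
        unfolding norm_h[OF n] A'_def[symmetric] using A' by (subst pos_divide_le_eq) auto
      also have "\<dots> \<le> K * exp C * exp ((C + 1) * n) + 1 * exp ((C + 1) * n)"
      proof (intro add_mono)
        have "exp (C * (1 + real n)) = exp C * exp (C * n)" by (simp flip: exp_add add: algebra_simps)
        also have "\<dots> \<le> exp C * exp ((C + 1) * n)" by (simp add: algebra_simps)
        finally show "K * exp (C * (1 + real n)) \<le> K * exp C * exp ((C + 1) * n)"
          using K by (simp add: mult.assoc mult_left_mono)
        have "1 + real n \<le> exp (real n)" by (rule exp_ge_add_one_self)
        also have "\<dots> \<le> exp ((C + 1) * n)" using C by (simp add: algebra_simps)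
        finally show "1 + real n \<le> 1 * exp ((C + 1) * n)" by simp
      qed
      also have "\<dots> = (K * exp C + 1) * exp (C + 1) ^ n" by (simp add: algebra_simps flip: exp_of_nat_mult)
      also have "\<dots> \<le> (K * exp C + 1) ^ n * exp (C + 1) ^ n"
        using K n by (intro mult_right_mono self_le_power) auto
      also have "\<dots> = D ^ n" by (simp add: D_def power_mult_distrib)
      finally have "norm (g n z) ^ n \<le> D ^ n" using norm_g[OF n z] by simp
      moreover have "D \<ge> 0" using K by (simp add: D_def)
      ultimately show ?thesis using n by (simp add: power_mono_iff)
    qed
    thus ?case using elim by simp
  qed
  then obtain N where N: "\<And>n. n \<ge> N \<Longrightarrow> n \<ge> 2 \<and> (\<forall>z\<in>B1. norm (g n z) \<le> D)"
    unfolding eventually_sequentially by blast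
  \<comment> \<open>Montel's theorem asks for a bound on every member of the sequence, so the first
    N are dropped.\<close>
  define F where "F = (\<lambda>n. g (n + N))"
  have N2: "n + N \<ge> 1" for n using N[of "n + N"] by simp
  have Fholo: "F n holomorphic_on B1" for n unfolding F_def by (rule g(1)[OF N2])
  obtain G r where G: "G holomorphic_on B1" "strict_mono (r :: nat \<Rightarrow> nat)"
      "\<And>x. x \<in> B1 \<Longrightarrow> (\<lambda>n. F (r n) x) \<longlonglongrightarrow> G x"
  proof (rule Montel[of B1 "range F" F])
    show "open B1" by (simp add: B1_def)
    show "\<exists>B. \<forall>h\<in>range F. \<forall>z\<in>K'. norm (h z) \<le> B" if "compact K'" "K' \<subseteq> B1" for K'
      using that N by (intro exI[of _ D]) (force simp: F_def)
  qed (use Fholo that in auto)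
  have sub: "filterlim (\<lambda>n. r n + N) at_top sequentially"
    by (rule filterlim_at_top_mono[OF filterlim_subseq[OF G(2)]]) simp
  have Glim: "(\<lambda>n. norm (g (r n + N) z)) \<longlonglongrightarrow> norm (G z)" if "z \<in> B1" for z
    using tendsto_norm[OF G(3)[OF that]] by (simp add: F_def)
  have G1: "norm (G z) = 1" if z: "z \<in> V" for z
  proof -
    have zB: "z \<in> B1" using z V by (auto simp: B1_def)
    have nz: "norm z > 1" using S zB by (simp add: B1_def)
    obtain r' \<delta> where r': "r' > 0" "\<delta> > 0" and dom: "\<forall>\<^sub>F n in sequentially. \<forall>x\<in>ball z r'. norm x \<ge> 1 \<longrightarrow>
      \<delta> / (\<rho> + n)^2 * ml_max \<rho> n * norm x ^ n \<le> norm (ml_tail \<rho> (n + 1) (of_real (ml_R \<rho> n) * x)) \<and>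
      norm (ml_tail \<rho> (n + 1) (of_real (ml_R \<rho> n) * x)) \<le> (real n + 2) * ml_max \<rho> n * norm x ^ n"
      by (rule section_dominates[OF rho, of z]) (use nz V(4)[OF z] in auto)
    have ev: "\<forall>\<^sub>F n in sequentially. (\<delta> / (\<rho> + n)^2) powr (1 / n) \<le> norm (g n z) \<and> norm (g n z) \<le> (real n + 2) powr (1 / n)"
      using dom eventually_ge_at_top[of 1]
    proof eventually_elim
      case (elim n)
      have A: "ml_max \<rho> n * norm z ^ n > 0" using ml_max_pos[OF rho elim(2)] nz by (intro mult_pos_pos zero_less_power) auto
      have "\<delta> / (\<rho> + n)^2 * (ml_max \<rho> n * norm z ^ n) \<le> norm (ml_tail \<rho> (n + 1) (of_real (ml_R \<rho> n) * z))"
           "norm (ml_tail \<rho> (n + 1) (of_real (ml_R \<rho> n) * z)) \<le> (real n + 2) * (ml_max \<rho> n * norm z ^ n)"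
        using elim(1) r' nz by (simp_all add: mult.assoc)
      hence bd: "\<delta> / (\<rho> + n)^2 \<le> norm (g n z) ^ n" "norm (g n z) ^ n \<le> real n + 2"
        unfolding norm_g[OF elim(2) zB] norm_h[OF elim(2)] pos_le_divide_eq[OF A] pos_divide_le_eq[OF A] by blast+
      have root: "(norm (g n z) ^ n) powr (1 / n) = norm (g n z)"
      proof (cases "g n z = 0")
        case False
        thus ?thesis using elim(2) by (simp add: powr_realpow[symmetric] powr_powr)
      qed (use elim(2) in auto)
      show ?case
        using powr_mono2[OF _ _ bd(1), of "1 / n"] powr_mono2[OF _ _ bd(2), of "1 / n"] r' rho unfolding root by auto
    qed
    have "(\<lambda>n. norm (g n z)) \<longlonglongrightarrow> 1"
    proof (rule tendsto_sandwich)
      show "\<forall>\<^sub>F n in sequentially. (\<delta> / (\<rho> + n)^2) powr (1 / n) \<le> norm (g n z)" using ev by eventually_elim simp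
      show "\<forall>\<^sub>F n in sequentially. norm (g n z) \<le> (real n + 2) powr (1 / n)" using ev by eventually_elim simp
      show "(\<lambda>n. (\<delta> / (\<rho> + real n)^2) powr (1 / n)) \<longlonglongrightarrow> 1" using r' rho by real_asymp
      show "(\<lambda>n::nat. (real n + 2) powr (1 / n)) \<longlonglongrightarrow> 1" by real_asymp
    qed
    hence "(\<lambda>n. norm (g (r n + N) z)) \<longlonglongrightarrow> 1" using sub by (rule filterlim_compose)
    thus ?thesis using Glim[OF zB] LIMSEQ_unique by blast
  qed
  have Gw: "norm (G w) > 1"
  proof -
    have wB: "w \<in> B1" using w by (simp add: B1_def)
    have nz: "norm w > 1" using S w by simp
    obtain r' q where r': "r' > 0" "q > 1" and dom: "\<forall>\<^sub>F n in sequentially. \<forall>z\<in>ball w r'. norm z \<ge> 1 \<longrightarrow>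
      q ^ n * ml_max \<rho> n * norm z ^ n \<le> norm (ml_tail \<rho> (n + 1) (of_real (ml_R \<rho> n) * z))"
      by (rule exponential_dominates[OF rho _ w(2,3)]) (use nz in auto)
    have "\<forall>\<^sub>F n in sequentially. q \<le> norm (g n w)"
      using dom eventually_ge_at_top[of 1]
    proof eventually_elim
      case (elim n)
      have A: "ml_max \<rho> n * norm w ^ n > 0" using ml_max_pos[OF rho elim(2)] nz by (intro mult_pos_pos zero_less_power) auto
      have "q ^ n * (ml_max \<rho> n * norm w ^ n) \<le> norm (ml_tail \<rho> (n + 1) (of_real (ml_R \<rho> n) * w))"
        using elim(1) r' nz by (simp add: mult.assoc)
      hence "q ^ n \<le> norm (g n w) ^ n"
        unfolding norm_g[OF elim(2) wB] norm_h[OF elim(2)] using A by (subst pos_le_divide_eq)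
      thus ?case using r' elim(2) by (simp add: power_mono_iff)
    qed
    hence "\<forall>\<^sub>F n in sequentially. q \<le> norm (g (r n + N) w)"
      using sub by (rule eventually_compose_filterlim)
    hence "q \<le> norm (G w)" using Glim[OF wB] by (intro tendsto_lowerbound[of _ "norm (G w)" sequentially]) auto
    thus ?thesis using r' by simp
  qed
  have wB: "w \<in> B1" and VB: "V \<subseteq> B1" using w V by (auto simp: B1_def)
  have "\<not> G constant_on B1"
  proof
    assume "G constant_on B1"
    then obtain y where "\<And>x. x \<in> B1 \<Longrightarrow> G x = y" by (auto simp: constant_on_def)
    moreover obtain v where "v \<in> V" using V by auto
    ultimately show False using G1[of v] Gw wB VB by auto
  qed
  hence "open (G ` V)" using G(1) V(1) VB by (intro open_mapping_thm[of G B1 V]) (auto simp: B1_def)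
  moreover obtain v where v: "v \<in> V" using V by auto
  ultimately obtain d where d: "d > 0" "ball (G v) d \<subseteq> G ` V" unfolding open_contains_ball by blast
  have "norm (G v) = 1" using G1[OF v] .
  \<comment> \<open>Moving G v radially outwards stays in the open image of V but leaves the unit
    circle.\<close>
  hence "G v * of_real (1 + d / 2) \<in> ball (G v) d" using d(1)
    by (simp add: dist_norm algebra_simps norm_mult)
  then obtain v' where v': "v' \<in> V" "G v * of_real (1 + d / 2) = G v'" using d(2) by blast
  have "norm (G v * of_real (1 + d / 2)) = 1 + d / 2" using d(1) \<open>norm (G v) = 1\<close> by (simp only: norm_mult norm_of_real) simp
  thus False using G1[OF v'(1)] v'(2) d(1) by simp
qed

section \<open>Points of the curve in logarithmic coordinates\<close>

lemma sector_exp: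
  assumes "\<bar>Im s\<bar> < pi / (2 * \<rho>)"
  shows "in_sector \<rho> (exp s)" "szego_fun \<rho> (exp s) = szego_log \<rho> (Re s) (Im s)" "Ln (exp s) = s"
proof -
  have l: "\<bar>\<rho> * Im s\<bar> < pi / 2" using assms rho by (simp add: abs_mult field_simps)
  have "pi / 2 / \<rho> \<le> pi / 2 / 1" using rho by (intro divide_left_mono) auto
  hence "pi / (2 * \<rho>) \<le> pi / 2" by (simp only: divide_divide_eq_left div_by_1)
  hence im: "\<bar>Im s\<bar> < pi" using assms pi_gt_zero by linarith
  show Ln: "Ln (exp s) = s" using im by (intro Ln_exp) auto
  have p: "exp s powr of_real \<rho> = exp (of_real \<rho> * s)" by (simp add: powr_def Ln)
  have Ln2: "Ln (exp (of_real \<rho> * s)) = of_real \<rho> * s" using l pi_gt_zero by (intro Ln_exp) auto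
  have Re: "Re (exp (of_real \<rho> * s)) = exp (\<rho> * Re s) * cos (\<rho> * Im s)" by (simp add: Re_exp)
  have "cos (\<rho> * Im s) > 0" using l by (intro cos_gt_zero_pi) auto
  hence "Re (exp (of_real \<rho> * s)) > 0" unfolding Re by simp
  moreover have "exp (of_real \<rho> * s) powr of_real (1 / \<rho>) = exp s" using rho by (simp add: powr_def Ln2)
  ultimately show "in_sector \<rho> (exp s)" unfolding in_sector_def by blast
  show "szego_fun \<rho> (exp s) = szego_log \<rho> (Re s) (Im s)"
    unfolding szego_fun_def szego_log_def p Re by (simp add: norm_exp_eq_Re)
qed

lemma isCont_szego_fun:
  assumes "z \<notin> \<real>\<^sub>\<le>\<^sub>0"
  shows "isCont (szego_fun \<rho>) z"
proof -
  have "z \<noteq> 0" using assms by auto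
  thus ?thesis unfolding szego_fun_def using assms by (intro continuous_intros isCont_Re_powr) auto
qed

text \<open>Rotation at fixed modulus crosses the curve: t is constant while cos (\<rho> \<phi>)
  decreases strictly with |\<phi>|, so a smaller angle gives a positive and a larger one a negative
  value of \<open>szego_log\<close>. For this \<phi> must be nonzero, which t > 0 ensures.\<close>

lemma ml_root_near_szego_log:
  assumes t: "t > 0" and phi: "\<bar>\<phi>\<bar> < pi / (2 * \<rho>)" and eq: "szego_log \<rho> t \<phi> = 0" and e: "e > 0"
  shows "\<exists>n\<ge>1. \<exists>z\<in>ball (exp (Complex t \<phi>)) e. z \<in> ml_roots \<rho> n 1"
proof -
  define z1 where "z1 = exp (Complex t \<phi>)"
  have nz1: "norm z1 = exp t" by (simp add: z1_def norm_exp_eq_Re)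
  \<comment> \<open>Any v with v^(1/\<rho>) = z1 has modulus exp t powr \<rho>, hence no pole lies
    in Re v >= C.\<close>
  define C where "C = exp t powr \<rho> + 1"
  have C: "C > 0" by (simp add: C_def add_nonneg_pos)
  have np: "v powr of_real (1 / \<rho>) \<noteq> z1" if "Re v \<ge> C" for v
  proof
    assume v: "v powr of_real (1 / \<rho>) = z1"
    have "exp t = norm v powr (1 / \<rho>)" by (simp only: nz1[symmetric] v[symmetric] norm_powr_of_real)
    hence "exp t powr \<rho> = norm v" using rho by (simp add: powr_powr)
    thus False using that complex_Re_le_cmod[of v] by (simp add: C_def)
  qed
  obtain r K where r: "r > 0" "K > 0" and E:
    "\<And>z R. z \<in> ball z1 r \<Longrightarrow> R > 0 \<Longrightarrow> norm (mittag_leffler \<rho> (of_real R * z)) \<le> K * exp (C * R powr \<rho>)"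
    by (rule mittag_leffler_bound_without_pole[OF rho C np]) (assumption | (rule that; assumption))+
  define e' where "e' = min (min e r) (exp t - 1)"
  have e': "e' > 0" using e r t by (simp add: e'_def)
  \<comment> \<open>On the positive axis the equation reads exp (\<rho> t) = 1 + \<rho> t, which
    holds only for t = 0.\<close>
  have phi0: "\<phi> \<noteq> 0"
  proof
    assume "\<phi> = 0"
    hence "exp (\<rho> * t) = 1 + \<rho> * t" using eq by (simp add: szego_log_def)
    moreover have "1 + \<rho> * t < exp (\<rho> * t)" using t rho exp_minus_greater[of "- (\<rho> * t)"] by simp
    ultimately show False by simp
  qed
  \<comment> \<open>The angle is scaled, not shifted, so that l < 1 brings it closer to 0 whichever
    sign \<phi> has.\<close>
  define P where "P = (\<lambda>l. exp (Complex t (\<phi> * l)))"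
  have "\<forall>\<^sub>F l in nhds 1. dist (P l) z1 < e' \<and> \<bar>\<phi> * l\<bar> < pi / (2 * \<rho>)"
  proof (intro eventually_conj)
    have "isCont (\<lambda>l. dist (P l) z1) 1" unfolding P_def Complex_eq by (intro continuous_intros)
    thus "\<forall>\<^sub>F l in nhds 1. dist (P l) z1 < e'" by (rule eventually_nhds_less) (use e' in \<open>simp add: P_def z1_def\<close>)
    have "isCont (\<lambda>l. \<bar>\<phi> * l\<bar>) 1" by (intro continuous_intros)
    thus "\<forall>\<^sub>F l in nhds 1. \<bar>\<phi> * l\<bar> < pi / (2 * \<rho>)" by (rule eventually_nhds_less) (use phi in simp)
  qed
  then obtain d where d: "d > 0" "\<And>l. dist l 1 < d \<Longrightarrow> dist (P l) z1 < e' \<and> \<bar>\<phi> * l\<bar> < pi / (2 * \<rho>)"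
    by (auto simp: eventually_nhds_metric)
  define d' where "d' = min d 1 / 2"
  have d': "0 < d'" "d' < 1" "d' < d" using d by (auto simp: d'_def min_def)
  have strip: "\<bar>\<rho> * (\<phi> * l)\<bar> < pi / 2" if "\<bar>\<phi> * l\<bar> < pi / (2 * \<rho>)" for l
    using that rho by (simp add: abs_mult field_simps)
  have cos_less: "cos (\<rho> * (\<phi> * l')) < cos (\<rho> * (\<phi> * l))" if "0 \<le> l" "l < l'" "\<bar>\<phi> * l'\<bar> < pi / (2 * \<rho>)" for l l'
  proof -
    have "\<rho> * (\<bar>\<phi>\<bar> * l') = \<bar>\<rho> * (\<phi> * l')\<bar>" using that rho by (simp add: abs_mult)
    hence "\<rho> * (\<bar>\<phi>\<bar> * l') \<le> pi" using strip[OF that(3)] pi_gt_zero by linarith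
    hence "cos (\<rho> * (\<bar>\<phi>\<bar> * l')) < cos (\<rho> * (\<bar>\<phi>\<bar> * l))"
      using that rho phi0 by (intro cos_monotone_0_pi) auto
    thus ?thesis by (cases "\<phi> \<ge> 0") auto
  qed
  have near: "dist (P l) z1 < e'" "\<bar>\<phi> * l\<bar> < pi / (2 * \<rho>)" if "\<bar>l - 1\<bar> < d" for l
    using d(2)[of l] that by (auto simp: dist_real_def)
  have sec: "in_sector \<rho> (P l)" "szego_fun \<rho> (P l) = szego_log \<rho> t (\<phi> * l)" "Ln (P l) = Complex t (\<phi> * l)" if "\<bar>l - 1\<bar> < d" for l
    using sector_exp[of "Complex t (\<phi> * l)"] near(2)[OF that] by (auto simp: P_def)
  define w w' where "w = P (1 - d')" and "w' = P (1 + d')"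
  have w: "dist w z1 < e'" "in_sector \<rho> w" "szego_fun \<rho> w > 0"
  proof -
    have "cos (\<rho> * (\<phi> * 1)) < cos (\<rho> * (\<phi> * (1 - d')))" using d' phi by (intro cos_less) auto
    hence "szego_log \<rho> t \<phi> < szego_log \<rho> t (\<phi> * (1 - d'))" by (simp add: szego_log_def)
    thus "szego_fun \<rho> w > 0" using eq sec(2)[of "1 - d'"] d' by (simp add: w_def)
  qed (use near sec d' in \<open>auto simp: w_def\<close>)
  have w': "dist w' z1 < e'" "szego_fun \<rho> w' < 0"
  proof -
    have "cos (\<rho> * (\<phi> * (1 + d'))) < cos (\<rho> * (\<phi> * 1))" using d' near(2)[of "1 + d'"] by (intro cos_less) auto
    hence "szego_log \<rho> t (\<phi> * (1 + d')) < szego_log \<rho> t \<phi>" by (simp add: szego_log_def)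
    thus "szego_fun \<rho> w' < 0" using eq sec(2)[of "1 + d'"] d' by (simp add: w'_def)
  qed (use near d' in \<open>auto simp: w'_def\<close>)
  have "w' \<notin> \<real>\<^sub>\<le>\<^sub>0"
  proof -
    obtain v where "Re v > 0" "v powr of_real (1 / \<rho>) = w'"
      using sec(1)[of "1 + d'"] d' by (auto simp: in_sector_def w'_def)
    thus ?thesis using Ln_ml_root(3)[OF rho, of v] by (auto simp: complex_nonpos_Reals_iff)
  qed
  hence "\<forall>\<^sub>F z in nhds w'. szego_fun \<rho> z < 0"
    by (intro eventually_nhds_less isCont_szego_fun w')
  then obtain d2 where d2: "d2 > 0" "\<And>z. dist z w' < d2 \<Longrightarrow> szego_fun \<rho> z < 0"
    by (auto simp: eventually_nhds_metric)
  have "\<exists>n\<ge>1. \<exists>z\<in>ball z1 e'. z \<in> ml_roots \<rho> n 1"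
  proof (rule ml_root_near_sign_change)
    show "norm z > 1" if "z \<in> ball z1 e'" for z
      using that norm_triangle_ineq2[of z1 z] by (simp add: e'_def dist_norm nz1)
    show "norm (mittag_leffler \<rho> (of_real R * z)) \<le> K * exp (C * R powr \<rho>)" if "z \<in> ball z1 e'" "R > 0" for z R
      using that by (intro E) (auto simp: e'_def)
    show "w \<in> ball z1 e'" using w by (simp add: dist_commute)
    have "w' \<in> ball w' d2 \<inter> ball z1 e'" using d2 w' by (simp add: dist_commute)
    thus "ball w' d2 \<inter> ball z1 e' \<noteq> {}" by blast
    show "szego_fun \<rho> z < 0" if "z \<in> ball w' d2 \<inter> ball z1 e'" for z
      using that d2 by (auto simp: dist_commute)
  qed (use C w in auto)
  moreover have "ball z1 e' \<subseteq> ball z1 e" by (auto simp: e'_def)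
  ultimately show ?thesis unfolding z1_def by blast
qed

text \<open>For t >= 0 the equation is cos (\<rho> \<phi>) = (1 + \<rho> t) exp (-\<rho> t) with
  right side in (0, 1], so arccos parametrises the curve continuously by t. Raising t a little gives
  another point with t > 0; this covers t0 = 0, the point 1, where rotation does not cross the
  curve.\<close>

lemma szego_log_accumulates:
  assumes t0: "t0 \<ge> 0" and phi0: "\<bar>\<phi>0\<bar> < pi / (2 * \<rho>)" and eq: "szego_log \<rho> t0 \<phi>0 = 0" and e: "e > 0"
  obtains t \<phi> where "t > 0" "\<bar>\<phi>\<bar> < pi / (2 * \<rho>)" "szego_log \<rho> t \<phi> = 0"
    "exp (Complex t \<phi>) \<noteq> exp (Complex t0 \<phi>0)" "dist (exp (Complex t \<phi>)) (exp (Complex t0 \<phi>0)) < e"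
proof -
  define k where "k = (\<lambda>t. (1 + \<rho> * t) / exp (\<rho> * t))"
  \<comment> \<open>arccos yields only nonnegative angles; the sign selects the branch through the
    given point.\<close>
  define \<sigma> :: real where "\<sigma> = (if \<phi>0 \<ge> 0 then 1 else -1)"
  define p where "p = (\<lambda>t. \<sigma> * arccos (k t) / \<rho>)"
  have k: "0 < k t" "k t \<le> 1" if "t \<ge> 0" for t
    using that rho exp_ge_add_one_self[of "\<rho> * t"] unfolding k_def
    by (auto intro!: divide_pos_pos add_pos_nonneg simp: divide_le_eq_1)
  have cosp: "cos (\<rho> * p t) = k t" if "t \<ge> 0" for t
    using k[OF that] rho by (auto simp: p_def \<sigma>_def)
  have eq_p: "szego_log \<rho> t (p t) = 0" if "t \<ge> 0" for t
    unfolding szego_log_def cosp[OF that] by (simp add: k_def)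
  have "cos (\<rho> * \<bar>\<phi>0\<bar>) = k t0"
    using eq by (simp add: szego_log_def k_def abs_if field_simps)
  moreover have "\<rho> * \<bar>\<phi>0\<bar> < pi / 2" using phi0 rho by (simp add: field_simps)
  ultimately have "arccos (k t0) = \<rho> * \<bar>\<phi>0\<bar>" using arccos_cos[of "\<rho> * \<bar>\<phi>0\<bar>"] rho pi_gt_zero by simp
  hence p0: "p t0 = \<phi>0" using rho by (auto simp: p_def \<sigma>_def)
  define P where "P = (\<lambda>t. exp (Complex t (p t)))"
  have "continuous_on {0..} k" unfolding k_def by (intro continuous_intros) auto
  hence "continuous_on {0..} p" unfolding p_def using k rho by (intro continuous_intros) force+
  hence "continuous_on {0..} P" unfolding P_def Complex_eq by (intro continuous_intros)
  then obtain d where d: "d > 0" "\<And>t. t \<ge> 0 \<Longrightarrow> dist t t0 < d \<Longrightarrow> dist (P t) (P t0) < e"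
    unfolding continuous_on_iff using t0 e by fastforce
  define t where "t = t0 + d / 2"
  have t: "t > 0" "t > t0" "dist t t0 < d" using d t0 by (auto simp: t_def dist_real_def)
  have "arccos (k t) < arccos 0" using k[of t] t by (intro arccos_less_arccos) auto
  hence "\<bar>\<rho> * p t\<bar> < pi / 2" using k[of t] t rho arccos_lbound[of "k t"] by (auto simp: p_def \<sigma>_def)
  hence pt: "\<bar>p t\<bar> < pi / (2 * \<rho>)" using rho by (simp add: abs_mult field_simps)
  have "norm (P t) \<noteq> norm (P t0)" using t by (simp add: P_def norm_exp_eq_Re)
  hence "P t \<noteq> P t0" by metis
  thus ?thesis using that[of t "p t"] t pt eq_p[of t] d(2)[of t] by (simp add: P_def p0)
qed

text \<open>The roots are sought near a neighbouring curve point z1 instead of z0: an accumulation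
  point requires roots different from z0, and a ball about z1 of radius at most |z1 - z0| leaves z0
  out.\<close>

lemma szego_log_imp_ml_acc:
  assumes "t0 \<ge> 0" "\<bar>\<phi>0\<bar> < pi / (2 * \<rho>)" "szego_log \<rho> t0 \<phi>0 = 0"
  shows "exp (Complex t0 \<phi>0) \<in> ml_acc \<rho> 1"
  unfolding ml_acc_def mem_Collect_eq islimpt_approachable
proof (intro allI impI)
  fix e :: real assume e: "e > 0"
  define z0 where "z0 = exp (Complex t0 \<phi>0)"
  obtain t \<phi> where t: "t > 0" "\<bar>\<phi>\<bar> < pi / (2 * \<rho>)" "szego_log \<rho> t \<phi> = 0"
    "exp (Complex t \<phi>) \<noteq> z0" "dist (exp (Complex t \<phi>)) z0 < e"
    unfolding z0_def by (rule szego_log_accumulates[OF assms e]) 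
  define z1 where "z1 = exp (Complex t \<phi>)"
  define e' where "e' = min (dist z1 z0) (e - dist z1 z0)"
  have "e' > 0" using t by (simp add: e'_def z1_def)
  then obtain n z where z: "n \<ge> 1" "z \<in> ball z1 e'" "z \<in> ml_roots \<rho> n 1"
    using ml_root_near_szego_log[OF t(1-3), of e'] unfolding z1_def by blast
  have "z \<noteq> z0" using z(2) by (auto simp: e'_def)
  moreover have "dist z z0 < e" using z(2) dist_triangle[of z z0 z1] by (simp add: e'_def dist_commute)
  ultimately show "\<exists>x'\<in>\<Union>n\<in>{1..}. ml_roots \<rho> n 1. x' \<noteq> exp (Complex t0 \<phi>0) \<and> dist x' (exp (Complex t0 \<phi>0)) < e"
    using z unfolding z0_def by auto
qed

end

theorem mainTheorem5:
  fixes \<rho> :: real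
  assumes "\<rho> > 1"
  shows "ml_acc0 \<rho> 1 = szego_curve \<rho> \<inter> {z. norm z \<ge> 1}"
proof (intro equalityI subsetI)
  fix z assume "z \<in> ml_acc0 \<rho> 1"
  hence acc: "z \<in> ml_acc \<rho> 1" and z0: "z \<noteq> 0" by (auto simp: ml_acc0_def critical_rays_def)
  have n1: "norm z \<ge> 1" by (rule ml_acc_imp_szego(1)[OF assms acc z0])
  have "in_sector \<rho> z \<and> szego_fun \<rho> z = 0"
  proof (cases "z = 1")
    case True
    \<comment> \<open>The exceptional point satisfies the equation by itself, with t = \<phi> =
      0.\<close>
    have "in_sector \<rho> 1 \<and> szego_fun \<rho> 1 = 0" using sector_exp[OF assms, of 0] assms by (simp add: szego_log_def)
    thus ?thesis using True by simp
  qed (use ml_acc_imp_szego(2)[OF assms acc z0] in blast)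
  then obtain v where v: "Re v > 0" "v powr of_real (1 / \<rho>) = z" and sz: "szego_fun \<rho> z = 0"
    by (auto simp: in_sector_def)
  define \<phi> where "\<phi> = Im (Ln z)"
  have phi: "\<bar>\<phi>\<bar> < pi / (2 * \<rho>)" using Ln_ml_root(2)[OF assms v(1)] unfolding v(2) \<phi>_def .
  have Ln: "Re (Ln z) = ln (norm z)" using z0 by simp
  have sl: "szego_log \<rho> (ln (norm z)) \<phi> = 0"
    using sector_exp(2)[OF assms, of "Ln z"] phi sz z0 by (simp add: \<phi>_def)
  have "pi / 2 / \<rho> \<le> pi / 2 / 1" using assms by (intro divide_left_mono) auto
  hence "pi / (2 * \<rho>) \<le> pi / 2" by (simp only: divide_divide_eq_left div_by_1)
  hence "\<phi> < 2 * pi - pi / (2 * \<rho>)" using phi pi_gt_zero by linarith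
  moreover have "z = of_real (norm z) * cis \<phi>"
    using exp_eq_polar[of "Ln z"] z0 by (simp add: \<phi>_def)
  moreover have "norm z powr \<rho> * cos (\<phi> * \<rho>) - 1 - \<rho> * ln (norm z) = 0"
    using sl z0 by (simp add: szego_log_def powr_def mult.commute)
  ultimately have "z \<in> szego_curve \<rho>"
    using phi z0 unfolding szego_curve_def mem_Collect_eq
    by (intro exI[of _ "norm z"] exI[of _ \<phi>]) auto
  thus "z \<in> szego_curve \<rho> \<inter> {z. norm z \<ge> 1}" using n1 by simp
next
  fix z assume "z \<in> szego_curve \<rho> \<inter> {z. norm z \<ge> 1}"
  then obtain \<sigma> \<phi> where z: "z = of_real \<sigma> * cis \<phi>" "norm z \<ge> 1" "\<sigma> > 0" and
    range: "- (pi / (2 * \<rho>)) \<le> \<phi>" and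
    inside: "\<phi> \<le> pi / (2 * \<rho>) \<Longrightarrow> \<sigma> powr \<rho> * cos (\<phi> * \<rho>) - 1 - \<rho> * ln \<sigma> = 0" and
    outside: "pi / (2 * \<rho>) < \<phi> \<Longrightarrow> \<sigma> = exp (- (1 / \<rho>))"
    by (auto simp: szego_curve_def)
  have s1: "\<sigma> \<ge> 1" using z by (simp add: norm_mult)
  \<comment> \<open>The circular arc of the curve has radius exp (-1/\<rho>) < 1, so |z| >= 1 leaves
    only the part over the sector.\<close>
  have "\<phi> \<le> pi / (2 * \<rho>)"
  proof (rule ccontr)
    assume "\<not> ?thesis"
    hence "\<sigma> = exp (- (1 / \<rho>))" using outside by simp
    thus False using s1 assms by simp
  qed
  hence le: "\<bar>\<phi>\<bar> \<le> pi / (2 * \<rho>)" and eq: "\<sigma> powr \<rho> * cos (\<phi> * \<rho>) - 1 - \<rho> * ln \<sigma> = 0"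
    using range inside by auto
  \<comment> \<open>On the two rays the cosine vanishes and the equation becomes log \<sigma> =
    -1/\<rho>, against \<sigma> >= 1.\<close>
  have "\<bar>\<phi>\<bar> \<noteq> pi / (2 * \<rho>)"
  proof
    assume "\<bar>\<phi>\<bar> = pi / (2 * \<rho>)"
    hence "\<bar>\<phi>\<bar> * \<rho> = pi / 2" using assms by simp
    hence "cos (\<bar>\<phi>\<bar> * \<rho>) = 0" by (simp only: cos_pi_half)
    hence "cos (\<phi> * \<rho>) = 0" by (simp add: abs_if split: if_splits)
    moreover have "\<rho> * ln \<sigma> \<ge> 0" using s1 assms by simp
    ultimately show False using eq by simp
  qed
  hence lt: "\<bar>\<phi>\<bar> < pi / (2 * \<rho>)" using le by simp
  have z_exp: "z = exp (Complex (ln \<sigma>) \<phi>)" using z by (simp add: exp_eq_polar)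
  have "szego_log \<rho> (ln \<sigma>) \<phi> = 0" using eq z by (simp add: szego_log_def powr_def mult.commute)
  hence acc: "z \<in> ml_acc \<rho> 1" unfolding z_exp using s1 lt by (intro szego_log_imp_ml_acc[OF assms]) auto
  have "Ln z = Complex (ln \<sigma>) \<phi>" unfolding z_exp using sector_exp(3)[OF assms, of "Complex (ln \<sigma>) \<phi>"] lt by simp
  hence "Arg z = \<phi>" using z by (simp add: Arg_eq_Im_Ln)
  moreover have "\<phi> \<noteq> pi / (2 * \<rho>)" "\<phi> \<noteq> - (pi / (2 * \<rho>))" using lt by linarith+
  moreover have "z \<noteq> 0" using z by auto
  ultimately have "z \<notin> critical_rays \<rho>" by (simp add: critical_rays_def)
  with acc show "z \<in> ml_acc0 \<rho> 1" by (simp add: ml_acc0_def)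
qed

end
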